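(* Let $d\ge1$, $1\le p\le\infty$, $u\in L^p(\mathbb{R}^d)$ and $0\le\sigma<\eta<s\le1$. Then $$[u]_{W^{\eta,p}(\mathbb{R}^d)}\le\varkappa N_p(\sigma,\eta,s)\big([u]^p_{W^{\sigma,p}(\mathbb{R}^d)}+[u]^p_{W^{s,p}(\mathbb{R}^d)}\big)^{1/p},$$ $$[u]_{W^{\eta,p}(\mathbb{R}^d_+)}\le4^{1/p}\varkappa N_p(\sigma,\eta,s)\big([u]^p_{W^{\sigma,p}(\mathbb{R}^d_+)}+[u]^p_{W^{s,p}(\mathbb{R}^d_+)}\big)^{1/p},$$ where $N_p(\sigma,\eta,s)\le2^{1+\frac1p}$. In particular, for $\sigma=0$, $$[u]_{W^{\eta,p}(\mathbb{R}^d)}\le2^{1+\frac2p}(2|\mathbb{S}^{d-1}|+1)\big(\|u\|^p_{L^p(\mathbb{R}^d)}+[u]^p_{W^{s,p}(\mathbb{R}^d)}\big)^{1/p},$$ $$[u]_{W^{\eta,p}(\mathbb{R}^d_+)}\le2^{1+\frac4p}(2|\mathbb{S}^{d-1}|+1)\big(\|u\|^p_{L^p(\mathbb{R}^d_+)}+[u]^p_{W^{s,p}(\mathbb{R}^d_+)}\big)^{1/p}.$$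
   Context: Here $\varkappa=2^{1/p}$ if $d=1$, $\varkappa=1$ if $d\ge2$, and $N_p(\sigma,\eta,s)=2^{\frac{s-\eta}{s-\sigma}(\eta+1-\sigma)}\big(\frac{s-\sigma}{\eta-\sigma}\big)^{\frac{\eta-\sigma}{(s-\sigma)p}}\big(\frac{s-\sigma}{s-\eta}\big)^{\frac{s-\eta}{(s-\sigma)p}}$. $\mathbb{R}^d_+=\{x:x_d>0\}$; seminorms over $\mathbb{R}^d_+$ are of the restriction of $u$. $|\mathbb{S}^{d-1}|=2\pi^{d/2}/\Gamma(d/2)$, $K_{d,p}=\frac{\Gamma(d/2)\Gamma((p+1)/2)}{\Gamma((d+p)/2)\Gamma(1/2)}$. For $1\le p<\infty$ and $\Omega$ open, $[u]^p_{W^{s,p}(\Omega)}$ is $\frac{2|\mathbb{S}^{d-1}|}{p}\|u\|^p_{L^p(\Omega)}$ if $s=0$; $s(1-s)\iint_{\Omega\times\Omega}\frac{|u(x)-u(y)|^p}{|x-y|^{d+sp}}\,dy\,dx$ if $0<s<1$; $K_{d,p}\frac{|\mathbb{S}^{d-1}|}{p}\|\nabla u\|^p_{L^p(\Omega)}$ if $s=1$; it is $+\infty$ if $u\in L^p(\Omega)\setminus W^{s,p}(\Omega)$. For $p=\infty$, $[u]_{W^{s,\infty}(\Omega)}$ is $\|u\|_{L^\infty(\Omega)}$ if $s=0$; $\sup_{x\ne y}\frac{|u(x)-u(y)|}{|x-y|^s}$ if $0<s<1$; $\|\nabla u\|_{L^\infty(\Omega)}$ if $s=1$. For $p=\infty$,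 $1/p=0$ and $(A^p+B^p)^{1/p}$ is read as $\max(A,B)$. *)

theory Defs
  imports "HOL-Analysis.Analysis" "HOL-Probability.Essential_Supremum"
begin

text \<open>
  The space $R^d$ is \<open>real ^ 'n\<close> with $d$ = \<open>CARD('n)\<close>. The exponent $p$ ranges over \<open>ennreal\<close>, so
  that $p = \infty$ is included. Norms and seminorms are \<open>ennreal\<close>-valued; the value \<open>\<infinity>\<close> means
  that the function is not in the corresponding space.
\<close>

definition half_space :: "'n::finite \<Rightarrow> (real ^ 'n) set" where
  "half_space k = {x. x $ k > 0}"

text \<open>The number $1/p$, with $1/\infty = 0$.\<close>

definition recip :: "ennreal \<Rightarrow> real" where
  "recip p = (if p = \<infinity> then 0 else 1 / enn2real p)"

text \<open>Powers of extended nonnegative numbers; only meant for exponents \<open>a > 0\<close>.\<close>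

definition epow :: "ennreal \<Rightarrow> real \<Rightarrow> ennreal" where
  "epow x a = (if x = \<infinity> then \<infinity> else ennreal (enn2real x powr a))"

text \<open>The combination $(A^p + B^p)^{1/p}$, which is the maximum if $p = \infty$.\<close>

definition lp_sum :: "ennreal \<Rightarrow> ennreal \<Rightarrow> ennreal \<Rightarrow> ennreal" where
  "lp_sum p A B =
     (if p = \<infinity> then max A B
      else epow (epow A (enn2real p) + epow B (enn2real p)) (recip p))"

definition Lp_norm ::
  "ennreal \<Rightarrow> (real ^ 'n::finite) set \<Rightarrow> (real ^ 'n \<Rightarrow> 'b::real_normed_vector) \<Rightarrow> ennreal" where
  "Lp_norm p \<Omega> f =
     (if p = \<infinity> then esssup (lebesgue_on \<Omega>) (\<lambda>x. ennreal (norm (f x)))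
      else epow (\<integral>\<^sup>+x. ennreal (norm (f x) powr enn2real p) \<partial>lebesgue_on \<Omega>) (recip p))"

definition Lp_space ::
  "ennreal \<Rightarrow> (real ^ 'n::finite) set \<Rightarrow> (real ^ 'n \<Rightarrow> 'b::real_normed_vector) set" where
  "Lp_space p \<Omega> = {f \<in> borel_measurable (lebesgue_on \<Omega>). Lp_norm p \<Omega> f < \<infinity>}"

definition partial_deriv :: "'n::finite \<Rightarrow> (real ^ 'n \<Rightarrow> real) \<Rightarrow> real ^ 'n \<Rightarrow> real" where
  "partial_deriv i f x = frechet_derivative f (at x) (axis i 1)"

primrec Ck :: "nat \<Rightarrow> (real ^ 'n::finite \<Rightarrow> real) \<Rightarrow> bool" where
  "Ck 0 f \<longleftrightarrow> continuous_on UNIV f"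
| "Ck (Suc k) f \<longleftrightarrow> f differentiable_on UNIV \<and> (\<forall>i. Ck k (partial_deriv i f))"

definition test_fun :: "(real ^ 'n::finite) set \<Rightarrow> (real ^ 'n \<Rightarrow> real) \<Rightarrow> bool" where
  "test_fun \<Omega> \<phi> \<longleftrightarrow>
     (\<forall>k. Ck k \<phi>) \<and> compact (closure {x. \<phi> x \<noteq> 0}) \<and> closure {x. \<phi> x \<noteq> 0} \<subseteq> \<Omega>"

text \<open>
  \<open>g\<close> is a weak (distributional) gradient of \<open>u\<close> on the open set \<open>\<Omega>\<close>. Local integrability of \<open>g\<close>
  is required explicitly, since the Bochner integral of a non-integrable function is 0.
\<close>

definition weak_gradient ::
  "(real ^ 'n::finite) set \<Rightarrow> (real ^ 'n \<Rightarrow> real) \<Rightarrow> (real ^ 'n \<Rightarrow> real ^ 'n) \<Rightarrow> bool" where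
  "weak_gradient \<Omega> u g \<longleftrightarrow>
     g \<in> borel_measurable (lebesgue_on \<Omega>) \<and>
     (\<forall>K. compact K \<and> K \<subseteq> \<Omega> \<longrightarrow> integrable (lebesgue_on K) g) \<and>
     (\<forall>\<phi> i. test_fun \<Omega> \<phi> \<longrightarrow>
        (\<integral>x. u x * partial_deriv i \<phi> x \<partial>lebesgue_on \<Omega>) =
        - (\<integral>x. g x $ i * \<phi> x \<partial>lebesgue_on \<Omega>))"

text \<open>
  The $L^p$ norm of the weak gradient. The weak gradient is unique up to null sets, so the infimum
  is over a single value, or over the empty set (giving \<open>\<infinity>\<close>) if \<open>u\<close> has no weak gradient. Hence
  for \<open>u\<close> in $L^p$ the value is finite iff \<open>u\<close> is in $W^{1,p}$.
\<close>

definition grad_norm ::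
  "ennreal \<Rightarrow> (real ^ 'n::finite) set \<Rightarrow> (real ^ 'n \<Rightarrow> real) \<Rightarrow> ennreal" where
  "grad_norm p \<Omega> u = (INF g\<in>{g. weak_gradient \<Omega> u g}. Lp_norm p \<Omega> g)"

text \<open>
  The Hoelder seminorm of the a.e.-class of \<open>u\<close> on the open set \<open>\<Omega>\<close>. Elements of $L^\infty$ are
  classes of functions, so the supremum is taken for the continuous representative: a
  representative \<open>v\<close> with finite supremum is continuous, hence unique on \<open>\<Omega>\<close>, and the infimum is
  its seminorm. Without passing to representatives, changing \<open>u\<close> at one point would make the
  supremum infinite.
\<close>

definition hoelder_seminorm ::
  "real \<Rightarrow> (real ^ 'n::finite) set \<Rightarrow> (real ^ 'n \<Rightarrow> real) \<Rightarrow> ennreal" where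
  "hoelder_seminorm s \<Omega> u =
     (INF v\<in>{v. AE x in lebesgue_on \<Omega>. v x = u x}.
        SUP x\<in>\<Omega>. SUP y\<in>\<Omega> - {x}. ennreal (\<bar>v x - v y\<bar> / norm (x - y) powr s))"

definition sphere_area :: "nat \<Rightarrow> real" where
  "sphere_area d = 2 * pi powr (real d / 2) / Gamma (real d / 2)"

definition K_const :: "nat \<Rightarrow> real \<Rightarrow> real" where
  "K_const d p =
     (Gamma (real d / 2) * Gamma ((p + 1) / 2)) / (Gamma ((real d + p) / 2) * Gamma (1 / 2))"

text \<open>The $p$-th power of the seminorm, for finite $p$.\<close>

definition sobolev_pow ::
  "real \<Rightarrow> ennreal \<Rightarrow> (real ^ 'n::finite) set \<Rightarrow> (real ^ 'n \<Rightarrow> real) \<Rightarrow> ennreal" where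
  "sobolev_pow s p \<Omega> u =
     (let d = CARD('n); r = enn2real p in
      if s = 0 then ennreal (2 * sphere_area d / r) * epow (Lp_norm p \<Omega> u) r
      else if s = 1 then ennreal (K_const d r * (sphere_area d / r)) * epow (grad_norm p \<Omega> u) r
      else ennreal (s * (1 - s)) *
        (\<integral>\<^sup>+x. (\<integral>\<^sup>+y. ennreal (\<bar>u x - u y\<bar> powr r / norm (x - y) powr (real d + s * r))
           \<partial>lebesgue_on \<Omega>) \<partial>lebesgue_on \<Omega>))"

definition sobolev_seminorm ::
  "real \<Rightarrow> ennreal \<Rightarrow> (real ^ 'n::finite) set \<Rightarrow> (real ^ 'n \<Rightarrow> real) \<Rightarrow> ennreal" where
  "sobolev_seminorm s p \<Omega> u =
     (if p = \<infinity> then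
        (if s = 0 then Lp_norm \<infinity> \<Omega> u
         else if s = 1 then grad_norm \<infinity> \<Omega> u
         else hoelder_seminorm s \<Omega> u)
      else epow (sobolev_pow s p \<Omega> u) (recip p))"

definition kappa_const :: "nat \<Rightarrow> ennreal \<Rightarrow> real" where
  "kappa_const d p = (if d = 1 then 2 powr recip p else 1)"

definition N_const :: "ennreal \<Rightarrow> real \<Rightarrow> real \<Rightarrow> real \<Rightarrow> real" where
  "N_const p \<sigma> \<eta> s =
     2 powr ((s - \<eta>) / (s - \<sigma>) * (\<eta> + 1 - \<sigma>))
     * ((s - \<sigma>) / (\<eta> - \<sigma>)) powr ((\<eta> - \<sigma>) / (s - \<sigma>) * recip p)
     * ((s - \<sigma>) / (s - \<eta>)) powr ((s - \<eta>) / (s - \<sigma>) * recip p)"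

end

theory Submission
  imports Defs
begin

text \<open>
  Let $G(h)$ be the integral of $|u(x+h) - u(x)|^p$ over all $x$ with $x$ and $x+h$ in the domain.
  For $0 < s < 1$ the $p$-th power of the seminorm is $s(1-s)$ times the integral of
  $G(h) |h|^{-d-sp}$. The triangle inequality gives $G(2h) \<le> 2^p G(h)$ and
  $G(h) \<le> 2^{p-1} (G(lh) + G((l-1)h))$ for $l \<ge> 1$. By the first inequality $G(h)/|h|^p$ decreases
  along dyadic sequences, and this bounds the part $|h| < R$ of the integral for $\<eta>$ by the
  seminorm for $s$. Averaging the second one over $l$ with weight $l^{-1-\<sigma>p}$ bounds the part
  $|h| \<ge> R$ by the seminorm for $\<sigma>$. For a suitable $R$ the two constants agree, and their common
  value is at most $N^p$. At the end points one uses $G \<le> 2^p \<parallel>u\<parallel>^p$ and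
  $G(h) \<le> \<integral> |h \<cdot> \<nabla>u|^p$; the spherical mean of $|h \<cdot> e|^p$ produces $K_{d,p}$.

  These inequalities only involve collinear points, and $G$ is even. In the half space one may
  therefore take $h$ pointing inwards, and no extension operator is needed.

  For $p = \<infinity>$ the Hoelder quotients are interpolated pointwise. A function with a bounded weak
  gradient satisfies the Lipschitz bound for almost all pairs of points, hence has a Lipschitz
  representative.
\<close>

section \<open>Integrals over Euclidean space\<close>

text \<open>The normalising factors s(1-s) dictate the two one-sided estimates. Comparing the
  weights pointwise in h would already bound both parts of the integral, but with constants of order
  1/(1-s) near the origin and 1/\<sigma> at infinity. The dyadic argument recovers the quotient
  (1-s)/(1-\<eta>), the averaging argument the quotient \<sigma>/\<eta>; the other quotients
  \<eta>/s and (1-\<eta>)/(1-\<sigma>) are at most 1. With E =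
  (s-\<eta>)(\<eta>+1-\<sigma>)/(s-\<sigma>) the common constant for the best R is 2^{pE}, and the
  resulting inequality with constant 2^E holds on both domains. The other factor of N is the 1/p-th
  power of a number between 1 and 2, so 2^E \<le> N. Functions are given up to Lebesgue null sets,
  while translations and Fubini call for Borel functions on the whole space. The analysis is
  therefore done for a Borel representative of u; it is locally integrable on the whole space
  because u is in L^p there.\<close>

lemma nn_integral_lborel_affine:
  fixes t :: "'a::euclidean_space"
  assumes [measurable]: "f \<in> borel_measurable borel" and c: "c \<noteq> 0"
  shows "(\<integral>\<^sup>+x. f x \<partial>lborel) = ennreal (\<bar>c\<bar> ^ DIM('a)) * (\<integral>\<^sup>+x. f (t + c *\<^sub>R x) \<partial>lborel)"
  by (subst lborel_affine[OF c, of t])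
     (simp add: nn_integral_density nn_integral_distr nn_integral_cmult)

lemma nn_integral_lborel_scaleR:
  fixes f :: "'a::euclidean_space \<Rightarrow> ennreal"
  assumes f: "f \<in> borel_measurable borel" and c: "c > 0"
  shows "(\<integral>\<^sup>+x. f (c *\<^sub>R x) \<partial>lborel) = ennreal (c powr - real DIM('a)) * (\<integral>\<^sup>+x. f x \<partial>lborel)"
proof -
  have "ennreal (c powr - real DIM('a)) * (\<integral>\<^sup>+x. f x \<partial>lborel)
      = ennreal (c powr - real DIM('a)) * (ennreal (\<bar>c\<bar> ^ DIM('a)) * (\<integral>\<^sup>+x. f (c *\<^sub>R x) \<partial>lborel))"
    using nn_integral_lborel_affine[OF f, of c 0] c by simp
  also have "\<dots> = ennreal (c powr - real DIM('a) * c ^ DIM('a)) * (\<integral>\<^sup>+x. f (c *\<^sub>R x) \<partial>lborel)"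
    using c by (simp add: ennreal_mult mult.assoc)
  also have "c powr - real DIM('a) * c ^ DIM('a) = 1"
    using c by (simp add: powr_minus powr_realpow)
  finally show ?thesis by simp
qed

lemma nn_integral_lborel_translation:
  fixes f :: "'a::euclidean_space \<Rightarrow> ennreal"
  assumes f: "f \<in> borel_measurable borel"
  shows "(\<integral>\<^sup>+x. f (t + x) \<partial>lborel) = (\<integral>\<^sup>+x. f x \<partial>lborel)"
  using nn_integral_lborel_affine[OF f, of 1 t] by simp

lemma nn_integral_lborel_uminus:
  fixes f :: "'a::euclidean_space \<Rightarrow> ennreal"
  assumes f: "f \<in> borel_measurable borel"
  shows "(\<integral>\<^sup>+x. f (- x) \<partial>lborel) = (\<integral>\<^sup>+x. f x \<partial>lborel)"
  using nn_integral_lborel_affine[OF f, of "-1" 0] by simp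

lemma nn_integral_powr_from_0:
  assumes "a > -1" "c \<ge> 0"
  shows "(\<integral>\<^sup>+x. ennreal (x powr a) * indicator {0..c} x \<partial>lborel) = ennreal (c powr (a + 1) / (a + 1))"
  by (rule nn_integral_has_integral_lebesgue') (use assms has_integral_powr_from_0 in auto)

lemma nn_integral_powr_to_inf:
  assumes "a < -1" "c > 0"
  shows "(\<integral>\<^sup>+x. ennreal (x powr a) * indicator {c..} x \<partial>lborel) = ennreal (- (c powr (a + 1)) / (a + 1))"
  by (rule nn_integral_has_integral_lebesgue') (use assms has_integral_powr_to_inf in auto)

text \<open>The functional that sends f to the integral of f (T x) is translation invariant, so it
  is a multiple of the Lebesgue integral; the unit ball, which T preserves, shows that the multiple
  is 1. The proof carries this out by Fubini with the indicator \<open>B1\<close> of the ball as a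
  test function.\<close>

lemma nn_integral_lborel_orthogonal:
  fixes f :: "'a::euclidean_space \<Rightarrow> ennreal" and T :: "'a \<Rightarrow> 'a"
  assumes T: "orthogonal_transformation T" and f[measurable]: "f \<in> borel_measurable borel"
  shows "(\<integral>\<^sup>+x. f (T x) \<partial>lborel) = (\<integral>\<^sup>+x. f x \<partial>lborel)"
proof -
  have lin: "linear T" using T by (rule orthogonal_transformation_linear)
  have surj: "surj T" using T by (rule orthogonal_transformation_surj)
  have [measurable]: "T \<in> borel_measurable borel"
    by (intro borel_measurable_continuous_onI linear_continuous_on)
      (simp add: linear_conv_bounded_linear[symmetric] lin)
  define V where "V = emeasure lborel (ball (0::'a) 1)"
  define B1 :: "'a \<Rightarrow> ennreal" where "B1 x = indicator {x. norm x < 1} x" for x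
  have [measurable]: "B1 \<in> borel_measurable borel" unfolding B1_def by measurable
  have V: "V = (\<integral>\<^sup>+x. B1 x \<partial>lborel)"
    unfolding V_def B1_def by (subst nn_integral_indicator[symmetric]) (auto simp: ball_def indicator_def)
  have "V * (\<integral>\<^sup>+y. f (T y) \<partial>lborel) = (\<integral>\<^sup>+y. (\<integral>\<^sup>+x. B1 x \<partial>lborel) * f (T y) \<partial>lborel)"
    unfolding V by (rule nn_integral_cmult[symmetric]) measurable
  also have "\<dots> = (\<integral>\<^sup>+y. (\<integral>\<^sup>+x. B1 (T y + x) * f (T y) \<partial>lborel) \<partial>lborel)"
    by (simp add: nn_integral_multc nn_integral_lborel_translation[of B1])
  also have "\<dots> = (\<integral>\<^sup>+x. (\<integral>\<^sup>+y. B1 (T y + x) * f (T y) \<partial>lborel) \<partial>lborel)"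
    by (rule lborel_pair.Fubini') measurable
  \<comment> \<open>For fixed x = T z, the shift of y by - z moves x from the argument of
    \<open>B1\<close> to that of f.\<close>
  also have "\<dots> = (\<integral>\<^sup>+x. (\<integral>\<^sup>+y. B1 (T y) * f (T y - x) \<partial>lborel) \<partial>lborel)"
  proof (rule nn_integral_cong)
    fix x
    obtain z where z: "x = T z" using surj by (metis surjD)
    have "(\<integral>\<^sup>+y. B1 (T (- z + y) + x) * f (T (- z + y)) \<partial>lborel) = (\<integral>\<^sup>+y. B1 (T y + x) * f (T y) \<partial>lborel)"
      by (rule nn_integral_lborel_translation) measurable
    moreover have "T (- z + y) = T y - x" for y
      using linear_diff[OF lin, of y z] by (simp add: z)
    ultimately show "(\<integral>\<^sup>+y. B1 (T y + x) * f (T y) \<partial>lborel) = (\<integral>\<^sup>+y. B1 (T y) * f (T y - x) \<partial>lborel)"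
      by (simp only: diff_add_cancel)
  qed
  also have "\<dots> = (\<integral>\<^sup>+y. (\<integral>\<^sup>+x. B1 (T y) * f (T y - x) \<partial>lborel) \<partial>lborel)"
    by (rule lborel_pair.Fubini') measurable
  also have "\<dots> = (\<integral>\<^sup>+y. B1 (T y) * (\<integral>\<^sup>+x. f x \<partial>lborel) \<partial>lborel)"
  proof (rule nn_integral_cong)
    fix y
    have "(\<integral>\<^sup>+x. f (T y - x) \<partial>lborel) = (\<integral>\<^sup>+x. f x \<partial>lborel)"
      using nn_integral_lborel_affine[OF f, of "-1" "T y"] by simp
    then show "(\<integral>\<^sup>+x. B1 (T y) * f (T y - x) \<partial>lborel) = B1 (T y) * (\<integral>\<^sup>+x. f x \<partial>lborel)"
      by (simp add: nn_integral_cmult)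
  qed
  also have "\<dots> = V * (\<integral>\<^sup>+x. f x \<partial>lborel)"
  proof -
    have "B1 (T y) = B1 y" for y
      unfolding B1_def by (simp add: indicator_def orthogonal_transformation_norm[OF T])
    then show ?thesis unfolding V by (simp add: nn_integral_multc)
  qed
  finally have "V * (\<integral>\<^sup>+y. f (T y) \<partial>lborel) = V * (\<integral>\<^sup>+x. f x \<partial>lborel)" .
  moreover have "V = ennreal (measure lborel (ball (0::'a) 1))"
    unfolding V_def using emeasure_lborel_ball_finite[of "0::'a" 1] by (intro emeasure_eq_ennreal_measure) auto
  moreover have "measure lborel (ball (0::'a) 1) > 0"
    by (simp add: content_ball_pos)
  ultimately show ?thesis by (simp add: ennreal_mult_cancel_left)
qed

lemma nn_integral_inverse_unit_log_length:
  assumes "a > (0::real)"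
  shows "(\<integral>\<^sup>+t. ennreal (t powr -1) * indicator {a / exp 1<..a} t \<partial>lborel) = 1"
proof -
  have l: "a / exp 1 > 0" "a / exp 1 \<le> a" using assms by (auto simp: field_simps)
  have "(\<integral>\<^sup>+t. ennreal (t powr -1) * indicator {a / exp 1<..a} t \<partial>lborel)
      = (\<integral>\<^sup>+t. ennreal (t powr -1) * indicator {a / exp 1..a} t \<partial>lborel)"
  proof (rule nn_integral_cong_AE)
    show "AE t in lborel. ennreal (t powr -1) * indicator {a / exp 1<..a} t = ennreal (t powr -1) * indicator {a / exp 1..a} t"
      using AE_lborel_singleton[of "a / exp 1"] by eventually_elim (auto simp: indicator_def)
  qed
  also have "\<dots> = ennreal (ln a - ln (a / exp 1))"
  proof (rule nn_integral_has_integral_lebesgue')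
    show "((\<lambda>t. t powr -1) has_integral ln a - ln (a / exp 1)) {a / exp 1..a}"
    proof (rule fundamental_theorem_of_calculus[OF l(2)])
      fix x assume "x \<in> {a / exp 1..a}"
      then have "x > 0" using l by auto
      then have "(ln has_real_derivative x powr -1) (at x within {a / exp 1..a})"
        by (simp add: powr_minus DERIV_ln has_field_derivative_at_within)
      then show "(ln has_vector_derivative x powr -1) (at x within {a / exp 1..a})"
        by (simp add: has_real_derivative_iff_has_vector_derivative)
    qed
  qed auto
  also have "ln a - ln (a / exp 1) = 1" using assms by (simp add: ln_div)
  finally show ?thesis by simp
qed

lemma ennreal_half_mult_inverse: "G > 0 \<Longrightarrow> ennreal (G / 2) * ennreal (2 / G) = 1"
  by (simp flip: ennreal_mult)

section \<open>Radial integrals and the constants\<close>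

text \<open>The exponential width of the shell \<open>1 \<le> norm v < exp 1\<close> makes \<open>dt/t\<close> integrate to 1, so
  that this shell replaces the unit sphere in polar coordinates.\<close>

definition shell_integral :: "real \<Rightarrow> ('a::euclidean_space \<Rightarrow> ennreal) \<Rightarrow> ennreal" where
  "shell_integral q f =
     (\<integral>\<^sup>+v. f v * ennreal (norm v powr (- q - real DIM('a))) * indicator {v. 1 \<le> norm v \<and> norm v < exp 1} v \<partial>lborel)"

text \<open>Polar coordinates with a shell in place of the sphere: one inserts 1 = \<integral> dt/t
  over norm y / e < t \<le> norm y and writes y = t v, which puts v into the shell. By homogeneity
  \<open>shell_integral q f\<close> is the integral of f over the unit sphere. It is the same for
  every kernel k, so it can be evaluated with a Gaussian and then used with powers.\<close>

lemma nn_integral_homogeneous_radial: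
  fixes f :: "'a::euclidean_space \<Rightarrow> ennreal" and k :: "real \<Rightarrow> ennreal"
  assumes [measurable]: "f \<in> borel_measurable borel" "k \<in> borel_measurable borel"
    and hom: "\<And>t v. t > 0 \<Longrightarrow> f (t *\<^sub>R v) = ennreal (t powr q) * f v"
  shows "(\<integral>\<^sup>+h. f h * k (norm h) \<partial>lborel)
    = shell_integral q f * (\<integral>\<^sup>+t. k t * ennreal (t powr (q + real DIM('a) - 1)) * indicator {0<..} t \<partial>lborel)"
proof -
  define n where "n = real DIM('a)"
  define W :: "'a \<Rightarrow> ennreal" where "W v = indicator {v. 1 \<le> norm v \<and> norm v < exp 1} v" for v
  have [measurable]: "W \<in> borel_measurable borel" unfolding W_def by measurable
  let ?P = "\<lambda>t (y::'a). ennreal (t powr -1) * (if 0 < t \<and> t \<le> norm y \<and> norm y < t * exp 1 then 1 else 0)"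
  let ?Q = "\<lambda>t v. f (t *\<^sub>R v) * k (norm (t *\<^sub>R v)) * ennreal (t powr (n - 1)) * indicator {0<..} t"
  let ?D = "\<lambda>t. k t * ennreal (t powr (q + n - 1)) * indicator {0<..} t"
  define J where "J = (\<integral>\<^sup>+t. ?D t \<partial>lborel)"
  \<comment> \<open>The substitution t -> t / norm v frees k from v. The powers of norm v that this
    leaves form the weight in \<open>shell_integral\<close>.\<close>
  have radial: "(\<integral>\<^sup>+t. ?Q t v \<partial>lborel)
      = f v * ennreal (norm v powr (- q - n)) * J" if v: "norm v \<ge> 1" for v
  proof -
    let ?c = "norm v"
    have c: "?c > 0" using v by linarith
    have "(\<integral>\<^sup>+t. ?Q t v \<partial>lborel)
       = (\<integral>\<^sup>+t. f v * ennreal (?c powr (1 - q - n)) * (?D (?c * t)) \<partial>lborel)"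
    proof (rule nn_integral_cong)
      fix t :: real
      show "?Q t v
        = f v * ennreal (?c powr (1 - q - n)) * (?D (?c * t))"
      proof (cases "t > 0")
        case True
        have "?c powr (1 - q - n) * (?c * t) powr (q + n - 1) = (?c powr (1 - q - n) * ?c powr (q + n - 1)) * t powr (q + n - 1)"
          by (simp add: powr_mult)
        also have "?c powr (1 - q - n) * ?c powr (q + n - 1) = 1"
          using c by (subst powr_add[symmetric]) simp
        also have "1 * t powr (q + n - 1) = t powr q * t powr (n - 1)"
          by (subst powr_add[symmetric]) (simp add: algebra_simps)
        finally have "ennreal (?c powr (1 - q - n)) * ennreal ((?c * t) powr (q + n - 1)) = ennreal (t powr q) * ennreal (t powr (n - 1))"
          by (simp flip: ennreal_mult)
        then have "f v * k (?c * t) * (ennreal (t powr q) * ennreal (t powr (n - 1))) = f v * k (?c * t) * (ennreal (?c powr (1 - q - n)) * ennreal ((?c * t) powr (q + n - 1)))"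
          by simp
        then show ?thesis using True c by (simp add: hom mult_ac)
      next
        case False
        then show ?thesis using c by (auto simp: indicator_def zero_less_mult_iff)
      qed
    qed
    also have "\<dots> = f v * ennreal (?c powr (1 - q - n)) * (\<integral>\<^sup>+t. ?D (?c * t) \<partial>lborel)"
      by (rule nn_integral_cmult) measurable
    also have "(\<integral>\<^sup>+t. ?D (?c * t) \<partial>lborel) = ennreal (?c powr -1) * J"
      using nn_integral_lborel_scaleR[of "\<lambda>t. ?D t" ?c] c
      by (simp add: J_def)
    also have "f v * ennreal (?c powr (1 - q - n)) * (ennreal (?c powr -1) * J) = f v * (ennreal (?c powr (1 - q - n)) * ennreal (?c powr -1)) * J"
      by (simp only: mult_ac)
    also have "ennreal (?c powr (1 - q - n)) * ennreal (?c powr -1) = ennreal (?c powr (- q - n))"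
    proof -
      have "?c powr (1 - q - n) * ?c powr -1 = ?c powr (- q - n)" by (subst powr_add[symmetric]) simp
      then show ?thesis by (simp flip: ennreal_mult)
    qed
    finally show ?thesis .
  qed
  have "shell_integral q f * J = (\<integral>\<^sup>+v. f v * ennreal (norm v powr (- q - n)) * W v * J \<partial>lborel)"
    unfolding shell_integral_def W_def n_def by (rule nn_integral_multc[symmetric]) measurable
  also have "\<dots> = (\<integral>\<^sup>+v. W v * (\<integral>\<^sup>+t. ?Q t v \<partial>lborel) \<partial>lborel)"
  proof (rule nn_integral_cong)
    fix v :: 'a
    show "f v * ennreal (norm v powr (- q - n)) * W v * J = W v * (\<integral>\<^sup>+t. ?Q t v \<partial>lborel)"
    proof (cases "norm v \<ge> 1")
      case True
      show ?thesis unfolding radial[OF True] by (simp only: mult_ac)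
    qed (simp add: W_def)
  qed
  also have "\<dots> = (\<integral>\<^sup>+v. (\<integral>\<^sup>+t. W v * (?Q t v) \<partial>lborel) \<partial>lborel)"
    by (simp add: nn_integral_cmult)
  also have "\<dots> = (\<integral>\<^sup>+t. (\<integral>\<^sup>+v. W v * (?Q t v) \<partial>lborel) \<partial>lborel)"
    by (rule lborel_pair.Fubini') measurable
  \<comment> \<open>Substitution y = t v: the Jacobian t powr - n meets the factor t powr (n - 1)
    and leaves the logarithmic weight t powr -1.\<close>
  also have "\<dots> = (\<integral>\<^sup>+t. (\<integral>\<^sup>+y. f y * k (norm y) * (?P t y) \<partial>lborel) \<partial>lborel)"
  proof (rule nn_integral_cong)
    fix t :: real
    show "(\<integral>\<^sup>+v. W v * (?Q t v) \<partial>lborel)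
      = (\<integral>\<^sup>+y. f y * k (norm y) * (?P t y) \<partial>lborel)"
    proof (cases "t > 0")
      case True
      let ?F = "\<lambda>y. ennreal (t powr (n - 1)) * (W ((1 / t) *\<^sub>R y) * f y * k (norm y))"
      have "(\<integral>\<^sup>+v. W v * (?Q t v) \<partial>lborel)
         = (\<integral>\<^sup>+v. ?F (t *\<^sub>R v) \<partial>lborel)"
        using True by (simp add: mult_ac)
      also have "\<dots> = ennreal (t powr - n) * (\<integral>\<^sup>+v. ?F v \<partial>lborel)"
        unfolding n_def by (rule nn_integral_lborel_scaleR) (use True in auto)
      also have "\<dots> = (\<integral>\<^sup>+v. ennreal (t powr - n) * ?F v \<partial>lborel)"
        by (rule nn_integral_cmult[symmetric]) measurable
      also have "\<dots> = (\<integral>\<^sup>+y. f y * k (norm y) * (?P t y) \<partial>lborel)"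
      proof (rule nn_integral_cong)
        fix y :: 'a
        have "t powr - n * t powr (n - 1) = t powr -1" by (subst powr_add[symmetric]) simp
        then have 1: "ennreal (t powr - n) * ennreal (t powr (n - 1)) = ennreal (t powr -1)" by (simp flip: ennreal_mult)
        have 2: "W ((1 / t) *\<^sub>R y) = (if 0 < t \<and> t \<le> norm y \<and> norm y < t * exp 1 then 1 else 0)"
          using True by (auto simp: W_def indicator_def field_simps)
        have "ennreal (t powr - n) * ?F y = f y * k (norm y) * ((ennreal (t powr - n) * ennreal (t powr (n - 1))) * W ((1 / t) *\<^sub>R y))"
          by (simp only: mult_ac)
        then show "ennreal (t powr - n) * ?F y = f y * k (norm y) * (?P t y)"
          unfolding 1 2 .
      qed
      finally show ?thesis .
    qed simp
  qed
  also have "\<dots> = (\<integral>\<^sup>+y. (\<integral>\<^sup>+t. f y * k (norm y) * (?P t y) \<partial>lborel) \<partial>lborel)"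
    by (rule lborel_pair.Fubini') measurable
  also have "\<dots> = (\<integral>\<^sup>+y. f y * k (norm y) \<partial>lborel)"
  proof (rule nn_integral_cong_AE)
    show "AE y in lborel. (\<integral>\<^sup>+t. f y * k (norm y) * (?P t y) \<partial>lborel) = f y * k (norm y)"
      using AE_lborel_singleton[of "0::'a"]
    proof eventually_elim
      fix y :: 'a
      assume y: "y \<noteq> 0"
      have "(\<integral>\<^sup>+t. f y * k (norm y) * (?P t y) \<partial>lborel)
         = f y * k (norm y) * (\<integral>\<^sup>+t. (?P t y) \<partial>lborel)"
        by (rule nn_integral_cmult) measurable
      also have "(\<integral>\<^sup>+t. (?P t y) \<partial>lborel)
         = (\<integral>\<^sup>+t. ennreal (t powr -1) * indicator {norm y / exp 1<..norm y} t \<partial>lborel)"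
      proof (rule nn_integral_cong)
        fix t :: real
        have "norm y / exp 1 < t \<Longrightarrow> 0 < t" using y by (smt (verit) divide_pos_pos exp_gt_zero zero_less_norm_iff)
        then have "(if 0 < t \<and> t \<le> norm y \<and> norm y < t * exp 1 then 1 else 0) = (indicator {norm y / exp 1<..norm y} t :: ennreal)"
          by (auto simp: indicator_def field_simps)
        then show "?P t y = ennreal (t powr -1) * indicator {norm y / exp 1<..norm y} t"
          by (rule arg_cong)
      qed
      also have "\<dots> = 1" using y by (intro nn_integral_inverse_unit_log_length) simp
      finally show "(\<integral>\<^sup>+t. f y * k (norm y) * (?P t y) \<partial>lborel) = f y * k (norm y)"
        by simp
    qed
  qed
  finally show ?thesis unfolding J_def n_def ..
qed

text \<open>Writing exp (- t^2) as the integral of exp (- x) over x \<ge> t^2 and swapping the order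
  leaves the elementary integral of t powr (a - 1) up to sqrt x. What remains is the Gamma integral
  at a/2 + 1, and the recursion of Gamma turns Gamma (a/2 + 1) / a into Gamma (a/2) / 2.\<close>

lemma nn_integral_gaussian_powr:
  assumes a: "a > 0"
  shows "(\<integral>\<^sup>+t. ennreal (exp (- (t\<^sup>2))) * ennreal (t powr (a - 1)) * indicator {0<..} t \<partial>lborel) = ennreal (Gamma (a / 2) / 2)"
proof -
  let ?P = "\<lambda>t. (ennreal (t powr (a - 1)) * indicator {0<..} t)"
  let ?X = "\<lambda>t x. ennreal (exp (- x)) * (if t\<^sup>2 \<le> x then 1 else 0)"
  have tail: "ennreal (exp (- (t\<^sup>2))) = (\<integral>\<^sup>+x. ?X t x \<partial>lborel)" for t :: real
  proof -
    define c where "c = t\<^sup>2"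
    have "((\<lambda>x. exp (- x)) has_integral exp (- c)) {c..}"
      using has_integral_exp_minus_to_infinity[of 1 c] by simp
    from nn_integral_has_integral_lebesgue'[OF _ this] have "(\<integral>\<^sup>+x. ennreal (exp (- x)) * indicator {c..} x \<partial>lborel) = ennreal (exp (- c))"
      by simp
    then show ?thesis by (simp add: c_def indicator_def of_bool_def if_distrib cong: if_cong)
  qed
  have "(\<integral>\<^sup>+t. ennreal (exp (- (t\<^sup>2))) * ennreal (t powr (a - 1)) * indicator {0<..} t \<partial>lborel)
    = (\<integral>\<^sup>+t. (\<integral>\<^sup>+x. ?X t x \<partial>lborel) * ?P t \<partial>lborel)"
    by (simp only: tail mult.assoc)
  also have "\<dots> = (\<integral>\<^sup>+t. (\<integral>\<^sup>+x. ?X t x * ?P t \<partial>lborel) \<partial>lborel)"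
    by (intro nn_integral_cong nn_integral_multc[symmetric]) measurable
  also have "\<dots> = (\<integral>\<^sup>+x. (\<integral>\<^sup>+t. ?X t x * ?P t \<partial>lborel) \<partial>lborel)"
    by (rule lborel_pair.Fubini') measurable
  also have "\<dots> = (\<integral>\<^sup>+x. ennreal (x powr (a / 2 + 1 - 1) / exp x / a) * indicator {0..} x \<partial>lborel)"
  proof (rule nn_integral_cong)
    fix x :: real
    show "(\<integral>\<^sup>+t. ?X t x * ?P t \<partial>lborel)
      = ennreal (x powr (a / 2 + 1 - 1) / exp x / a) * indicator {0..} x"
    proof (cases "x \<ge> 0")
      case True
      have "(\<integral>\<^sup>+t. ?X t x * ?P t \<partial>lborel)
        = (\<integral>\<^sup>+t. ennreal (exp (- x)) * (ennreal (t powr (a - 1)) * indicator {0..sqrt x} t) \<partial>lborel)"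
      proof (rule nn_integral_cong)
        fix t :: real
        have "t > 0 \<Longrightarrow> t\<^sup>2 \<le> x \<longleftrightarrow> t \<le> sqrt x"
          using real_sqrt_le_iff[of "t\<^sup>2" x] by simp
        then show "?X t x * ?P t = ennreal (exp (- x)) * (ennreal (t powr (a - 1)) * indicator {0..sqrt x} t)"
          by (cases "t = 0") (auto simp: indicator_def)
      qed
      also have "\<dots> = ennreal (exp (- x)) * ennreal (sqrt x powr a / a)"
        using nn_integral_powr_from_0[of "a - 1" "sqrt x"] a True by (subst nn_integral_cmult) auto
      also have "sqrt x powr a = x powr (a / 2)"
        using True by (simp add: powr_half_sqrt[symmetric] powr_powr)
      finally show ?thesis using True a by (simp add: exp_minus field_simps flip: ennreal_mult)
    next
      case False
      then have "\<not> t\<^sup>2 \<le> x" for t using zero_le_power2[of t] by linarith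
      then show ?thesis using False by simp
    qed
  qed
  also have "\<dots> = ennreal (Gamma (a / 2 + 1) / a)"
  proof (rule nn_integral_has_integral_lebesgue')
    show "((\<lambda>x. x powr (a / 2 + 1 - 1) / exp x / a) has_integral Gamma (a / 2 + 1) / a) {0..}"
      using Gamma_integral_real[of "a / 2 + 1"] a by (intro has_integral_divide) simp
  qed (use a in auto)
  also have "Gamma (a / 2 + 1) = (a / 2) * Gamma (a / 2)"
    using a by (intro Gamma_plus1) (auto elim!: nonpos_Ints_cases)
  finally show ?thesis using a by simp
qed

lemma nn_integral_gaussian_abs_powr:
  assumes "a > -1"
  shows "(\<integral>\<^sup>+x. ennreal (exp (- (x\<^sup>2)) * \<bar>x\<bar> powr a) \<partial>lborel) = ennreal (Gamma ((a + 1) / 2))"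
proof -
  let ?g = "\<lambda>x::real. ennreal (exp (- (x\<^sup>2)) * \<bar>x\<bar> powr a) * indicator {0<..} x"
  have "(\<integral>\<^sup>+x. ennreal (exp (- (x\<^sup>2)) * \<bar>x\<bar> powr a) \<partial>lborel) = (\<integral>\<^sup>+x. ?g x + ?g (- x) \<partial>lborel)"
  proof (rule nn_integral_cong_AE)
    show "AE x in lborel. ennreal (exp (- (x\<^sup>2)) * \<bar>x\<bar> powr a) = ?g x + ?g (- x)"
      using AE_lborel_singleton[of "0::real"] by eventually_elim (auto simp: indicator_def)
  qed
  also have "\<dots> = (\<integral>\<^sup>+x. ?g x \<partial>lborel) + (\<integral>\<^sup>+x. ?g x \<partial>lborel)"
  proof -
    have "(\<integral>\<^sup>+x. ?g (- x) \<partial>lborel) = (\<integral>\<^sup>+x. ?g x \<partial>lborel)"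
      by (rule nn_integral_lborel_uminus) measurable
    moreover have "(\<integral>\<^sup>+x. ?g x + ?g (- x) \<partial>lborel) = (\<integral>\<^sup>+x. ?g x \<partial>lborel) + (\<integral>\<^sup>+x. ?g (- x) \<partial>lborel)"
      by (rule nn_integral_add) measurable
    ultimately show ?thesis by (simp only:)
  qed
  also have "(\<integral>\<^sup>+x. ?g x \<partial>lborel) = (\<integral>\<^sup>+t. ennreal (exp (- (t\<^sup>2))) * ennreal (t powr (a + 1 - 1)) * indicator {0<..} t \<partial>lborel)"
    by (intro nn_integral_cong) (auto simp: indicator_def ennreal_mult)
  also have "\<dots> = ennreal (Gamma ((a + 1) / 2) / 2)"
    using assms by (intro nn_integral_gaussian_powr) simp
  finally show ?thesis using assms by (simp flip: ennreal_plus)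
qed

lemma nn_integral_gaussian:
  "(\<integral>\<^sup>+x. ennreal (exp (- (x\<^sup>2))) \<partial>lborel) = ennreal (sqrt pi)"
proof -
  \<comment> \<open>The two integrands differ at x = 0, where \<open>0 powr 0 = 0\<close>.\<close>
  have "(\<integral>\<^sup>+x. ennreal (exp (- (x\<^sup>2))) \<partial>lborel) = (\<integral>\<^sup>+x. ennreal (exp (- (x\<^sup>2)) * \<bar>x\<bar> powr 0) \<partial>lborel)"
    by (rule nn_integral_cong_AE, use AE_lborel_singleton[of "0::real"] in eventually_elim) simp
  then show ?thesis using nn_integral_gaussian_abs_powr[of 0] by (simp add: Gamma_one_half_real)
qed

lemma exp_minus_norm_square_eq_prod: "exp (- ((norm (h::'a::euclidean_space))\<^sup>2)) = (\<Prod>b\<in>Basis. exp (- ((h \<bullet> b)\<^sup>2)))"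
proof -
  have "(norm h)\<^sup>2 = (\<Sum>b\<in>Basis. (h \<bullet> b)\<^sup>2)"
    by (metis (no_types, lifting) euclidean_inner power2_eq_square power2_norm_eq_inner sum.cong)
  then show ?thesis by (simp add: exp_sum[symmetric] sum_negf)
qed

text \<open>The Gaussian integral is evaluated twice: radially it is this constant times Gamma (d/2)
  / 2, as a product over the coordinates it is pi powr (d/2).\<close>

lemma shell_integral_const: 
  "shell_integral 0 (\<lambda>h::real ^ 'n::finite. 1) = ennreal (sphere_area CARD('n))"
proof -
  let ?d = "real CARD('n)"
  have "(\<integral>\<^sup>+(h::real^'n). 1 * ennreal (exp (- ((norm h)\<^sup>2))) \<partial>lborel)
     = shell_integral 0 (\<lambda>h::real^'n. 1) * (\<integral>\<^sup>+t. ennreal (exp (- (t\<^sup>2))) * ennreal (t powr (0 + real DIM(real^'n) - 1)) * indicator {0<..} t \<partial>lborel)"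
    by (rule nn_integral_homogeneous_radial) auto
  also have "\<dots> = shell_integral 0 (\<lambda>h::real^'n. 1) * ennreal (Gamma (?d / 2) / 2)"
    using nn_integral_gaussian_powr[of ?d] by simp
  also have "(\<integral>\<^sup>+(h::real^'n). 1 * ennreal (exp (- ((norm h)\<^sup>2))) \<partial>lborel) = (\<integral>\<^sup>+(h::real^'n). (\<Prod>b\<in>Basis. ennreal (exp (- ((h \<bullet> b)\<^sup>2)))) \<partial>lborel)"
    by (simp add: exp_minus_norm_square_eq_prod prod_ennreal)
  also have "\<dots> = (\<Prod>b\<in>(Basis::(real^'n) set). ennreal (sqrt pi))"
    unfolding nn_integral_gaussian[symmetric] by (rule nn_integral_lborel_prod) auto
  also have "\<dots> = ennreal (pi powr (?d / 2))"
    by (simp add: prod_ennreal powr_half_sqrt[symmetric] powr_realpow[symmetric] powr_powr ennreal_power)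
  finally have *: "shell_integral 0 (\<lambda>h::real^'n. 1) * ennreal (Gamma (?d / 2) / 2) = ennreal (pi powr (?d / 2))" ..
  have G: "Gamma (?d / 2) > 0" by (intro Gamma_real_pos) simp
  have "shell_integral 0 (\<lambda>h::real^'n. 1) = shell_integral 0 (\<lambda>h::real^'n. 1) * ennreal (Gamma (?d / 2) / 2) * ennreal (2 / Gamma (?d / 2))"
  proof -
    have "ennreal (Gamma (?d / 2) / 2) * ennreal (2 / Gamma (?d / 2)) = 1"
      using G by (rule ennreal_half_mult_inverse)
    then show ?thesis by (simp only: mult.assoc mult_1_right)
  qed
  also have "\<dots> = ennreal (sphere_area CARD('n))"
    unfolding * sphere_area_def using G by (simp add: mult_ac flip: ennreal_mult)
  finally show ?thesis .
qed

text \<open>Again a radial and a product evaluation are compared, now of |h \<bullet> e|^p times the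
  Gaussian. A rotation takes e to a coordinate axis; that coordinate then contributes Gamma
  ((p+1)/2) and each other one sqrt pi = Gamma (1/2).\<close>

lemma shell_integral_inner_unit:
  fixes e :: "real ^ 'n::finite"
  assumes e: "norm e = 1" and p: "p > 0"
  shows "shell_integral p (\<lambda>h. ennreal (\<bar>h \<bullet> e\<bar> powr p)) = ennreal (K_const CARD('n) p * sphere_area CARD('n))"
proof -
  let ?d = "real CARD('n)"
  let ?Q = "shell_integral p (\<lambda>h. ennreal (\<bar>h \<bullet> e\<bar> powr p))"
  obtain i :: 'n where True by blast
  obtain T :: "real^'n \<Rightarrow> real^'n" where T: "orthogonal_transformation T" and Te: "T (axis i 1) = e"
    using orthogonal_transformation_exists_1[of "axis i 1" e] e by (auto simp: norm_axis_1)
  define a where "a = (axis i 1 :: real^'n)"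
  have a: "a \<in> Basis" by (simp add: a_def axis_in_Basis_iff)
  have "(\<integral>\<^sup>+h. ennreal (\<bar>h \<bullet> e\<bar> powr p) * ennreal (exp (- ((norm h)\<^sup>2))) \<partial>lborel)
     = ?Q * (\<integral>\<^sup>+t. ennreal (exp (- (t\<^sup>2))) * ennreal (t powr (p + real DIM(real^'n) - 1)) * indicator {0<..} t \<partial>lborel)"
    by (rule nn_integral_homogeneous_radial) (auto simp: abs_mult powr_mult ennreal_mult)
  also have "\<dots> = ?Q * ennreal (Gamma ((p + ?d) / 2) / 2)"
    using nn_integral_gaussian_powr[of "p + ?d"] p by simp
  also have "(\<integral>\<^sup>+h. ennreal (\<bar>h \<bullet> e\<bar> powr p) * ennreal (exp (- ((norm h)\<^sup>2))) \<partial>lborel)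
     = (\<integral>\<^sup>+h. ennreal (\<bar>T h \<bullet> e\<bar> powr p) * ennreal (exp (- ((norm (T h))\<^sup>2))) \<partial>lborel)"
    by (rule nn_integral_lborel_orthogonal[OF T, symmetric]) auto
  also have "\<dots> = (\<integral>\<^sup>+h. ennreal (\<bar>h \<bullet> a\<bar> powr p) * ennreal (exp (- ((norm h)\<^sup>2))) \<partial>lborel)"
    using T unfolding a_def Te[symmetric] by (simp add: orthogonal_transformation_norm orthogonal_transformation_def)
  also have "\<dots> = (\<integral>\<^sup>+h. (\<Prod>b\<in>Basis. (\<lambda>x. if b = a then ennreal (exp (- (x\<^sup>2)) * \<bar>x\<bar> powr p) else ennreal (exp (- (x\<^sup>2)))) (h \<bullet> b)) \<partial>lborel)"
  proof (rule nn_integral_cong)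
    fix h :: "real^'n"
    have "(\<Prod>b\<in>Basis. if b = a then ennreal (exp (- ((h \<bullet> b)\<^sup>2)) * \<bar>h \<bullet> b\<bar> powr p) else ennreal (exp (- ((h \<bullet> b)\<^sup>2))))
       = (\<Prod>b\<in>Basis. ennreal (exp (- ((h \<bullet> b)\<^sup>2))) * (if b = a then ennreal (\<bar>h \<bullet> b\<bar> powr p) else 1))"
      by (intro prod.cong) (auto simp: ennreal_mult)
    also have "\<dots> = ennreal (exp (- ((norm h)\<^sup>2))) * ennreal (\<bar>h \<bullet> a\<bar> powr p)"
      using a by (simp add: prod.distrib exp_minus_norm_square_eq_prod prod_ennreal prod.delta)
    finally show "ennreal (\<bar>h \<bullet> a\<bar> powr p) * ennreal (exp (- ((norm h)\<^sup>2)))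
      = (\<Prod>b\<in>Basis. (\<lambda>x. if b = a then ennreal (exp (- (x\<^sup>2)) * \<bar>x\<bar> powr p) else ennreal (exp (- (x\<^sup>2)))) (h \<bullet> b))"
      by (simp add: mult.commute)
  qed
  also have "\<dots> = (\<Prod>b\<in>(Basis::(real^'n) set). \<integral>\<^sup>+x. (if b = a then ennreal (exp (- (x\<^sup>2)) * \<bar>x\<bar> powr p) else ennreal (exp (- (x\<^sup>2)))) \<partial>lborel)"
    by (rule nn_integral_lborel_prod) auto
  also have "\<dots> = (\<Prod>b\<in>(Basis::(real^'n) set). if b = a then ennreal (Gamma ((p + 1) / 2)) else ennreal (sqrt pi))"
    using p by (intro prod.cong) (auto simp: nn_integral_gaussian nn_integral_gaussian_abs_powr)
  also have "\<dots> = ennreal (Gamma ((p + 1) / 2)) * (\<Prod>b\<in>(Basis::(real^'n) set) - {a}. ennreal (sqrt pi))"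
    using a by (subst prod.remove[of _ a]) auto
  also have "(\<Prod>b\<in>(Basis::(real^'n) set) - {a}. ennreal (sqrt pi)) = ennreal (sqrt pi ^ (CARD('n) - 1))"
    using a by (simp add: ennreal_power card_Diff_singleton)
  also have "sqrt pi ^ (CARD('n) - 1) = pi powr (?d / 2) / sqrt pi"
  proof -
    have "sqrt pi ^ (CARD('n) - 1) * sqrt pi = sqrt pi ^ CARD('n)"
      by (metis One_nat_def Suc_pred mult.commute power_Suc zero_less_card_finite)
    also have "\<dots> = pi powr (?d / 2)"
      by (simp add: powr_half_sqrt[symmetric] powr_realpow[symmetric] powr_powr)
    finally show ?thesis by (simp add: field_simps)
  qed
  finally have *: "?Q * ennreal (Gamma ((p + ?d) / 2) / 2) = ennreal (Gamma ((p + 1) / 2)) * ennreal (pi powr (?d / 2) / sqrt pi)" ..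
  have G: "Gamma ((p + ?d) / 2) > 0" "Gamma (?d / 2) > 0" "Gamma ((p + 1) / 2) > 0" using p by (auto intro!: Gamma_real_pos)
  have "?Q = ?Q * ennreal (Gamma ((p + ?d) / 2) / 2) * ennreal (2 / Gamma ((p + ?d) / 2))"
    by (simp only: mult.assoc ennreal_half_mult_inverse[OF G(1)] mult_1_right)
  also have "\<dots> = ennreal (K_const CARD('n) p * sphere_area CARD('n))"
  proof -
    have "ennreal (Gamma ((p + 1) / 2)) * ennreal (pi powr (?d / 2) / sqrt pi) * ennreal (2 / Gamma ((p + ?d) / 2))
      = ennreal (Gamma ((p + 1) / 2) * (pi powr (?d / 2) / sqrt pi) * (2 / Gamma ((p + ?d) / 2)))"
    proof -
      have "ennreal a * ennreal b * ennreal c = ennreal (a * b * c)" if "b \<ge> 0" "c \<ge> 0" for a b c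
        using that by (simp add: ennreal_mult'')
      then show ?thesis using G by (simp only: divide_nonneg_pos less_imp_le pi_gt_zero real_sqrt_gt_zero powr_ge_zero zero_le_numeral)
    qed
    also have "Gamma ((p + 1) / 2) * (pi powr (?d / 2) / sqrt pi) * (2 / Gamma ((p + ?d) / 2)) = K_const CARD('n) p * sphere_area CARD('n)"
    proof -
      have c: "(?d + p) / 2 = (p + ?d) / 2" by simp
      have "b * (P / q) * (2 / a) = (g * b / (a * q)) * (2 * P / g)" if "g > 0" for a b g P q :: real
        using that by (simp add: field_simps)
      from this[OF G(2)] show ?thesis
        unfolding sphere_area_def K_const_def c Gamma_one_half_real .
    qed
    finally show ?thesis unfolding * .
  qed
  finally show ?thesis .
qed

section \<open>Radial weights away from the origin and near it\<close>

lemma nn_integral_far_powr: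
  assumes R: "R > 0" and b: "\<beta> > 0"
  shows "(\<integral>\<^sup>+h. ennreal (norm (h :: real ^ 'n::finite) powr (- \<beta> - real CARD('n))) * indicator {h. R \<le> norm h} h \<partial>lborel)
    = ennreal (sphere_area CARD('n) * (R powr - \<beta> / \<beta>))"
proof -
  let ?d = "real CARD('n)"
  let ?k = "\<lambda>t. ennreal (t powr (- \<beta> - ?d)) * indicator {R..} t"
  have "(\<integral>\<^sup>+(h::real^'n). ennreal (norm h powr (- \<beta> - ?d)) * indicator {h. R \<le> norm h} h \<partial>lborel)
    = (\<integral>\<^sup>+(h::real^'n). 1 * ?k (norm h) \<partial>lborel)"
    by (intro nn_integral_cong) (auto simp: indicator_def)
  also have "\<dots> = shell_integral 0 (\<lambda>h::real^'n. 1) * (\<integral>\<^sup>+t. ?k t * ennreal (t powr (0 + real DIM(real^'n) - 1)) * indicator {0<..} t \<partial>lborel)"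
    by (rule nn_integral_homogeneous_radial) auto
  also have "(\<integral>\<^sup>+t. ?k t * ennreal (t powr (0 + real DIM(real^'n) - 1)) * indicator {0<..} t \<partial>lborel)
     = (\<integral>\<^sup>+t. ennreal (t powr (- \<beta> - 1)) * indicator {R..} t \<partial>lborel)"
  proof (rule nn_integral_cong)
    fix t :: real
    have "t powr (- \<beta> - ?d) * t powr (?d - 1) = t powr (- \<beta> - 1)" by (subst powr_add[symmetric]) simp
    then show "?k t * ennreal (t powr (0 + real DIM(real^'n) - 1)) * indicator {0<..} t = ennreal (t powr (- \<beta> - 1)) * indicator {R..} t"
      using R by (auto simp: indicator_def simp flip: ennreal_mult)
  qed
  also have "\<dots> = ennreal (R powr - \<beta> / \<beta>)"
    using nn_integral_powr_to_inf[of "- \<beta> - 1" R] R b by simp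
  finally show ?thesis
    unfolding shell_integral_const using b by (subst ennreal_mult'') auto
qed

text \<open>The factor of degree p in h raises the radial exponent to p - \<beta> - 1, which is
  integrable at 0 because \<beta> < p. The direction of g enters only through a unit vector, hence
  through K.\<close>

lemma nn_integral_near_inner_powr:
  fixes g :: "real ^ 'n::finite"
  assumes R: "R > 0" and p: "p > 0" and b: "\<beta> < p"
  shows "(\<integral>\<^sup>+h. ennreal (\<bar>h \<bullet> g\<bar> powr p) * ennreal (norm h powr (- \<beta> - real CARD('n))) * indicator {h. norm h < R} h \<partial>lborel)
    = ennreal (K_const CARD('n) p * sphere_area CARD('n) * (R powr (p - \<beta>) / (p - \<beta>))) * ennreal (norm g powr p)"
proof (cases "g = 0")
  case False
  let ?d = "real CARD('n)"
  define e where "e = (1 / norm g) *\<^sub>R g"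
  have e: "norm e = 1" "g = norm g *\<^sub>R e" using False by (auto simp: e_def)
  have ge: "\<bar>h \<bullet> g\<bar> powr p = norm g powr p * \<bar>h \<bullet> e\<bar> powr p" for h
    by (subst e(2)) (simp add: abs_mult powr_mult)
  let ?k = "\<lambda>t. ennreal (t powr (- \<beta> - ?d)) * indicator {..<R} t"
  have "(\<integral>\<^sup>+h. ennreal (\<bar>h \<bullet> g\<bar> powr p) * ennreal (norm h powr (- \<beta> - ?d)) * indicator {h. norm h < R} h \<partial>lborel)
    = (\<integral>\<^sup>+h. ennreal (norm g powr p) * (ennreal (\<bar>h \<bullet> e\<bar> powr p) * ?k (norm h)) \<partial>lborel)"
    unfolding ge by (intro nn_integral_cong) (auto simp: indicator_def ennreal_mult mult_ac)
  also have "\<dots> = ennreal (norm g powr p) * (\<integral>\<^sup>+h. ennreal (\<bar>h \<bullet> e\<bar> powr p) * ?k (norm h) \<partial>lborel)"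
    by (rule nn_integral_cmult) measurable
  also have "(\<integral>\<^sup>+h. ennreal (\<bar>h \<bullet> e\<bar> powr p) * ?k (norm h) \<partial>lborel)
     = shell_integral p (\<lambda>h. ennreal (\<bar>h \<bullet> e\<bar> powr p)) * (\<integral>\<^sup>+t. ?k t * ennreal (t powr (p + real DIM(real^'n) - 1)) * indicator {0<..} t \<partial>lborel)"
    by (rule nn_integral_homogeneous_radial) (auto simp: abs_mult powr_mult ennreal_mult)
  also have "(\<integral>\<^sup>+t. ?k t * ennreal (t powr (p + real DIM(real^'n) - 1)) * indicator {0<..} t \<partial>lborel)
     = (\<integral>\<^sup>+t. ennreal (t powr (p - \<beta> - 1)) * indicator {0..R} t \<partial>lborel)"
  proof (rule nn_integral_cong_AE)
    show "AE t in lborel. ?k t * ennreal (t powr (p + real DIM(real^'n) - 1)) * indicator {0<..} t = ennreal (t powr (p - \<beta> - 1)) * indicator {0..R} t"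
      using AE_lborel_singleton[of R]
    proof eventually_elim
      fix t :: real assume t: "t \<noteq> R"
      have "t powr (- \<beta> - ?d) * t powr (p + ?d - 1) = t powr (p - \<beta> - 1)" by (subst powr_add[symmetric]) (simp add: algebra_simps)
      then show "?k t * ennreal (t powr (p + real DIM(real^'n) - 1)) * indicator {0<..} t = ennreal (t powr (p - \<beta> - 1)) * indicator {0..R} t"
        using t by (cases "t = 0") (auto simp: indicator_def simp flip: ennreal_mult)
    qed
  qed
  also have "\<dots> = ennreal (R powr (p - \<beta>) / (p - \<beta>))"
    using nn_integral_powr_from_0[of "p - \<beta> - 1" R] R b by simp
  finally show ?thesis
    unfolding shell_integral_inner_unit[OF e(1) p] using b by (subst ennreal_mult''[of "R powr (p - \<beta>) / (p - \<beta>)"]) (simp, simp only: mult_ac)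
next
  case True
  then show ?thesis using p by simp
qed

section \<open>Dyadic monotonicity near the origin, quasi-monotonicity at infinity\<close>

text \<open>The chord slope (2^x - 1)/x increases by convexity of the exponential; denominators are
  cleared. It supplies the quotient \<delta>/\<epsilon> in the dyadic estimate below.\<close>

lemma powr_2_minus_1_over_mono:
  fixes a b :: real
  assumes "0 < a" "a \<le> b"
  shows "b * (2 powr a - 1) \<le> a * (2 powr b - 1)"
proof -
  have "exp ((1 - a / b) * 0 + (a / b) * (b * ln 2)) \<le> (1 - a / b) * exp 0 + (a / b) * exp (b * ln 2)"
    using convex_onD[OF exp_convex, of "a / b" 0 "b * ln 2"] assms by simp
  then have "2 powr a \<le> 1 + (a / b) * (2 powr b - 1)"
    using assms by (simp add: powr_def algebra_simps)
  then show ?thesis using assms by (simp add: field_simps)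
qed

text \<open>The pointwise bound norm h powr (\<epsilon> - \<delta>) \<le> R powr (\<epsilon> -
  \<delta>) alone would lose the quotient \<delta>/\<epsilon>. It is therefore applied to D h = G h
  - 2^{-r} G (2h), which is nonnegative by the doubling hypothesis and whose weighted integral is (1
  - 2^{-a}) M a. The quotient of 1 - 2^{-\<delta>} by 1 - 2^{-\<epsilon>} is 2^{\<epsilon>-\<delta>}
  (2^\<delta> - 1)/(2^\<epsilon> - 1), at most 2^{\<epsilon>-\<delta>} \<delta>/\<epsilon>.\<close>

lemma dyadic_near_origin:
  fixes G :: "'a::euclidean_space \<Rightarrow> ennreal"
  assumes [measurable]: "G \<in> borel_measurable borel"
    and dbl: "\<And>h. G (2 *\<^sub>R h) \<le> ennreal (2 powr r) * G h"
    and R: "R > 0" and d: "0 < \<delta>" "\<delta> < \<epsilon>"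
  defines "M \<equiv> \<lambda>a. \<integral>\<^sup>+h. G h * ennreal (norm h powr (a - r - real DIM('a))) * indicator {h. norm h < R} h \<partial>lborel"
  shows "ennreal \<epsilon> * M \<epsilon> \<le> ennreal ((2 * R) powr (\<epsilon> - \<delta>) * \<delta>) * M \<delta>"
proof -
  define n where "n = real DIM('a)"
  \<comment> \<open>The indicator keeps 2h inside the ball of radius R, so that scaling by 2
    reproduces the same domain of integration.\<close>
  define D where "D h = G h - ennreal (2 powr - r) * G (2 *\<^sub>R h) * indicator {h. norm h < R / 2} h" for h
  define P where "P a = (\<integral>\<^sup>+h. D h * (ennreal (norm h powr (a - r - n)) * indicator {h. norm h < R} h) \<partial>lborel)" for a
  have [measurable]: "D \<in> borel_measurable borel" unfolding D_def by measurable
  let ?w = "\<lambda>a (h::'a). (ennreal (norm h powr (a - r - n)) * indicator {h. norm h < R} h)"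
  let ?g = "\<lambda>h. ennreal (2 powr - r) * G (2 *\<^sub>R h) * indicator {h. norm h < R / 2} h"
  let ?e = "\<lambda>a h. (G (2 *\<^sub>R h) * ennreal (norm (2 *\<^sub>R h) powr (a - r - n)) * indicator {h. norm h < R} (2 *\<^sub>R h))"
  have dbl': "ennreal (2 powr - r) * G (2 *\<^sub>R h) \<le> G h" for h
  proof -
    have "ennreal (2 powr - r) * G (2 *\<^sub>R h) \<le> ennreal (2 powr - r) * (ennreal (2 powr r) * G h)"
      by (intro mult_left_mono dbl) simp
    also have "\<dots> = ennreal (2 powr - r * 2 powr r) * G h"
      by (simp add: ennreal_mult mult.assoc)
    also have "2 powr - r * 2 powr r = (1::real)" by (simp flip: powr_add)
    finally show ?thesis by simp
  qed
  have Gd: "G h = D h + ?g h" for h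
    unfolding D_def using dbl'[of h]
    by (intro diff_add_cancel_ennreal[symmetric]) (auto split: split_indicator)
  \<comment> \<open>Stated as a sum and not as P a = (1 - 2^{-a}) M a, so that it also holds when M
    a is infinite.\<close>
  have split: "M a = P a + ennreal (2 powr - a) * M a" for a
  proof -
    have "M a = (\<integral>\<^sup>+h. D h * ?w a h
        + ?g h * ?w a h \<partial>lborel)"
      unfolding M_def n_def[symmetric] by (subst Gd) (simp add: algebra_simps)
    also have "\<dots> = P a + (\<integral>\<^sup>+h. ?g h * ?w a h \<partial>lborel)"
      unfolding P_def by (subst nn_integral_add) auto
    also have "(\<integral>\<^sup>+h. ?g h * ?w a h \<partial>lborel)
      = (\<integral>\<^sup>+h. ennreal (2 powr (n - a)) * ?e a h \<partial>lborel)"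
    proof (intro nn_integral_cong)
      fix h :: 'a
      have "2 powr (-r) * norm h powr (a - r - n) = 2 powr (n - a) * (norm (2 *\<^sub>R h) powr (a - r - n))"
        by (simp add: powr_mult powr_add[symmetric] mult.assoc[symmetric])
      then have "ennreal (2 powr - r) * ennreal (norm h powr (a - r - n)) = ennreal (2 powr (n - a)) * ennreal (norm (2 *\<^sub>R h) powr (a - r - n))"
        by (simp flip: ennreal_mult)
      moreover have "indicator {h. norm h < R / 2} h * (indicator {h. norm h < R} h :: ennreal) = indicator {h. norm h < R} (2 *\<^sub>R h)"
        using norm_ge_zero[of h] by (auto simp: indicator_def simp del: norm_ge_zero)
      ultimately have "(ennreal (2 powr - r) * ennreal (norm h powr (a - r - n))) * G (2 *\<^sub>R h)
          * (indicator {h. norm h < R / 2} h * indicator {h. norm h < R} h)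
        = (ennreal (2 powr (n - a)) * ennreal (norm (2 *\<^sub>R h) powr (a - r - n))) * G (2 *\<^sub>R h)
          * indicator {h. norm h < R} (2 *\<^sub>R h)"
        by (simp only:)
      then show "?g h * ?w a h
         = ennreal (2 powr (n - a)) * ?e a h"
        by (simp only: mult_ac)
    qed
    also have "\<dots> = ennreal (2 powr (n - a)) * (\<integral>\<^sup>+h. ?e a h \<partial>lborel)"
      by (rule nn_integral_cmult) measurable
    also have "\<dots> = ennreal (2 powr (n - a)) * (ennreal (2 powr - n) * M a)"
      unfolding M_def n_def
      by (subst nn_integral_lborel_scaleR[where f="\<lambda>h. G h * ennreal (norm h powr (a - r - real DIM('a))) * indicator {h. norm h < R} h"]) auto
    also have "\<dots> = ennreal (2 powr (n - a) * 2 powr - n) * M a" 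
      by (simp add: ennreal_mult mult.assoc)
    also have "2 powr (n - a) * 2 powr - n = 2 powr - a" by (simp flip: powr_add)
    finally show ?thesis .
  qed
  have Wle: "ennreal (norm h powr (\<epsilon> - r - n)) * indicator {h. norm h < R} h \<le> ennreal (R powr (\<epsilon> - \<delta>)) * ?w \<delta> h" for h :: 'a
  proof (cases "norm h < R")
    case True
    have "norm h powr (\<epsilon> - r - n) = norm h powr (\<epsilon> - \<delta>) * norm h powr (\<delta> - r - n)"
      by (subst powr_add[symmetric]) (simp add: algebra_simps)
    also have "\<dots> \<le> R powr (\<epsilon> - \<delta>) * norm h powr (\<delta> - r - n)"
      using True d by (intro mult_right_mono powr_mono2) auto
    finally show ?thesis using True by (simp flip: ennreal_mult)
  qed simp
  have mono: "N \<epsilon> \<le> ennreal (R powr (\<epsilon> - \<delta>)) * N \<delta>" 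
    if N: "\<And>a. N a = (\<integral>\<^sup>+h. f h * ?w a h \<partial>lborel)"
    and [measurable]: "f \<in> borel_measurable borel" for N and f :: "'a \<Rightarrow> ennreal"
  proof -
    have "N \<epsilon> \<le> (\<integral>\<^sup>+h. ennreal (R powr (\<epsilon> - \<delta>)) * (f h * ?w \<delta> h) \<partial>lborel)"
      unfolding N using Wle by (intro nn_integral_mono) (metis mult.left_commute mult_left_mono zero_le)
    also have "\<dots> = ennreal (R powr (\<epsilon> - \<delta>)) * N \<delta>"
      unfolding N by (rule nn_integral_cmult) measurable
    finally show ?thesis .
  qed
  \<comment> \<open>The crude bound serves to show that M \<epsilon> is finite when M \<delta> is,
    which makes the subtractions below possible.\<close>
  have MM: "M \<epsilon> \<le> ennreal (R powr (\<epsilon> - \<delta>)) * M \<delta>"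
    by (rule mono[where f=G]) (auto simp: M_def n_def mult.assoc)
  have PP: "P \<epsilon> \<le> ennreal (R powr (\<epsilon> - \<delta>)) * P \<delta>"
    by (rule mono[where f=D]) (auto simp: P_def)
  show ?thesis
  proof (cases "M \<delta> = \<infinity>")
    case True
    then show ?thesis using R d by (simp add: ennreal_mult_top)
  next
    case False
    then obtain m where m: "M \<delta> = ennreal m" "m \<ge> 0" by (cases "M \<delta>") auto
    have "M \<epsilon> \<noteq> \<infinity>" using MM m by (auto simp: top_unique simp flip: ennreal_mult)
    then obtain k where k: "M \<epsilon> = ennreal k" "k \<ge> 0" by (cases "M \<epsilon>") auto
    have fin: "P a \<noteq> \<infinity>" if "M a \<noteq> \<infinity>" for a using split[of a] that by auto
    obtain p where p: "P \<delta> = ennreal p" "p \<ge> 0" using fin[of \<delta>] m by (cases "P \<delta>") auto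
    obtain q where q: "P \<epsilon> = ennreal q" "q \<ge> 0" using fin[of \<epsilon>] k by (cases "P \<epsilon>") auto
    have 1: "m = p + 2 powr - \<delta> * m" using split[of \<delta>] m p by (simp flip: ennreal_mult ennreal_plus)
    have 2: "k = q + 2 powr - \<epsilon> * k" using split[of \<epsilon>] k q by (simp flip: ennreal_mult ennreal_plus)
    have 3: "q \<le> R powr (\<epsilon> - \<delta>) * p" using PP p q by (simp flip: ennreal_mult)
    have scale: "x * (2 powr c - 1) = 2 powr c * y" if "x = y + 2 powr - c * x" for x y c :: real
    proof -
      have "2 powr c * 2 powr - c = (1::real)" by (simp flip: powr_add)
      then show ?thesis using that by algebra
    qed
    note k1 = scale[OF 2] and m1 = scale[OF 1]
    have E: "2 powr \<epsilon> > (1::real)" "2 powr \<delta> > (1::real)" using d by auto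
    have "(\<epsilon> * k) * (2 powr \<epsilon> - 1) \<le> \<epsilon> * (2 powr \<epsilon> * (R powr (\<epsilon> - \<delta>) * p))"
      using k1 3 d by (simp add: mult.assoc)
    also have "\<dots> = R powr (\<epsilon> - \<delta>) * 2 powr (\<epsilon> - \<delta>) * (\<epsilon> * (2 powr \<delta> * p))"
      by (simp add: powr_diff)
    also have "\<dots> = (2 * R) powr (\<epsilon> - \<delta>) * m * (\<epsilon> * (2 powr \<delta> - 1))"
      using R by (simp add: m1[symmetric] powr_mult)
    also have "\<dots> \<le> (2 * R) powr (\<epsilon> - \<delta>) * m * (\<delta> * (2 powr \<epsilon> - 1))"
      using powr_2_minus_1_over_mono[of \<delta> \<epsilon>] d m by (intro mult_left_mono) auto
    finally have "(\<epsilon> * k) * (2 powr \<epsilon> - 1) \<le> ((2 * R) powr (\<epsilon> - \<delta>) * \<delta> * m) * (2 powr \<epsilon> - 1)"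
      by (simp add: algebra_simps)
    then have "\<epsilon> * k \<le> (2 * R) powr (\<epsilon> - \<delta>) * \<delta> * m" using E by simp
    then show ?thesis using m k d by (simp flip: ennreal_mult)
  qed
qed

text \<open>Let X and Y be the two integrals and \<gamma> = \<beta> - \<alpha>. Integrating the
  hypothesis over l > 1 against l powr (-1-\<alpha>), whose integral is 1/\<alpha>, and then over h
  gives X/\<alpha> \<le> q (T1 + T2), where \<open>T1\<close> and \<open>T2\<close> collect the
  dilates l h with l > 1 and l > 0. Substituting y = l h turns the exponent \<beta> into \<alpha>:
  T2 = R^{-\<gamma>} Y / \<gamma>, while T1 starts at l = 1 and is smaller by at least X/\<gamma>.
  This gain moves to the left side, where 1/\<alpha> grows to at least 1/\<alpha> + 1/\<gamma> as q
  \<ge> 1; the bound thus has \<alpha>/\<beta> instead of \<alpha>/\<gamma>.\<close>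

lemma quasi_monotone_near_infinity:
  fixes G :: "'a::euclidean_space \<Rightarrow> ennreal"
  assumes [measurable]: "G \<in> borel_measurable borel"
    and qm: "\<And>h l. l \<ge> 1 \<Longrightarrow> G h \<le> ennreal q * (G (l *\<^sub>R h) + G ((l - 1) *\<^sub>R h))"
    and q: "q \<ge> 1" and R: "R > 0" and ab: "0 < \<alpha>" "\<alpha> < \<beta>"
  shows "ennreal \<beta> * (\<integral>\<^sup>+h. G h * ennreal (norm h powr (- \<beta> - real DIM('a))) * indicator {h. R \<le> norm h} h \<partial>lborel)
    \<le> ennreal (2 * q * R powr (\<alpha> - \<beta>) * \<alpha>) * (\<integral>\<^sup>+h. G h * ennreal (norm h powr (- \<alpha> - real DIM('a))) \<partial>lborel)"
proof -
  define n where "n = real DIM('a)"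
  define \<gamma> where "\<gamma> = \<beta> - \<alpha>"
  have \<gamma>: "\<gamma> > 0" using ab by (simp add: \<gamma>_def)
  define k :: "'a \<Rightarrow> ennreal" where "k h = ennreal (norm h powr (- \<beta> - n)) * indicator {h. R \<le> norm h} h" for h
  have [measurable]: "k \<in> borel_measurable borel" unfolding k_def by measurable
  define X where "X = (\<integral>\<^sup>+h. G h * k h \<partial>lborel)"
  define Y where "Y = (\<integral>\<^sup>+h. G h * ennreal (norm h powr (- \<alpha> - n)) \<partial>lborel)"
  define w where "w l = ennreal (l powr (- 1 - \<alpha>))" for l
  have [measurable]: "w \<in> borel_measurable borel" unfolding w_def by measurable
  let ?I = "\<lambda>c h. (\<integral>\<^sup>+l. w l * G (l *\<^sub>R h) * indicator {c<..} l \<partial>lborel)"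
  let ?P = "\<lambda>c (y::'a) l. ennreal (l powr (\<gamma> - 1)) * indicator {c<..norm y / R} l"
  let ?V = "\<lambda>(y::'a). ennreal (norm y powr (- \<beta> - n))"
  let ?Y = "\<lambda>y. (G y * ennreal (norm y powr (- \<alpha> - n)))"
  define T1 where "T1 = (\<integral>\<^sup>+h. k h * ?I 1 h \<partial>lborel)"
  define T2 where "T2 = (\<integral>\<^sup>+h. k h * ?I 0 h \<partial>lborel)"
  have ind_if: "indicator {a<..b} x = (if a < x \<and> x \<le> b then 1 else (0::ennreal))" for a b x :: real
    by (simp add: indicator_def)
  \<comment> \<open>The condition R \<le> norm h becomes l \<le> norm y / R after y = l h, so the
    integral over l ends at norm y / R.\<close>
  have swap: "(\<integral>\<^sup>+h. k h * ?I c h \<partial>lborel)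
    = (\<integral>\<^sup>+y. G y * ?V y * (\<integral>\<^sup>+l. ?P c y l \<partial>lborel) \<partial>lborel)"
    if c: "c \<ge> 0" for c :: real
  proof -
    have inner: "(\<integral>\<^sup>+h. k h * G (l *\<^sub>R h) \<partial>lborel) * w l * indicator {c<..} l
      = (\<integral>\<^sup>+y. G y * ?V y * (?P c y l) \<partial>lborel)" for l
    proof (cases "l > c")
      case True
      then have l: "l > 0" using c by simp
      have kl: "k h = k ((1 / l) *\<^sub>R (l *\<^sub>R h))" for h using l by simp
      have "(\<integral>\<^sup>+h. k h * G (l *\<^sub>R h) \<partial>lborel) = (\<integral>\<^sup>+h. (\<lambda>y. k ((1 / l) *\<^sub>R y) * G y) (l *\<^sub>R h) \<partial>lborel)"
        using l by simp
      also have "\<dots> = ennreal (l powr - n) * (\<integral>\<^sup>+y. k ((1 / l) *\<^sub>R y) * G y \<partial>lborel)"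
        unfolding n_def by (rule nn_integral_lborel_scaleR) (use l in auto)
      finally have "(\<integral>\<^sup>+h. k h * G (l *\<^sub>R h) \<partial>lborel) * w l * indicator {c<..} l
        = (\<integral>\<^sup>+y. (ennreal (l powr - n) * w l) * (k ((1 / l) *\<^sub>R y) * G y) \<partial>lborel)"
        using True by (subst nn_integral_cmult) (auto simp: mult_ac)
      also have "\<dots> = (\<integral>\<^sup>+y. G y * ?V y * (?P c y l) \<partial>lborel)"
      proof (intro nn_integral_cong)
        fix y :: 'a
        have ind: "indicator {h. R \<le> norm h} ((1 / l) *\<^sub>R y) = (indicator {c<..norm y / R} l :: ennreal)"
          using l True R by (auto simp: indicator_def field_simps)
        have "l powr - n * l powr (- 1 - \<alpha>) * norm ((1 / l) *\<^sub>R y) powr (- \<beta> - n) = norm y powr (- \<beta> - n) * l powr (\<gamma> - 1)"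
        proof -
          have "norm ((1 / l) *\<^sub>R y) powr (- \<beta> - n) = l powr (\<beta> + n) * norm y powr (- \<beta> - n)"
          proof -
            have "norm ((1 / l) *\<^sub>R y) = l powr - 1 * norm y"
              using l by (simp add: powr_minus divide_inverse)
            then show ?thesis by (simp only: powr_mult powr_powr) (simp add: algebra_simps)
          qed
          moreover have "l powr - n * l powr (- 1 - \<alpha>) * l powr (\<beta> + n) = l powr (\<gamma> - 1)"
            unfolding \<gamma>_def powr_add[symmetric] by (simp add: algebra_simps)
          ultimately show ?thesis by (metis mult.assoc mult.commute)
        qed
        then have e: "ennreal (l powr - n) * w l * ennreal (norm ((1 / l) *\<^sub>R y) powr (- \<beta> - n)) = ?V y * ennreal (l powr (\<gamma> - 1))"
          unfolding w_def by (simp flip: ennreal_mult)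
        have "(ennreal (l powr - n) * w l) * (k ((1 / l) *\<^sub>R y) * G y)
          = (ennreal (l powr - n) * w l * ennreal (norm ((1 / l) *\<^sub>R y) powr (- \<beta> - n))) * G y * indicator {h. R \<le> norm h} ((1 / l) *\<^sub>R y)"
          unfolding k_def by (simp only: mult_ac)
        also have "\<dots> = (?V y * ennreal (l powr (\<gamma> - 1))) * G y * indicator {c<..norm y / R} l"
          unfolding e ind ..
        finally show "(ennreal (l powr - n) * w l) * (k ((1 / l) *\<^sub>R y) * G y) = G y * ?V y * (?P c y l)"
          by (simp only: mult_ac)
      qed
      finally show ?thesis .
    qed auto
    have "(\<integral>\<^sup>+h. k h * ?I c h \<partial>lborel)
       = (\<integral>\<^sup>+h. (\<integral>\<^sup>+l. k h * (w l * G (l *\<^sub>R h) * indicator {c<..} l) \<partial>lborel) \<partial>lborel)"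
      by (simp add: nn_integral_cmult)
    also have "\<dots> = (\<integral>\<^sup>+l. (\<integral>\<^sup>+h. k h * (w l * G (l *\<^sub>R h) * indicator {c<..} l) \<partial>lborel) \<partial>lborel)"
      by (rule lborel_pair.Fubini') measurable
    also have "\<dots> = (\<integral>\<^sup>+l. (\<integral>\<^sup>+h. k h * G (l *\<^sub>R h) \<partial>lborel) * w l * indicator {c<..} l \<partial>lborel)"
    proof (intro nn_integral_cong)
      fix l
      have "(\<integral>\<^sup>+h. k h * (w l * G (l *\<^sub>R h) * indicator {c<..} l) \<partial>lborel) = (\<integral>\<^sup>+h. (k h * G (l *\<^sub>R h)) * (w l * indicator {c<..} l) \<partial>lborel)"
        by (simp only: mult_ac)
      also have "\<dots> = (\<integral>\<^sup>+h. k h * G (l *\<^sub>R h) \<partial>lborel) * (w l * indicator {c<..} l)"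
        by (rule nn_integral_multc) measurable
      finally show "(\<integral>\<^sup>+h. k h * (w l * G (l *\<^sub>R h) * indicator {c<..} l) \<partial>lborel) = (\<integral>\<^sup>+h. k h * G (l *\<^sub>R h) \<partial>lborel) * w l * indicator {c<..} l"
        by (simp only: mult.assoc)
    qed
    also have "\<dots> = (\<integral>\<^sup>+l. (\<integral>\<^sup>+y. G y * ?V y * (?P c y l) \<partial>lborel) \<partial>lborel)"
      unfolding inner ..
    also have "\<dots> = (\<integral>\<^sup>+y. (\<integral>\<^sup>+l. G y * ?V y * (?P c y l) \<partial>lborel) \<partial>lborel)"
      unfolding ind_if by (rule lborel_pair.Fubini') measurable
    also have "\<dots> = (\<integral>\<^sup>+y. G y * ?V y * (\<integral>\<^sup>+l. ?P c y l \<partial>lborel) \<partial>lborel)"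
      by (simp add: nn_integral_cmult)
    finally show ?thesis .
  qed
  have I0: "(\<integral>\<^sup>+l. ennreal (l powr (\<gamma> - 1)) * indicator {0<..z} l \<partial>lborel) = ennreal (z powr \<gamma> / \<gamma>)" if "z \<ge> 0" for z
  proof -
    have "(\<integral>\<^sup>+l. ennreal (l powr (\<gamma> - 1)) * indicator {0<..z} l \<partial>lborel) = (\<integral>\<^sup>+l. ennreal (l powr (\<gamma> - 1)) * indicator {0..z} l \<partial>lborel)"
      by (intro nn_integral_cong) (auto simp: indicator_def)
    then show ?thesis using nn_integral_powr_from_0[of "\<gamma> - 1" z] \<gamma> that by simp
  qed
  \<comment> \<open>The interval from 0 to z is split at 1; the piece up to 1 contributes
    1/\<gamma>.\<close>
  have I1: "(\<integral>\<^sup>+l. ennreal (l powr (\<gamma> - 1)) * indicator {1<..z} l \<partial>lborel) + ennreal (1 / \<gamma>) = ennreal (z powr \<gamma> / \<gamma>)" if "z \<ge> 1" for z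
  proof -
    have "ennreal (z powr \<gamma> / \<gamma>) = (\<integral>\<^sup>+l. ennreal (l powr (\<gamma> - 1)) * indicator {1<..z} l + ennreal (l powr (\<gamma> - 1)) * indicator {0<..1} l \<partial>lborel)"
      using that by (subst I0[symmetric]) (auto intro!: nn_integral_cong simp: indicator_def)
    also have "\<dots> = (\<integral>\<^sup>+l. ennreal (l powr (\<gamma> - 1)) * indicator {1<..z} l \<partial>lborel) + ennreal (1 / \<gamma>)"
      using I0[of 1] by (subst nn_integral_add) auto
    finally show ?thesis ..
  qed
  have zY: "?V y * ennreal ((norm y / R) powr \<gamma> / \<gamma>) = ennreal (R powr - \<gamma> / \<gamma>) * ennreal (norm y powr (- \<alpha> - n))" for y :: 'a
  proof -
    have "norm y powr (- \<beta> - n) * ((norm y / R) powr \<gamma> / \<gamma>) = (norm y powr (- \<beta> - n) * norm y powr \<gamma>) * (R powr - \<gamma> / \<gamma>)"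
    proof -
      have "(norm y / R) powr \<gamma> = norm y powr \<gamma> * R powr - \<gamma>"
        using R by (simp add: powr_divide powr_minus_divide)
      then show ?thesis by simp
    qed
    also have "norm y powr (- \<beta> - n) * norm y powr \<gamma> = norm y powr (- \<alpha> - n)"
      by (subst powr_add[symmetric]) (simp add: \<gamma>_def algebra_simps)
    finally show ?thesis using \<gamma> by (simp add: mult.commute flip: ennreal_mult)
  qed
  have T2: "T2 = ennreal (R powr - \<gamma> / \<gamma>) * Y"
  proof -
    have "T2 = (\<integral>\<^sup>+y. G y * ?V y * ennreal ((norm y / R) powr \<gamma> / \<gamma>) \<partial>lborel)"
      unfolding T2_def swap[OF order_refl] using R by (simp add: I0)
    also have "\<dots> = (\<integral>\<^sup>+y. ennreal (R powr - \<gamma> / \<gamma>) * ?Y y \<partial>lborel)"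
      by (simp only: mult.assoc zY) (simp only: mult_ac)
    also have "\<dots> = ennreal (R powr - \<gamma> / \<gamma>) * Y"
      unfolding Y_def by (rule nn_integral_cmult) measurable
    finally show ?thesis .
  qed
  have T1: "T1 + ennreal (1 / \<gamma>) * X \<le> ennreal (R powr - \<gamma> / \<gamma>) * Y"
  proof -
    have "T1 + ennreal (1 / \<gamma>) * X = (\<integral>\<^sup>+y. G y * ?V y * (\<integral>\<^sup>+l. ?P 1 y l \<partial>lborel)
        + ennreal (1 / \<gamma>) * (G y * k y) \<partial>lborel)"
      unfolding T1_def X_def swap[OF zero_le_one] ind_if by (simp add: nn_integral_add nn_integral_cmult)
    also have "\<dots> \<le> (\<integral>\<^sup>+y. ennreal (R powr - \<gamma> / \<gamma>) * ?Y y \<partial>lborel)"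
    proof (intro nn_integral_mono)
      fix y :: 'a
      let ?J = "\<integral>\<^sup>+l. ?P 1 y l \<partial>lborel"
      show "G y * ?V y * ?J + ennreal (1 / \<gamma>) * (G y * k y) \<le> ennreal (R powr - \<gamma> / \<gamma>) * ?Y y"
      proof (cases "norm y / R \<ge> 1")
        case True
        then have "R \<le> norm y" using R by (simp add: field_simps)
        then have "G y * ?V y * ?J + ennreal (1 / \<gamma>) * (G y * k y) = G y * (?V y * (?J + ennreal (1 / \<gamma>)))"
          unfolding k_def by (simp add: distrib_left mult_ac)
        also have "\<dots> = ennreal (R powr - \<gamma> / \<gamma>) * ?Y y"
          unfolding I1[OF True] zY by (simp only: mult_ac)
        finally show ?thesis by simp
      next
        case False
        then have "{1<..norm y / R} = {}" "\<not> R \<le> norm y" using R by (auto simp: field_simps)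
        then show ?thesis by (simp add: k_def)
      qed
    qed
    also have "\<dots> = ennreal (R powr - \<gamma> / \<gamma>) * Y"
      unfolding Y_def by (rule nn_integral_cmult) measurable
    finally show ?thesis .
  qed
  have main: "ennreal (1 / \<alpha>) * X \<le> ennreal q * (T1 + T2)"
  proof -
    have pt: "ennreal (1 / \<alpha>) * G h \<le> ennreal q * (?I 1 h + ?I 0 h)" for h
    proof -
      have "ennreal (1 / \<alpha>) = (\<integral>\<^sup>+l. w l * indicator {1..} l \<partial>lborel)"
        unfolding w_def using nn_integral_powr_to_inf[of "- 1 - \<alpha>" 1] ab by simp
      also have "\<dots> = (\<integral>\<^sup>+l. w l * indicator {1<..} l \<partial>lborel)"
      proof (rule nn_integral_cong_AE)
        show "AE l in lborel. w l * indicator {1..} l = w l * indicator {1<..} l"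
          using AE_lborel_singleton[of "1::real"] by eventually_elim (auto simp: indicator_def)
      qed
      finally have "ennreal (1 / \<alpha>) * G h = (\<integral>\<^sup>+l. w l * indicator {1<..} l * G h \<partial>lborel)"
        by (simp add: nn_integral_multc)
      also have "\<dots> \<le> (\<integral>\<^sup>+l. ennreal q * (w l * G (l *\<^sub>R h) * indicator {1<..} l + w l * G ((l - 1) *\<^sub>R h) * indicator {1<..} l) \<partial>lborel)"
      proof (intro nn_integral_mono)
        fix l :: real
        show "w l * indicator {1<..} l * G h \<le> ennreal q * (w l * G (l *\<^sub>R h) * indicator {1<..} l + w l * G ((l - 1) *\<^sub>R h) * indicator {1<..} l)"
        proof (cases "l > 1")
          case True
          then have "w l * G h \<le> w l * (ennreal q * (G (l *\<^sub>R h) + G ((l - 1) *\<^sub>R h)))"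
            by (intro mult_left_mono qm) auto
          then show ?thesis using True by (simp add: distrib_left mult_ac)
        qed simp
      qed
      also have "\<dots> = ennreal q * (?I 1 h + (\<integral>\<^sup>+l. w l * G ((l - 1) *\<^sub>R h) * indicator {1<..} l \<partial>lborel))"
        by (subst nn_integral_cmult, measurable) (subst nn_integral_add, auto)
      also have "(\<integral>\<^sup>+l. w l * G ((l - 1) *\<^sub>R h) * indicator {1<..} l \<partial>lborel) = (\<integral>\<^sup>+l. w (1 + l) * G ((1 + l - 1) *\<^sub>R h) * indicator {1<..} (1 + l) \<partial>lborel)"
        by (rule nn_integral_lborel_translation[symmetric]) measurable
      \<comment> \<open>After the shift of l by 1 the weight (1 + l) powr (-1-\<alpha>) is enlarged
        to l powr (-1-\<alpha>), which gives the integrand of \<open>?I 1\<close> on a longer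
        interval.\<close>
      also have "\<dots> \<le> ?I 0 h"
      proof (intro nn_integral_mono)
        fix l :: real
        have "w (1 + l) \<le> w l" if "l > 0"
          unfolding w_def using that ab by (intro ennreal_leI powr_mono2') auto
        then show "w (1 + l) * G ((1 + l - 1) *\<^sub>R h) * indicator {1<..} (1 + l) \<le> w l * G (l *\<^sub>R h) * indicator {0<..} l"
          by (auto simp: indicator_def intro!: mult_right_mono)
      qed
      finally show ?thesis by (simp add: mult_left_mono add_left_mono)
    qed
    have "ennreal (1 / \<alpha>) * X = (\<integral>\<^sup>+h. k h * (ennreal (1 / \<alpha>) * G h) \<partial>lborel)"
      unfolding X_def by (subst nn_integral_cmult[symmetric]) (auto simp: mult_ac)
    also have "\<dots> \<le> (\<integral>\<^sup>+h. k h * (ennreal q * (?I 1 h + ?I 0 h)) \<partial>lborel)"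
      by (intro nn_integral_mono mult_left_mono pt) auto
    also have "\<dots> = (\<integral>\<^sup>+h. ennreal q * (k h * ?I 1 h + k h * ?I 0 h) \<partial>lborel)"
      by (simp add: distrib_left mult_ac)
    also have "\<dots> = ennreal q * (T1 + T2)"
      unfolding T1_def T2_def by (subst nn_integral_cmult, measurable) (subst nn_integral_add, auto)
    finally show ?thesis .
  qed
  have "ennreal \<beta> * X \<le> ennreal (2 * q * R powr - \<gamma> * \<alpha>) * Y"
  proof (cases "Y = \<infinity>")
    case True
    then show ?thesis using R q ab by (simp add: ennreal_mult_top)
  next
    case False
    then obtain y where y: "Y = ennreal y" "y \<ge> 0" by (cases Y) auto
    have T1fin: "T1 + ennreal (1 / \<gamma>) * X \<noteq> \<infinity>" using T1 y \<gamma> by (auto simp: top_unique simp flip: ennreal_mult)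
    then have "X \<noteq> \<infinity>" using \<gamma> by (auto simp: ennreal_mult_top)
    then obtain x where x: "X = ennreal x" "x \<ge> 0" by (cases X) auto
    obtain t1 where t1: "T1 = ennreal t1" "t1 \<ge> 0" using T1fin by (cases T1) auto
    define z where "z = R powr - \<gamma> * y"
    have 1: "t1 + x / \<gamma> \<le> z / \<gamma>" 
      using T1 x t1 y \<gamma> by (simp add: z_def flip: ennreal_mult ennreal_plus)
    have "x / \<alpha> \<le> q * (t1 + z / \<gamma>)" 
      using main x t1 y q \<gamma> ab unfolding T2 by (simp add: z_def flip: ennreal_mult ennreal_plus)
    \<comment> \<open>Here t1 \<le> z/\<gamma> - x/\<gamma>; the term - x/\<gamma> is the gain that
      goes back to the left side.\<close>
    also have "\<dots> \<le> q * (2 * z / \<gamma> - x / \<gamma>)" using 1 q by (intro mult_left_mono) auto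
    finally have "x * \<gamma> \<le> q * (2 * z - x) * \<alpha>" using \<gamma> ab by (simp add: field_simps)
    then have "x * \<gamma> + (x * \<alpha>) * q \<le> 2 * q * z * \<alpha>" by (simp add: algebra_simps)
    moreover have "(x * \<alpha>) * 1 \<le> (x * \<alpha>) * q" using q x ab by (intro mult_left_mono) auto
    ultimately have "\<beta> * x \<le> 2 * q * z * \<alpha>" by (simp add: \<gamma>_def algebra_simps)
    then show ?thesis using x y ab q by (simp add: z_def mult_ac flip: ennreal_mult)
  qed
  then show ?thesis unfolding X_def Y_def k_def n_def \<gamma>_def by (simp add: mult.assoc)
qed

section \<open>Power means\<close>

text \<open>Convexity of the power in the form of its tangent line at a, obtained from Young's
  inequality for x/a and 1. The negative term p a^p has been moved to the right, so that all terms
  are nonnegative and can be integrated in \<open>ennreal\<close>.\<close>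

lemma powr_ge_tangent:
  fixes a x p :: real
  assumes p: "p \<ge> 1" and a: "a \<ge> 0" and x: "x \<ge> 0"
  shows "a powr p + p * a powr (p - 1) * x \<le> x powr p + p * a powr p"
proof (cases "a = 0 \<or> p = 1")
  case True
  then show ?thesis using a x by auto
next
  case False
  then have a: "a > 0" and p: "p > 1" using assms by auto
  define q where "q = p / (p - 1)"
  have q: "q > 1" "1 / p + 1 / q = 1" using p by (auto simp: q_def field_simps)
  have "(x / a) * 1 \<le> (x / a) powr p / p + 1 powr q / q"
    using Youngs_inequality[of p q "x / a" 1] p q a x by simp
  then have "x / a \<le> (x powr p / a powr p) / p + (1 - 1 / p)"
    using q(2) a x by (simp add: powr_divide)
  then have "x / a * (p * a powr p) \<le> ((x powr p / a powr p) / p + (1 - 1 / p)) * (p * a powr p)"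
    using p by (intro mult_right_mono) auto
  also have "\<dots> = x powr p + (p - 1) * a powr p"
    using a p by (simp add: field_simps)
  also have "x / a * (p * a powr p) = p * a powr (p - 1) * x"
    using a by (simp add: powr_diff)
  finally show ?thesis by (simp add: algebra_simps)
qed

text \<open>Both points are compared with the tangent at their midpoint, and the first-order terms
  cancel in the sum.\<close>

lemma powr_add_le:
  fixes x y p :: real
  assumes p: "p \<ge> 1" and x: "x \<ge> 0" and y: "y \<ge> 0"
  shows "(x + y) powr p \<le> 2 powr (p - 1) * (x powr p + y powr p)"
proof -
  define m where "m = (x + y) / 2"
  have m: "m \<ge> 0" using x y by (simp add: m_def)
  have "m powr (p - 1) * m = m powr p"
    using m p by (cases "m = 0") (auto simp: powr_diff)
  then have "p * m powr (p - 1) * x + p * m powr (p - 1) * y = 2 * (p * m powr p)"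
  proof -
    have "p * m powr (p - 1) * x + p * m powr (p - 1) * y = p * m powr (p - 1) * (x + y)"
      by (simp add: algebra_simps)
    also have "x + y = 2 * m" by (simp add: m_def)
    also have "p * m powr (p - 1) * (2 * m) = 2 * (p * (m powr (p - 1) * m))" by simp
    finally show ?thesis unfolding \<open>m powr (p - 1) * m = m powr p\<close> .
  qed
  with powr_ge_tangent[OF p m x] powr_ge_tangent[OF p m y] have "2 * m powr p \<le> x powr p + y powr p"
    by linarith
  moreover have "(x + y) powr p = 2 powr (p - 1) * (2 * m powr p)"
    using x y by (simp add: m_def powr_divide powr_diff)
  ultimately show ?thesis by simp
qed

text \<open>Jensen's inequality on the unit interval, from the tangent at a. Only a lower bound of
  the mean of f is assumed, so it applies to functions whose integral may be infinite.\<close>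

lemma nn_integral_power_mean:
  fixes f :: "real \<Rightarrow> real"
  assumes p: "p \<ge> 1" and a: "a \<ge> 0" and [measurable]: "f \<in> borel_measurable borel" and f: "\<And>t. f t \<ge> 0"
    and le: "ennreal a \<le> (\<integral>\<^sup>+t. ennreal (f t) * indicator {0..1} t \<partial>lborel)"
  shows "ennreal (a powr p) \<le> (\<integral>\<^sup>+t. ennreal (f t powr p) * indicator {0..1} t \<partial>lborel)"
proof -
  have ap: "a powr (p - 1) * a = a powr p"
    using a p by (cases "a = 0") (auto simp: powr_diff)
  have "ennreal (a powr p) + ennreal (p * a powr p) = ennreal (a powr p) + ennreal (p * a powr (p - 1)) * ennreal a"
    using p a ap by (simp add: ennreal_mult[symmetric] mult.assoc)
  also have "\<dots> \<le> ennreal (a powr p) + ennreal (p * a powr (p - 1)) * (\<integral>\<^sup>+t. ennreal (f t) * indicator {0..1} t \<partial>lborel)"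
    by (intro add_left_mono mult_left_mono le) auto
  also have "\<dots> = (\<integral>\<^sup>+t. ennreal (a powr p) * indicator {0..1} t + ennreal (p * a powr (p - 1)) * (ennreal (f t) * indicator {0..1} t) \<partial>lborel)"
    by (subst nn_integral_add) (auto simp: nn_integral_cmult nn_integral_cmult_indicator)
  also have "\<dots> \<le> (\<integral>\<^sup>+t. ennreal (f t powr p) * indicator {0..1} t + ennreal (p * a powr p) * indicator {0..1} t \<partial>lborel)"
  proof (rule nn_integral_mono)
    fix t :: real
    have "ennreal (a powr p + p * a powr (p - 1) * f t) \<le> ennreal (f t powr p + p * a powr p)"
      by (intro ennreal_leI powr_ge_tangent p a f)
    then have "ennreal (a powr p) + ennreal (p * a powr (p - 1)) * ennreal (f t) \<le> ennreal (f t powr p) + ennreal (p * a powr p)"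
      using p a f[of t] by (simp add: ennreal_mult)
    then show "ennreal (a powr p) * indicator {0..1} t + ennreal (p * a powr (p - 1)) * (ennreal (f t) * indicator {0..1} t)
      \<le> ennreal (f t powr p) * indicator {0..1} t + ennreal (p * a powr p) * indicator {0..1} t"
      by (auto simp: indicator_def)
  qed
  also have "\<dots> = (\<integral>\<^sup>+t. ennreal (f t powr p) * indicator {0..1} t \<partial>lborel) + ennreal (p * a powr p)"
    by (subst nn_integral_add) (auto simp: nn_integral_cmult_indicator)
  finally show ?thesis by (simp add: ennreal_add_left_cancel_le add.commute)
qed

section \<open>Bump functions\<close>

text \<open>The factor (1/x)^m closes the family under differentiation up to linear combinations:
  the derivative of member m combines the members m + 2 and m + 1. Member 0 is the classical flat
  function exp (-1/x).\<close>

definition flat_exp :: "nat \<Rightarrow> real \<Rightarrow> real" where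
  "flat_exp m x = (if x > 0 then (1 / x) ^ m * exp (- (1 / x)) else 0)"

lemma flat_exp_tendsto_0: "(flat_exp m \<longlongrightarrow> 0) (at 0)"
proof (rule filterlim_split_at)
  have "((\<lambda>y::real. y ^ m / exp y) \<longlongrightarrow> 0) at_top" by (rule tendsto_power_div_exp_0)
  moreover have "filterlim (\<lambda>x::real. 1 / x) at_top (at_right 0)"
    using filterlim_inverse_at_top_right by (simp add: inverse_eq_divide)
  ultimately have "((\<lambda>x::real. (1 / x) ^ m / exp (1 / x)) \<longlongrightarrow> 0) (at_right 0)"
    by (rule filterlim_compose[of "\<lambda>y. y ^ m / exp y"])
  then show "(flat_exp m \<longlongrightarrow> 0) (at_right 0)"
    by (rule Lim_transform_eventually)
      (auto simp: eventually_at_right_field flat_exp_def exp_minus divide_inverse intro!: exI[of _ 1])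
  show "(flat_exp m \<longlongrightarrow> 0) (at_left 0)"
    by (rule Lim_transform_eventually[OF tendsto_const])
      (auto simp: eventually_at_left_field flat_exp_def intro!: exI[of _ "-1"])
qed

lemma flat_exp_deriv:
  "(flat_exp m has_real_derivative flat_exp (m + 2) x - real m * flat_exp (m + 1) x) (at x)"
proof -
  consider "x > 0" | "x < 0" | "x = 0" by linarith
  then show ?thesis
  proof cases
    case 1
    let ?y = "1 / x" and ?D = "flat_exp (m + 2) x - real m * flat_exp (m + 1) x"
    have "((\<lambda>x. 1 / x) has_real_derivative - (?y\<^sup>2)) (at x)"
      using 1 by (auto intro!: derivative_eq_intros simp: power2_eq_square field_simps)
    moreover have "((\<lambda>y. y ^ m * exp (- y)) has_real_derivative
        real m * ?y ^ (m - 1) * exp (- ?y) - ?y ^ m * exp (- ?y)) (at ?y)"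
      by (auto intro!: derivative_eq_intros)
    ultimately have "((\<lambda>x. (1 / x) ^ m * exp (- (1 / x))) has_real_derivative
        (real m * ?y ^ (m - 1) * exp (- ?y) - ?y ^ m * exp (- ?y)) * - (?y\<^sup>2)) (at x)"
      by (rule DERIV_chain2[rotated])
    moreover have "(real m * y ^ (m - 1) * e - y ^ m * e) * - (y\<^sup>2) = y ^ (m + 2) * e - real m * (y ^ (m + 1) * e)" for y e :: real
      by (cases m) (simp_all add: algebra_simps power2_eq_square)
    ultimately have d: "((\<lambda>x. (1 / x) ^ m * exp (- (1 / x))) has_real_derivative ?D) (at x)"
      using 1 by (simp add: flat_exp_def)
    have ev: "\<forall>\<^sub>F y in nhds x. (1 / y) ^ m * exp (- (1 / y)) = flat_exp m y"
      using eventually_nhds_in_open[of "{0<..}" x] 1 by (auto elim!: eventually_mono simp: flat_exp_def)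
    show ?thesis by (rule iffD1[OF DERIV_cong_ev[OF refl ev refl] d])
  next
    case 2
    have d: "((\<lambda>x. 0) has_real_derivative flat_exp (m + 2) x - real m * flat_exp (m + 1) x) (at x)"
      using 2 by (simp add: flat_exp_def)
    have ev: "\<forall>\<^sub>F y in nhds x. 0 = flat_exp m y"
      using eventually_nhds_in_open[of "{..<0}" x] 2 by (auto elim!: eventually_mono simp: flat_exp_def)
    show ?thesis by (rule iffD1[OF DERIV_cong_ev[OF refl ev refl] d])
  next
    case 3
    \<comment> \<open>As \<open>flat_exp m 0 = 0\<close>, the difference quotient at 0 is
      \<open>flat_exp (Suc m)\<close>, so differentiability at 0 reduces to a limit already
      known.\<close>
    have "((\<lambda>h. (flat_exp m (0 + h) - flat_exp m 0) / h) \<longlongrightarrow> 0) (at 0)"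
      by (rule Lim_transform_eventually[OF flat_exp_tendsto_0[of "Suc m"]])
        (auto simp: eventually_at_filter flat_exp_def)
    then show ?thesis using 3 by (simp add: DERIV_def flat_exp_def)
  qed
qed

lemma flat_exp_bounds: "0 \<le> flat_exp 0 x" "flat_exp 0 x \<le> 1"
  by (auto simp: flat_exp_def)

lemma flat_exp_scaled_tendsto: "(\<lambda>n. flat_exp 0 (real n * x)) \<longlonglongrightarrow> (if x > 0 then 1 else 0)"
proof (cases "x > 0")
  case True
  have "(\<lambda>n. exp (- (inverse (real n) * (1 / x)))) \<longlonglongrightarrow> exp (- (0 * (1 / x)))"
    by (intro tendsto_intros lim_inverse_n)
  moreover have "\<forall>\<^sub>F n in sequentially. exp (- (inverse (real n) * (1 / x))) = flat_exp 0 (real n * x)"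
    using eventually_gt_at_top[of 0] by eventually_elim (use True in \<open>simp add: flat_exp_def field_simps\<close>)
  ultimately show ?thesis using True Lim_transform_eventually by fastforce
next
  case False
  then have "flat_exp 0 (real n * x) = 0" for n
    by (simp add: flat_exp_def zero_less_mult_iff)
  then show ?thesis using False by simp
qed

text \<open>A class that contains the factors of the bump functions and is closed under
  differentiation. Smoothness of every order then follows by induction, without formulas for higher
  derivatives.\<close>

inductive_set smooth1 :: "(real \<Rightarrow> real) set" where
  flat: "(\<lambda>x. flat_exp m (a + b * x)) \<in> smooth1"
| scale: "f \<in> smooth1 \<Longrightarrow> (\<lambda>x. c * f x) \<in> smooth1"
| add: "f \<in> smooth1 \<Longrightarrow> g \<in> smooth1 \<Longrightarrow> (\<lambda>x. f x + g x) \<in> smooth1"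
| mult: "f \<in> smooth1 \<Longrightarrow> g \<in> smooth1 \<Longrightarrow> (\<lambda>x. f x * g x) \<in> smooth1"

lemma smooth1_deriv:
  "f \<in> smooth1 \<Longrightarrow> \<exists>f'\<in>smooth1. \<forall>x. (f has_real_derivative f' x) (at x)"
proof (induction rule: smooth1.induct)
  case (flat m a b)
  let ?g = "\<lambda>x. b * (flat_exp (m + 2) (a + b * x) + (- real m) * flat_exp (m + 1) (a + b * x))"
  have "?g \<in> smooth1" by (intro smooth1.intros)
  moreover have "((\<lambda>x. flat_exp m (a + b * x)) has_real_derivative ?g x) (at x)" for x
    by (rule DERIV_cong[OF DERIV_chain2[OF flat_exp_deriv]])
      (auto intro!: derivative_eq_intros simp: algebra_simps)
  ultimately show ?case by (intro bexI[of _ ?g]) auto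
next
  case (scale f c)
  then obtain f' where "f' \<in> smooth1" "\<forall>x. (f has_real_derivative f' x) (at x)" by blast
  then show ?case by (intro bexI[of _ "\<lambda>x. c * f' x"]) (auto intro!: derivative_eq_intros smooth1.intros)
next
  case (add f g)
  then obtain f' g' where "f' \<in> smooth1" "\<forall>x. (f has_real_derivative f' x) (at x)"
    "g' \<in> smooth1" "\<forall>x. (g has_real_derivative g' x) (at x)" by blast
  then show ?case by (intro bexI[of _ "\<lambda>x. f' x + g' x"]) (auto intro!: derivative_eq_intros smooth1.intros)
next
  case (mult f g)
  then obtain f' g' where "f' \<in> smooth1" "\<forall>x. (f has_real_derivative f' x) (at x)"
    "g' \<in> smooth1" "\<forall>x. (g has_real_derivative g' x) (at x)" by blast
  with mult(1,2) show ?case by (intro bexI[of _ "\<lambda>x. f' x * g x + f x * g' x"]) (auto intro!: derivative_eq_intros smooth1.intros)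
qed

text \<open>A partial derivative replaces only the i-th factor by its derivative, so the result is a
  product of the same kind and the differentiation can be iterated.\<close>

lemma prod_coordinates_partial:
  fixes f :: "'n::finite \<Rightarrow> real \<Rightarrow> real"
  assumes f': "\<And>i x. (f i has_real_derivative f' i x) (at x)"
  shows "(\<lambda>x::real^'n. \<Prod>j\<in>UNIV. f j (x $ j)) differentiable (at x)"
    and "partial_deriv i (\<lambda>x::real^'n. \<Prod>j\<in>UNIV. f j (x $ j)) = (\<lambda>x. \<Prod>j\<in>UNIV. (f(i := f' i)) j (x $ j))"
proof -
  have D: "((\<lambda>x::real^'n. \<Prod>j\<in>UNIV. f j (x $ j)) has_derivative
      (\<lambda>y. \<Sum>i\<in>UNIV. (f' i (x $ i) * y $ i) * (\<Prod>j\<in>UNIV - {i}. f j (x $ j)))) (at x)" for x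
  proof (rule has_derivative_prod)
    fix i :: 'n
    have "((\<lambda>x::real^'n. x $ i) has_derivative (\<lambda>y. y $ i)) (at x)"
      by (rule bounded_linear_imp_has_derivative) (rule bounded_linear_vec_nth)
    from has_derivative_compose[OF this, of "f i" "(*) (f' i (x $ i))"] f'[of i "x $ i"]
    show "((\<lambda>x::real^'n. f i (x $ i)) has_derivative (\<lambda>y. f' i (x $ i) * y $ i)) (at x)"
      by (simp add: has_field_derivative_def)
  qed
  then show "(\<lambda>x::real^'n. \<Prod>j\<in>UNIV. f j (x $ j)) differentiable (at x)"
    by (auto simp: differentiable_def)
  show "partial_deriv i (\<lambda>x::real^'n. \<Prod>j\<in>UNIV. f j (x $ j)) = (\<lambda>x. \<Prod>j\<in>UNIV. (f(i := f' i)) j (x $ j))"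
  proof
    fix x :: "real^'n"
    have "partial_deriv i (\<lambda>x::real^'n. \<Prod>j\<in>UNIV. f j (x $ j)) x
      = (\<Sum>k\<in>UNIV. (f' k (x $ k) * axis i 1 $ k) * (\<Prod>j\<in>UNIV - {k}. f j (x $ j)))"
      unfolding partial_deriv_def frechet_derivative_at[OF D, symmetric] ..
    also have "\<dots> = (\<Sum>k\<in>UNIV. if k = i then f' k (x $ k) * (\<Prod>j\<in>UNIV - {k}. f j (x $ j)) else 0)"
      by (intro sum.cong) (auto simp: axis_def)
    also have "\<dots> = f' i (x $ i) * (\<Prod>j\<in>UNIV - {i}. f j (x $ j))" by simp
    also have "\<dots> = (\<Prod>j\<in>UNIV. (f(i := f' i)) j (x $ j))"
      by (subst prod.remove[of UNIV i]) (auto intro!: prod.cong)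
    finally show "partial_deriv i (\<lambda>x::real^'n. \<Prod>j\<in>UNIV. f j (x $ j)) x = (\<Prod>j\<in>UNIV. (f(i := f' i)) j (x $ j))" .
  qed
qed

lemma prod_coordinates_Ck:
  fixes f :: "'n::finite \<Rightarrow> real \<Rightarrow> real"
  assumes "\<And>i. f i \<in> smooth1"
  shows "Ck k (\<lambda>x::real^'n. \<Prod>j\<in>UNIV. f j (x $ j))"
  using assms
proof (induction k arbitrary: f)
  case (0 f)
  have "continuous_on UNIV (f j)" for j
    using smooth1_deriv[OF 0] by (metis DERIV_isCont continuous_at_imp_continuous_on)
  then have "continuous_on UNIV (\<lambda>x::real^'n. f j (x $ j))" for j
    by (rule continuous_on_compose2) (auto intro: continuous_intros)
  then show ?case by (auto intro!: continuous_on_prod)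
next
  case (Suc k f)
  obtain f' where f': "\<And>i. f' i \<in> smooth1" "\<And>i x. (f i has_real_derivative f' i x) (at x)"
    using smooth1_deriv[OF Suc.prems] by metis
  have "Ck k (\<lambda>x::real^'n. \<Prod>j\<in>UNIV. (f(i := f' i)) j (x $ j))" for i
    using f'(1) Suc.prems by (intro Suc.IH) auto
  then have "Ck k (partial_deriv i (\<lambda>x::real^'n. \<Prod>j\<in>UNIV. f j (x $ j)))" for i
    unfolding prod_coordinates_partial(2)[OF f'(2)] .
  moreover have "(\<lambda>x::real^'n. \<Prod>j\<in>UNIV. f j (x $ j)) differentiable_on UNIV"
    unfolding differentiable_on_def
    by (intro ballI) (rule prod_coordinates_partial(1)[OF f'(2)])
  ultimately show ?case by simp
qed

text \<open>Smooth functions that vanish outside the open box from a to b and tend pointwise to its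
  indicator as n grows: in each coordinate the two factors exp (-1/(n x)) measure the distances to
  the two faces. All test functions used below are of this form.\<close>

definition bump :: "nat \<Rightarrow> real ^ 'n::finite \<Rightarrow> real ^ 'n \<Rightarrow> real ^ 'n \<Rightarrow> real" where
  "bump n a b x = (\<Prod>j\<in>UNIV. flat_exp 0 (real n * (x $ j - a $ j)) * flat_exp 0 (real n * (b $ j - x $ j)))"

lemma bump_eq:
  "bump n a b = (\<lambda>x. \<Prod>j\<in>UNIV. (\<lambda>y. flat_exp 0 (- real n * a $ j + real n * y) * flat_exp 0 (real n * b $ j + (- real n) * y)) (x $ j))"
  by (simp add: bump_def fun_eq_iff algebra_simps)

lemma bump_Ck: "Ck k (bump n a b)"
  unfolding bump_eq by (intro prod_coordinates_Ck smooth1.mult smooth1.flat)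

lemma bump_bounds: "0 \<le> bump n a b x" "bump n a b x \<le> 1"
  unfolding bump_def using flat_exp_bounds
  by (auto intro!: prod_nonneg prod_le_1 mult_nonneg_nonneg mult_le_one)

lemma bump_eq_0:
  assumes "x \<notin> box a b"
  shows "bump n a b x = 0"
proof -
  obtain j where "\<not> (a $ j < x $ j \<and> x $ j < b $ j)" using assms by (auto simp: mem_box_cart)
  then have "flat_exp 0 (real n * (x $ j - a $ j)) * flat_exp 0 (real n * (b $ j - x $ j)) = 0"
    by (auto simp: flat_exp_def zero_less_mult_iff)
  then show ?thesis unfolding bump_def by (intro prod_zero) auto
qed

lemma bump_tendsto: "(\<lambda>n. bump n a b x) \<longlonglongrightarrow> indicator (box a b) x"
proof -
  have "(\<lambda>n. bump n a b x) \<longlonglongrightarrow> (\<Prod>j\<in>UNIV. (if x $ j - a $ j > 0 then 1 else 0) * (if b $ j - x $ j > 0 then 1 else 0))"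
    unfolding bump_def by (intro tendsto_intros flat_exp_scaled_tendsto)
  also have "(\<Prod>j\<in>UNIV. (if x $ j - a $ j > 0 then 1 else 0) * (if b $ j - x $ j > 0 then 1 else 0)) = (indicator (box a b) x :: real)"
  proof (cases "x \<in> box a b")
    case True
    then show ?thesis by (simp add: mem_box_cart)
  next
    case False
    then obtain j where "\<not> (a $ j < x $ j \<and> x $ j < b $ j)" by (auto simp: mem_box_cart)
    then show ?thesis using False by (auto simp: prod_zero_iff intro!: exI[of _ j])
  qed
  finally show ?thesis .
qed

lemma bump_translate: "bump n a b (x - c) = bump n (a + c) (b + c) x"
  by (simp add: bump_def algebra_simps)

lemma bump_test_fun:
  assumes "cbox a b \<subseteq> \<Omega>"
  shows "test_fun \<Omega> (bump n a b)"
proof -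
  have "closure {x. bump n a b x \<noteq> 0} \<subseteq> cbox a b"
    using bump_eq_0 box_subset_cbox by (intro closure_minimal) (blast, auto)
  moreover have "bounded {x. bump n a b x \<noteq> 0}"
    by (rule bounded_subset[OF bounded_cbox[of a b]]) (use bump_eq_0 box_subset_cbox in blast)
  ultimately show ?thesis
    unfolding test_fun_def using bump_Ck assms compact_closure by (metis (no_types, lifting) subset_trans)
qed

lemma bump_differentiable: "bump n a b differentiable (at x)"
  using bump_Ck[of "Suc 0" n a b] by (simp add: differentiable_on_def)

lemma bump_partial_continuous: "continuous_on UNIV (partial_deriv i (bump n a b))"
  using bump_Ck[of "Suc 0" n a b] by simp

lemma bump_partial_eq_0:
  assumes "x \<notin> cbox a b"
  shows "partial_deriv i (bump n a b) x = 0"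
proof -
  \<comment> \<open>The closed box is taken because its complement is open: the bump then vanishes
    in a neighbourhood of x, which determines the derivative.\<close>
  have "\<forall>\<^sub>F y in nhds x. y \<in> - cbox a b"
    using assms by (intro eventually_nhds_in_open) auto
  then have ev: "\<forall>\<^sub>F y in nhds x. bump n a b y = 0"
    by eventually_elim (use bump_eq_0 box_subset_cbox in blast)
  have "(bump n a b has_derivative (\<lambda>_. 0)) (at x)"
  proof (rule has_derivative_transform_eventually[OF has_derivative_const[of 0]])
    show "\<forall>\<^sub>F y in at x. 0 = bump n a b y" using ev by (auto simp: eventually_at_filter elim: eventually_mono)
    show "0 = bump n a b x" using eventually_nhds_x_imp_x[OF ev] by simp
  qed simp
  then show ?thesis unfolding partial_deriv_def using frechet_derivative_at by metis
qed

lemma bump_partial_bounded: "\<exists>C. \<forall>x. \<bar>partial_deriv i (bump n a b) x\<bar> \<le> C"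
proof -
  have "compact (partial_deriv i (bump n a b) ` cbox a b)"
    by (intro compact_continuous_image continuous_on_subset[OF bump_partial_continuous]) auto
  then obtain C where "\<forall>y\<in>partial_deriv i (bump n a b) ` cbox a b. norm y \<le> C"
    using compact_imp_bounded bounded_iff by blast
  then have C: "\<bar>partial_deriv i (bump n a b) x\<bar> \<le> C" if "x \<in> cbox a b" for x
    using that by auto
  have "\<bar>partial_deriv i (bump n a b) x\<bar> \<le> max C 0" for x
    using C[of x] bump_partial_eq_0[of x a b i n] by (cases "x \<in> cbox a b") auto
  then show ?thesis by blast
qed

lemma bump_frechet: "frechet_derivative (bump n a b) (at x) h = (\<Sum>i\<in>UNIV. h $ i * partial_deriv i (bump n a b) x)"
proof -
  have lin: "linear (frechet_derivative (bump n a b) (at x))"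
    using bump_differentiable[of n a b x] by (rule linear_frechet_derivative)
  have "h = (\<Sum>i\<in>UNIV. h $ i *\<^sub>R axis i 1)"
    by (metis basis_expansion scalar_mult_eq_scaleR)
  then have "frechet_derivative (bump n a b) (at x) h = frechet_derivative (bump n a b) (at x) (\<Sum>i\<in>UNIV. h $ i *\<^sub>R axis i 1)"
    by simp
  then show ?thesis
    by (simp add: partial_deriv_def linear_sum[OF lin] linear_scale[OF lin])
qed

text \<open>The shift is by - h because a translation of v by h will be moved onto the test
  function.\<close>

lemma bump_fundamental_theorem:
  fixes h :: "real ^ 'n::finite"
  shows "bump n a b (x - h) - bump n a b x
    = - (\<integral>t. indicator {0..1} t * (\<Sum>i\<in>UNIV. h $ i * partial_deriv i (bump n a b) (x - t *\<^sub>R h)) \<partial>lborel)"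
proof -
  let ?D = "\<lambda>t. - (\<Sum>i\<in>UNIV. h $ i * partial_deriv i (bump n a b) (x - t *\<^sub>R h))"
  have "(\<integral>t. ?D t * indicator {0..1} t \<partial>lborel) = bump n a b (x - 1 *\<^sub>R h) - bump n a b (x - 0 *\<^sub>R h)"
  proof (rule integral_FTC_Icc_real)
    fix t :: real
    have "((\<lambda>t. x - t *\<^sub>R h) has_derivative (\<lambda>s. - (s *\<^sub>R h))) (at t)"
      by (auto intro!: derivative_eq_intros)
    from has_derivative_compose[OF this frechet_derivative_works[THEN iffD1, OF bump_differentiable]]
    have "((\<lambda>t. bump n a b (x - t *\<^sub>R h)) has_derivative (\<lambda>s. s * ?D t)) (at t)"
      unfolding bump_frechet by (simp add: sum_distrib_left mult_ac sum_negf)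
    then show "((\<lambda>t. bump n a b (x - t *\<^sub>R h)) has_real_derivative ?D t) (at t)"
      by (rule has_derivative_imp_has_field_derivative) simp
    have "isCont (partial_deriv i (bump n a b)) y" for i y
      using bump_partial_continuous[of i n a b] by (simp add: continuous_on_eq_continuous_at)
    moreover have "isCont (\<lambda>t. x - t *\<^sub>R h) t" by (intro continuous_intros)
    ultimately have c: "isCont (\<lambda>t. partial_deriv i (bump n a b) (x - t *\<^sub>R h)) t" for i
      using isCont_o2 by blast
    show "isCont ?D t" by (intro continuous_intros c)
  qed simp
  moreover have "(\<integral>t. ?D t * indicator {0..1} t \<partial>lborel)
    = (\<integral>t. - (indicator {0..1} t * (\<Sum>i\<in>UNIV. h $ i * partial_deriv i (bump n a b) (x - t *\<^sub>R h))) \<partial>lborel)"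
    by (intro Bochner_Integration.integral_cong refl) simp
  ultimately show ?thesis by simp
qed

section \<open>Differences and weak gradients\<close>

text \<open>The positive and the negative part of w are taken as densities of two finite measures.
  These agree on boxes, a generator closed under intersections, hence everywhere, and densities are
  unique up to null sets.\<close>

lemma AE_eq_0_if_box_integrals_eq_0:
  fixes w :: "'a::euclidean_space \<Rightarrow> real"
  assumes w: "integrable lborel w"
    and 0: "\<And>c d. (\<integral>x. indicator (box c d) x * w x \<partial>lborel) = 0"
  shows "AE x in lborel. w x = 0"
proof -
  have [measurable]: "w \<in> borel_measurable borel" using borel_measurable_integrable[OF w] by simp
  define P where "P x = ennreal (max 0 (w x))" for x
  define N where "N x = ennreal (max 0 (- w x))" for x
  have [measurable]: "P \<in> borel_measurable borel" "N \<in> borel_measurable borel"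
    unfolding P_def N_def by measurable
  have iP: "integrable lborel (\<lambda>x. max 0 (w x))" and iN: "integrable lborel (\<lambda>x. max 0 (- w x))"
    by (intro integrable_max integrable_zero integrable_minus w)+
  have fin: "emeasure (density lborel P) (box c d) \<noteq> \<infinity>" for c d
  proof -
    have "emeasure (density lborel P) (box c d) = (\<integral>\<^sup>+x. P x * indicator (box c d) x \<partial>lborel)"
      by (rule emeasure_density) auto
    also have "\<dots> \<le> (\<integral>\<^sup>+x. P x \<partial>lborel)"
      by (intro nn_integral_mono) (auto simp: indicator_def)
    also have "\<dots> < \<infinity>" using iP unfolding P_def by (simp add: integrable_iff_bounded)
    finally show ?thesis by simp
  qed
  have eq: "emeasure (density lborel P) (box c d) = emeasure (density lborel N) (box c d)" for c d
  proof -
    have *: "emeasure (density lborel (\<lambda>x. ennreal (f x))) (box c d) = ennreal (\<integral>x. indicator (box c d) x * f x \<partial>lborel)"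
      if f: "integrable lborel f" "\<And>x. f x \<ge> 0" for f :: "'a \<Rightarrow> real"
    proof -
      have [measurable]: "f \<in> borel_measurable borel" using f by auto
      have "emeasure (density lborel (\<lambda>x. ennreal (f x))) (box c d) = (\<integral>\<^sup>+x. ennreal (f x) * indicator (box c d) x \<partial>lborel)"
        by (rule emeasure_density) auto
      also have "\<dots> = (\<integral>\<^sup>+x. ennreal (indicator (box c d) x * f x) \<partial>lborel)"
        by (intro nn_integral_cong) (auto simp: indicator_def)
      also have "\<dots> = ennreal (\<integral>x. indicator (box c d) x * f x \<partial>lborel)"
        using f integrable_real_mult_indicator[of "box c d" lborel f]
        by (intro nn_integral_eq_integral) (auto simp: mult.commute)
      finally show ?thesis .
    qed
    have "(\<integral>x. indicator (box c d) x * max 0 (w x) \<partial>lborel) - (\<integral>x. indicator (box c d) x * max 0 (- w x) \<partial>lborel)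
      = (\<integral>x. indicator (box c d) x * max 0 (w x) - indicator (box c d) x * max 0 (- w x) \<partial>lborel)"
      using integrable_real_mult_indicator[OF _ iP, of "box c d"] integrable_real_mult_indicator[OF _ iN, of "box c d"]
      by (intro Bochner_Integration.integral_diff[symmetric]) (auto simp: mult.commute)
    also have "\<dots> = (\<integral>x. indicator (box c d) x * w x \<partial>lborel)"
      by (intro Bochner_Integration.integral_cong) (auto simp: indicator_def max_def)
    finally show ?thesis using 0[of c d] *[OF iP] *[OF iN] unfolding P_def N_def by simp
  qed
  have "density lborel P = density lborel N"
  proof (rule measure_eqI_generator_eq)
    let ?E = "range (\<lambda>(a, b). box a b::'a set)"
    show "Int_stable ?E" by (auto simp: Int_stable_def box_Int_box)
    show "?E \<subseteq> Pow UNIV" "sets (density lborel P) = sigma_sets UNIV ?E" "sets (density lborel N) = sigma_sets UNIV ?E"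
      by (simp_all add: borel_eq_box)
    let ?A = "\<lambda>n::nat. box (- (real n *\<^sub>R One)) (real n *\<^sub>R One) :: 'a set"
    show "range ?A \<subseteq> ?E" "(\<Union>i. ?A i) = UNIV" unfolding UN_box_eq_UNIV by auto
    show "emeasure (density lborel P) (?A i) \<noteq> \<infinity>" for i by (rule fin)
    show "emeasure (density lborel P) X = emeasure (density lborel N) X" if "X \<in> ?E" for X
      using that eq by auto
  qed
  then have "AE x in lborel. P x = N x"
    by (intro sigma_finite_measure.density_unique[OF sigma_finite_lborel]) auto
  then show ?thesis
    by eventually_elim (auto simp: P_def N_def max_def split: if_splits)
qed

text \<open>Measurability is required on the whole space and in the Borel sense, although
  integrability concerns only compact subsets of \<Omega>: compositions such as
  \<open>g (x + t *\<^sub>R h)\<close> then remain jointly measurable in x and t.\<close>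

definition locally_integrable_on :: "'a::euclidean_space set \<Rightarrow> ('a \<Rightarrow> 'b::euclidean_space) \<Rightarrow> bool" where
  "locally_integrable_on \<Omega> f \<longleftrightarrow> f \<in> borel_measurable borel \<and>
     (\<forall>K. compact K \<and> K \<subseteq> \<Omega> \<longrightarrow> integrable lborel (\<lambda>x. indicator K x *\<^sub>R f x))"

lemma locally_integrable_mult_bounded:
  assumes f: "locally_integrable_on \<Omega> f" and K: "compact K" "K \<subseteq> \<Omega>"
    and [measurable]: "\<phi> \<in> borel_measurable borel" and b: "\<And>x. \<bar>\<phi> x\<bar> \<le> C" and z: "\<And>x. x \<notin> K \<Longrightarrow> \<phi> x = (0::real)"
  shows "integrable lborel (\<lambda>x. \<phi> x *\<^sub>R f x)"
proof (rule Bochner_Integration.integrable_bound)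
  show "integrable lborel (\<lambda>x. C *\<^sub>R (indicator K x *\<^sub>R f x))"
    using f K unfolding locally_integrable_on_def by (intro integrable_scaleR_right) auto
  have [measurable]: "f \<in> borel_measurable borel" using f by (simp add: locally_integrable_on_def)
  show "(\<lambda>x. \<phi> x *\<^sub>R f x) \<in> borel_measurable lborel" by measurable
  have "norm (\<phi> x *\<^sub>R f x) \<le> norm (C *\<^sub>R (indicator K x *\<^sub>R f x))" for x
    using b[of x] z[of x] by (cases "x \<in> K") (auto intro!: mult_right_mono)
  then show "AE x in lborel. norm (\<phi> x *\<^sub>R f x) \<le> norm (C *\<^sub>R (indicator K x *\<^sub>R f x))" by simp
qed

section \<open>Bump functions under translation and integration; Fubini for signed
  integrands\<close>

lemma bump_measurable[measurable]: "bump n a b \<in> borel_measurable borel"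
  using bump_Ck[of 0 n a b] by (intro borel_measurable_continuous_onI) simp

lemma bump_partial_measurable[measurable]: "partial_deriv i (bump n a b) \<in> borel_measurable borel"
  by (intro borel_measurable_continuous_onI bump_partial_continuous)

lemma partial_deriv_bump_translate:
  "partial_deriv i (bump n a b) (x - c) = partial_deriv i (bump n (a + c) (b + c)) x"
proof -
  have "((\<lambda>x. x - c) has_derivative (\<lambda>y. y)) (at x)" by (auto intro!: derivative_eq_intros)
  from has_derivative_compose[OF this frechet_derivative_works[THEN iffD1, OF bump_differentiable]]
  have "(bump n (a + c) (b + c) has_derivative frechet_derivative (bump n a b) (at (x - c))) (at x)"
    by (simp add: bump_translate)
  then show ?thesis unfolding partial_deriv_def using frechet_derivative_at by metis
qed

lemma lborel_integral_translation:
  fixes f :: "'a::euclidean_space \<Rightarrow> 'b::euclidean_space"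
  assumes [measurable]: "f \<in> borel_measurable borel"
  shows "(\<integral>x. f (t + x) \<partial>lborel) = (\<integral>x. f x \<partial>lborel)"
proof -
  have "(\<integral>x. f x \<partial>lborel) = (\<integral>x. f x \<partial>distr lborel borel ((+) t))"
    by (simp add: lborel_distr_plus)
  also have "\<dots> = (\<integral>x. f (t + x) \<partial>lborel)" by (rule integral_distr) auto
  finally show ?thesis ..
qed

lemma lborel_Fubini_of_bounded:
  fixes F :: "'a::euclidean_space \<Rightarrow> 'b::euclidean_space \<Rightarrow> real"
  assumes [measurable]: "case_prod F \<in> borel_measurable (borel \<Otimes>\<^sub>M borel)"
    and fin: "(\<integral>\<^sup>+x. (\<integral>\<^sup>+t. ennreal \<bar>F x t\<bar> \<partial>lborel) \<partial>lborel) < \<infinity>"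
  shows "(\<integral>x. (\<integral>t. F x t \<partial>lborel) \<partial>lborel) = (\<integral>t. (\<integral>x. F x t \<partial>lborel) \<partial>lborel)"
    and "integrable lborel (\<lambda>x. \<integral>t. F x t \<partial>lborel)"
proof -
  have i: "integrable (lborel \<Otimes>\<^sub>M lborel) (case_prod F)"
  proof (rule integrableI_bounded)
    have "(\<integral>\<^sup>+z. ennreal (norm (case_prod F z)) \<partial>(lborel \<Otimes>\<^sub>M lborel)) = (\<integral>\<^sup>+x. (\<integral>\<^sup>+t. ennreal \<bar>F x t\<bar> \<partial>lborel) \<partial>lborel)"
      by (subst lborel.nn_integral_fst[symmetric]) (auto simp: split_beta)
    then show "(\<integral>\<^sup>+z. ennreal (norm (case_prod F z)) \<partial>(lborel \<Otimes>\<^sub>M lborel)) < \<infinity>" using fin by simp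
  qed simp
  show "(\<integral>x. (\<integral>t. F x t \<partial>lborel) \<partial>lborel) = (\<integral>t. (\<integral>x. F x t \<partial>lborel) \<partial>lborel)"
    using lborel_pair.Fubini_integral[OF i] by simp
  show "integrable lborel (\<lambda>x. \<integral>t. F x t \<partial>lborel)"
    using lborel_pair.integrable_fst'[OF i] by simp
qed

lemma locally_integrable_mult_bump:
  assumes f: "locally_integrable_on \<Omega> f" and sub: "cbox a b \<subseteq> \<Omega>"
  shows "integrable lborel (\<lambda>x. bump n a b x *\<^sub>R f x)"
proof (rule locally_integrable_mult_bounded[OF f compact_cbox sub bump_measurable])
  show "\<bar>bump n a b x\<bar> \<le> 1" for x using bump_bounds[of n a b x] by simp
  show "bump n a b x = 0" if "x \<notin> cbox a b" for x
    using that bump_eq_0[of x a b n] box_subset_cbox[of a b] by blast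
qed

text \<open>A weak gradient stated for Borel functions and tested with bumps. The integrals run over
  the whole space, which makes translations available; the bumps vanish outside \<Omega>. For v
  local integrability is asked on the whole space, since it will represent a function in L^p of the
  whole space; for g only on compact subsets of \<Omega>.\<close>

locale borel_weak_gradient =
  fixes \<Omega> :: "(real ^ 'n::finite) set" and v :: "real ^ 'n \<Rightarrow> real" and g :: "real ^ 'n \<Rightarrow> real ^ 'n"
  assumes v: "locally_integrable_on UNIV v"
    and g: "locally_integrable_on \<Omega> g"
    and weak: "\<And>n a b i. cbox a b \<subseteq> \<Omega> \<Longrightarrow>
      (\<integral>x. v x * partial_deriv i (bump n a b) x \<partial>lborel) = - (\<integral>x. g x $ i * bump n a b x \<partial>lborel)"
begin

lemma v_measurable[measurable]: "v \<in> borel_measurable borel"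
  and g_measurable[measurable]: "g \<in> borel_measurable borel"
  using v g by (auto simp: locally_integrable_on_def)

lemma g_inner: "locally_integrable_on \<Omega> (\<lambda>x. g x \<bullet> h)"
proof -
  have "integrable lborel (\<lambda>x. indicator K x *\<^sub>R (g x \<bullet> h))" if "compact K" "K \<subseteq> \<Omega>" for K
  proof -
    have "integrable lborel (\<lambda>x. (indicator K x *\<^sub>R g x) \<bullet> h)"
      using g that unfolding locally_integrable_on_def by (intro integrable_inner_left) auto
    then show ?thesis by simp
  qed
  then show ?thesis unfolding locally_integrable_on_def by auto
qed

context
  fixes a b h :: "real ^ 'n"
  assumes seg: "\<And>x t. x \<in> cbox a b \<Longrightarrow> 0 \<le> t \<Longrightarrow> t \<le> 1 \<Longrightarrow> x + t *\<^sub>R h \<in> \<Omega>"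
begin

text \<open>All segments from the box in direction h lie in this compact subset of \<Omega>. Both v
  and g are integrable on it, which gives the domination for Fubini.\<close>

definition swept :: "(real ^ 'n) set" where
  "swept = (\<lambda>(t, x). x + t *\<^sub>R h) ` ({0..1} \<times> cbox a b)"

lemma swept: "compact swept" "swept \<subseteq> \<Omega>"
proof -
  show "compact swept" unfolding swept_def
    by (intro compact_continuous_image compact_Times) (auto intro!: continuous_intros simp: split_beta)
  show "swept \<subseteq> \<Omega>" unfolding swept_def using seg by auto
qed

lemma swept_memI: "0 \<le> t \<Longrightarrow> t \<le> 1 \<Longrightarrow> x - t *\<^sub>R h \<in> cbox a b \<Longrightarrow> x \<in> swept"
  unfolding swept_def by (auto intro!: image_eqI[of _ _ "(t, x - t *\<^sub>R h)"])

definition bump_dir :: "nat \<Rightarrow> real ^ 'n \<Rightarrow> real" where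
  "bump_dir n x = (\<Sum>i\<in>UNIV. h $ i * partial_deriv i (bump n a b) x)"

lemma bump_dir_measurable[measurable]: "bump_dir n \<in> borel_measurable borel"
  unfolding bump_dir_def by measurable

lemma bump_dir_bounded: "\<exists>C. \<forall>x. \<bar>bump_dir n x\<bar> \<le> C"
proof -
  obtain C where C: "\<And>i x. \<bar>partial_deriv i (bump n a b) x\<bar> \<le> C i"
    using bump_partial_bounded[of _ n a b] by metis
  have "\<bar>bump_dir n x\<bar> \<le> (\<Sum>i\<in>UNIV. \<bar>h $ i\<bar> * C i)" for x
    unfolding bump_dir_def
    by (rule order_trans[OF sum_abs]) (auto simp: abs_mult intro!: sum_mono mult_left_mono C)
  then show ?thesis by blast
qed

lemma bump_dir_eq_0: "x \<notin> cbox a b \<Longrightarrow> bump_dir n x = 0"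
  by (simp add: bump_dir_def bump_partial_eq_0)

text \<open>The box moved by t h still lies in \<Omega>, so the weak identity is available for the
  translated bump; its components are combined with the weights h $ i.\<close>

lemma weak_directional:
  assumes t: "0 \<le> t" "t \<le> 1"
  shows "(\<integral>x. v x * bump_dir n (x - t *\<^sub>R h) \<partial>lborel) = - (\<integral>x. (g x \<bullet> h) * bump n a b (x - t *\<^sub>R h) \<partial>lborel)"
proof -
  let ?c = "t *\<^sub>R h"
  let ?\<psi> = "bump n (a + ?c) (b + ?c)"
  have sub: "cbox (a + ?c) (b + ?c) \<subseteq> \<Omega>"
  proof
    fix x assume "x \<in> cbox (a + ?c) (b + ?c)"
    then have "x - ?c \<in> cbox a b" by (auto simp: mem_box_cart algebra_simps)
    from seg[OF this t] show "x \<in> \<Omega>" by simp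
  qed
  have int1: "integrable lborel (\<lambda>x. v x * partial_deriv i ?\<psi> x)" for i
  proof -
    obtain C where "\<And>x. \<bar>partial_deriv i ?\<psi> x\<bar> \<le> C" using bump_partial_bounded by metis
    from locally_integrable_mult_bounded[OF v compact_cbox subset_UNIV bump_partial_measurable this bump_partial_eq_0]
    show ?thesis by (simp add: mult.commute)
  qed
  have int2: "integrable lborel (\<lambda>x. g x $ i * ?\<psi> x)" for i
  proof -
    have "integrable lborel (\<lambda>x. ?\<psi> x *\<^sub>R (g x \<bullet> axis i 1))"
      by (rule locally_integrable_mult_bump[OF g_inner sub])
    then show ?thesis by (simp add: inner_axis mult.commute)
  qed
  have "(\<integral>x. v x * bump_dir n (x - ?c) \<partial>lborel) = (\<integral>x. (\<Sum>i\<in>UNIV. h $ i * (v x * partial_deriv i ?\<psi> x)) \<partial>lborel)"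
    unfolding bump_dir_def partial_deriv_bump_translate by (simp add: sum_distrib_left mult_ac)
  also have "\<dots> = (\<Sum>i\<in>UNIV. h $ i * (\<integral>x. v x * partial_deriv i ?\<psi> x \<partial>lborel))"
    using int1 by simp
  also have "\<dots> = (\<Sum>i\<in>UNIV. h $ i * - (\<integral>x. g x $ i * ?\<psi> x \<partial>lborel))"
    using weak[OF sub] by simp
  also have "\<dots> = - (\<integral>x. (\<Sum>i\<in>UNIV. h $ i * (g x $ i * ?\<psi> x)) \<partial>lborel)"
    using int2 by (simp add: sum_negf)
  also have "(\<integral>x. (\<Sum>i\<in>UNIV. h $ i * (g x $ i * ?\<psi> x)) \<partial>lborel) = (\<integral>x. (g x \<bullet> h) * bump n a b (x - ?c) \<partial>lborel)"
    unfolding bump_translate by (simp add: inner_vec_def sum_distrib_right mult_ac)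
  finally show ?thesis .
qed

text \<open>After swapping the order, the integral at each t is at most that of |g \<bullet> h| over
  \<open>swept\<close>. The function \<phi> is kept general so as to serve both for the bump and for
  the indicator of the box.\<close>

lemma segment_average_integrable:
  assumes [measurable]: "\<phi> \<in> borel_measurable borel" and \<phi>: "\<And>x. \<bar>\<phi> x\<bar> \<le> indicator (cbox a b) x"
  defines "F \<equiv> \<lambda>x t. \<phi> x * (indicator {0..1} t * (g (x + t *\<^sub>R h) \<bullet> h))"
  shows "(\<integral>x. (\<integral>t. F x t \<partial>lborel) \<partial>lborel) = (\<integral>t. (\<integral>x. F x t \<partial>lborel) \<partial>lborel)"
    and "integrable lborel (\<lambda>x. \<integral>t. F x t \<partial>lborel)"
proof -
  have [measurable]: "case_prod F \<in> borel_measurable (borel \<Otimes>\<^sub>M borel)" unfolding F_def by measurable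
  have fin: "(\<integral>\<^sup>+x. (\<integral>\<^sup>+t. ennreal \<bar>F x t\<bar> \<partial>lborel) \<partial>lborel) < \<infinity>"
  proof -
    let ?B = "\<integral>\<^sup>+y. ennreal \<bar>indicator swept y *\<^sub>R (g y \<bullet> h)\<bar> \<partial>lborel"
    have B: "?B < \<infinity>"
      using g_inner[of h] swept unfolding locally_integrable_on_def by (auto simp: integrable_iff_bounded)
    have sw[measurable]: "swept \<in> sets borel" using swept(1) by (simp add: borel_compact)
    have "(\<integral>\<^sup>+x. (\<integral>\<^sup>+t. ennreal \<bar>F x t\<bar> \<partial>lborel) \<partial>lborel) = (\<integral>\<^sup>+t. (\<integral>\<^sup>+x. ennreal \<bar>F x t\<bar> \<partial>lborel) \<partial>lborel)"
      by (rule lborel_pair.Fubini'[symmetric]) measurable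
    also have "\<dots> \<le> (\<integral>\<^sup>+t. ?B * indicator {0..1::real} t \<partial>lborel)"
    proof (rule nn_integral_mono)
      fix t :: real
      show "(\<integral>\<^sup>+x. ennreal \<bar>F x t\<bar> \<partial>lborel) \<le> ?B * indicator {0..1} t"
      proof (cases "t \<in> {0..1}")
        case True
        have "(\<integral>\<^sup>+x. ennreal \<bar>F x t\<bar> \<partial>lborel) \<le> (\<integral>\<^sup>+x. ennreal \<bar>indicator swept (t *\<^sub>R h + x) *\<^sub>R (g (t *\<^sub>R h + x) \<bullet> h)\<bar> \<partial>lborel)"
        proof (intro nn_integral_mono ennreal_leI)
          fix x
          have "x \<in> cbox a b \<Longrightarrow> t *\<^sub>R h + x \<in> swept"
            using True by (intro swept_memI[of t]) auto
          then have "\<bar>\<phi> x\<bar> \<le> indicator swept (t *\<^sub>R h + x)" using \<phi>[of x] by (cases "x \<in> cbox a b") auto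
          then have "\<bar>\<phi> x\<bar> * \<bar>g (t *\<^sub>R h + x) \<bullet> h\<bar> \<le> indicator swept (t *\<^sub>R h + x) * \<bar>g (t *\<^sub>R h + x) \<bullet> h\<bar>"
            by (intro mult_right_mono) auto
          then show "\<bar>F x t\<bar> \<le> \<bar>indicator swept (t *\<^sub>R h + x) *\<^sub>R (g (t *\<^sub>R h + x) \<bullet> h)\<bar>"
            using True by (simp add: F_def abs_mult add.commute)
        qed
        also have "\<dots> = ?B"
          by (rule nn_integral_lborel_translation) measurable
        finally show ?thesis using True by simp
      next
        case False
        then show ?thesis by (simp add: F_def)
      qed
    qed
    also have "\<dots> = ?B" by (simp add: nn_integral_cmult_indicator)
    finally show ?thesis using B by simp
  qed
  show "(\<integral>x. (\<integral>t. F x t \<partial>lborel) \<partial>lborel) = (\<integral>t. (\<integral>x. F x t \<partial>lborel) \<partial>lborel)"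
    by (rule lborel_Fubini_of_bounded(1)[OF _ fin]) measurable
  show "integrable lborel (\<lambda>x. \<integral>t. F x t \<partial>lborel)"
    by (rule lborel_Fubini_of_bounded(2)[OF _ fin]) measurable
qed

lemma bump_abs_le: "\<bar>bump n a b x\<bar> \<le> indicator (cbox a b) x"
  using bump_bounds[of n a b x] bump_eq_0[of x a b n] box_subset_cbox[of a b]
  by (cases "x \<in> cbox a b") auto

text \<open>The shift is moved from v to the bump, whose difference is an integral of directional
  derivatives. For each t the weak identity replaces v by g, and the shift back by t h restores the
  bump.\<close>

lemma bump_difference:
  "(\<integral>x. bump n a b x * ((v (x + h) - v x) - (\<integral>t. indicator {0..1} t * (g (x + t *\<^sub>R h) \<bullet> h) \<partial>lborel)) \<partial>lborel) = 0"
proof -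
  let ?\<phi> = "bump n a b"
  let ?A = "\<lambda>x. (\<integral>t. indicator {0..1} t * (g (x + t *\<^sub>R h) \<bullet> h) \<partial>lborel)"
  let ?B = "\<lambda>x t. (indicator {0..1} t * (g (x + t *\<^sub>R h) \<bullet> h))"
  let ?D = "\<lambda>x t. v x * (indicator {0..1} t * bump_dir n (x - t *\<^sub>R h))"
  have bump_int: "integrable lborel (\<lambda>x. bump n c d x * v x)" for c d
    using locally_integrable_mult_bump[OF v subset_UNIV, of n c d] by simp
  have tr: "(\<integral>x. ?\<phi> (x - h) * v x \<partial>lborel) = (\<integral>x. ?\<phi> x * v (x + h) \<partial>lborel)"
    using lborel_integral_translation[of "\<lambda>x. ?\<phi> (x - h) * v x" h] by (simp add: add.commute)
  have int1: "integrable lborel (\<lambda>x. ?\<phi> (x - h) * v x)" unfolding bump_translate by (rule bump_int)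
  have int2: "integrable lborel (\<lambda>x. ?\<phi> x * v (x + h))"
  proof -
    have "integrable (distr lborel borel ((+) h)) (\<lambda>x. ?\<phi> (x - h) * v x)" using int1 by (simp add: lborel_distr_plus)
    then show ?thesis by (subst (asm) integrable_distr_eq) (auto simp: add.commute)
  qed
  have "(\<integral>x. ?\<phi> x * (v (x + h) - v x) \<partial>lborel) = (\<integral>x. ?\<phi> (x - h) * v x \<partial>lborel) - (\<integral>x. ?\<phi> x * v x \<partial>lborel)"
    unfolding tr using int2 bump_int by (simp add: right_diff_distrib)
  also have "\<dots> = (\<integral>x. v x * (?\<phi> (x - h) - ?\<phi> x) \<partial>lborel)"
    using int1 bump_int by (simp add: right_diff_distrib mult.commute)
  also have "\<dots> = - (\<integral>x. (\<integral>t. ?D x t \<partial>lborel) \<partial>lborel)"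
    unfolding bump_fundamental_theorem bump_dir_def[symmetric] by simp
  also have "(\<integral>x. (\<integral>t. ?D x t \<partial>lborel) \<partial>lborel)
    = (\<integral>t. (\<integral>x. ?D x t \<partial>lborel) \<partial>lborel)"
  proof (rule lborel_Fubini_of_bounded(1))
    show "(\<lambda>(x, t). ?D x t) \<in> borel_measurable (borel \<Otimes>\<^sub>M borel)"
      by measurable
    obtain C where C: "\<And>x. \<bar>bump_dir n x\<bar> \<le> C" using bump_dir_bounded by blast
    have C0: "C \<ge> 0" using C[of 0] by simp
    let ?B = "\<integral>\<^sup>+x. ennreal \<bar>indicator swept x *\<^sub>R v x\<bar> \<partial>lborel"
    have B: "?B < \<infinity>"
      using v swept unfolding locally_integrable_on_def by (auto simp: integrable_iff_bounded)
    have sw[measurable]: "swept \<in> sets borel" using swept(1) by (simp add: borel_compact)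
    \<comment> \<open>Domination by C |v| on \<open>swept\<close>: for t in [0, 1] and x outside
      \<open>swept\<close> the point x - t h is outside the box, where the directional derivative
      vanishes.\<close>
    have "(\<integral>\<^sup>+x. (\<integral>\<^sup>+t. ennreal \<bar>?D x t\<bar> \<partial>lborel) \<partial>lborel)
      \<le> (\<integral>\<^sup>+x. (\<integral>\<^sup>+t. ennreal C * ennreal \<bar>indicator swept x *\<^sub>R v x\<bar> * indicator {0..1::real} t \<partial>lborel) \<partial>lborel)"
    proof (intro nn_integral_mono)
      fix x :: "real ^ 'n" and t :: real
      show "ennreal \<bar>?D x t\<bar> \<le> ennreal C * ennreal \<bar>indicator swept x *\<^sub>R v x\<bar> * indicator {0..1} t"
      proof (cases "t \<in> {0..1} \<and> x \<in> swept")
        case True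
        have "\<bar>v x * bump_dir n (x - t *\<^sub>R h)\<bar> \<le> C * \<bar>v x\<bar>"
          unfolding abs_mult mult.commute[of "\<bar>v x\<bar>"] by (intro mult_right_mono C) simp
        then have "ennreal \<bar>v x * bump_dir n (x - t *\<^sub>R h)\<bar> \<le> ennreal C * ennreal \<bar>v x\<bar>"
          using C0 by (simp add: ennreal_leI flip: ennreal_mult)
        then show ?thesis using True by simp
      next
        case False
        then have "indicator {0..1} t = (0::real) \<or> bump_dir n (x - t *\<^sub>R h) = 0"
        proof (cases "t \<in> {0..1}")
          case True
          then have "x - t *\<^sub>R h \<notin> cbox a b" using False swept_memI[of t x] by auto
          then show ?thesis by (simp add: bump_dir_eq_0)
        qed simp
        then have z: "?D x t = 0" by simp
        show ?thesis unfolding z by simp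
      qed
    qed
    also have "\<dots> = ennreal C * ?B"
      by (simp add: nn_integral_cmult_indicator nn_integral_cmult)
    finally show "(\<integral>\<^sup>+x. (\<integral>\<^sup>+t. ennreal \<bar>?D x t\<bar> \<partial>lborel) \<partial>lborel) < \<infinity>"
      using B by (auto simp: ennreal_mult_less_top intro: le_less_trans)
  qed
  also have "- \<dots> = (\<integral>t. (\<integral>x. ?\<phi> x * ?B x t \<partial>lborel) \<partial>lborel)"
  proof (subst Bochner_Integration.integral_minus[symmetric], rule Bochner_Integration.integral_cong[OF refl])
    fix t :: real
    show "- (\<integral>x. ?D x t \<partial>lborel)
      = (\<integral>x. ?\<phi> x * ?B x t \<partial>lborel)"
    proof (cases "t \<in> {0..1}")
      case True
      have "- (\<integral>x. v x * bump_dir n (x - t *\<^sub>R h) \<partial>lborel) = (\<integral>x. (g x \<bullet> h) * ?\<phi> (x - t *\<^sub>R h) \<partial>lborel)"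
        using weak_directional[of t n] True by simp
      also have "\<dots> = (\<integral>x. (g (t *\<^sub>R h + x) \<bullet> h) * ?\<phi> (t *\<^sub>R h + x - t *\<^sub>R h) \<partial>lborel)"
        by (rule lborel_integral_translation[symmetric]) measurable
      finally show ?thesis using True by (simp add: mult.commute add.commute)
    qed simp
  qed
  also have "\<dots> = (\<integral>x. (\<integral>t. ?\<phi> x * ?B x t \<partial>lborel) \<partial>lborel)"
    by (rule segment_average_integrable(1)[symmetric]) (auto intro: bump_abs_le)
  finally have eq: "(\<integral>x. ?\<phi> x * (v (x + h) - v x) \<partial>lborel) = (\<integral>x. ?\<phi> x * ?A x \<partial>lborel)"
    by simp
  have "integrable lborel (\<lambda>x. \<integral>t. ?\<phi> x * ?B x t \<partial>lborel)"
    by (rule segment_average_integrable(2)) (auto intro: bump_abs_le)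
  then have int3: "integrable lborel (\<lambda>x. ?\<phi> x * ?A x)"
    by simp
  have int4: "integrable lborel (\<lambda>x. ?\<phi> x * (v (x + h) - v x))"
    unfolding right_diff_distrib by (intro Bochner_Integration.integrable_diff int2 bump_int)
  show ?thesis
    unfolding right_diff_distrib[of "?\<phi> _" "v (_ + h) - v _"] Bochner_Integration.integral_diff[OF int4 int3] eq by simp
qed

end

text \<open>Bumps on smaller boxes converge to indicators, so the difference of the two sides has
  integral 0 over every box whose closure lies in the given one. A function with this property
  vanishes almost everywhere.\<close>

lemma difference_eq_segment_average:
  assumes seg: "\<And>x t. x \<in> cbox a b \<Longrightarrow> 0 \<le> t \<Longrightarrow> t \<le> 1 \<Longrightarrow> x + t *\<^sub>R h \<in> \<Omega>"
  shows "AE x in lborel. x \<in> box a b \<longrightarrow> v (x + h) - v x = (\<integral>t. indicator {0..1} t * (g (x + t *\<^sub>R h) \<bullet> h) \<partial>lborel)"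
proof -
  define w where "w x = (v (x + h) - v x) - (\<integral>t. indicator {0..1} t * (g (x + t *\<^sub>R h) \<bullet> h) \<partial>lborel)" for x
  \<comment> \<open>Cutting w off at the closed box makes it integrable on the whole space, and so a
    majorant for dominated convergence.\<close>
  define w0 where "w0 x = indicator (cbox a b) x * w x" for x
  have [measurable]: "w \<in> borel_measurable borel" unfolding w_def by measurable
  have int: "integrable lborel w0"
  proof -
    have K: "integrable lborel (\<lambda>x. indicator (cbox (a + h) (b + h)) x *\<^sub>R v x)" "integrable lborel (\<lambda>x. indicator (cbox a b) x *\<^sub>R v x)"
      using v compact_cbox unfolding locally_integrable_on_def by auto
    have "integrable (distr lborel borel ((+) h)) (\<lambda>x. indicator (cbox (a + h) (b + h)) x *\<^sub>R v x)"
      using K(1) by (simp add: lborel_distr_plus)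
    then have "integrable lborel (\<lambda>x. indicator (cbox (a + h) (b + h)) (h + x) *\<^sub>R v (h + x))"
      by (subst (asm) integrable_distr_eq) auto
    moreover have "indicator (cbox (a + h) (b + h)) (h + x) = (indicator (cbox a b) x :: real)" for x
      by (auto simp: indicator_def mem_box_cart algebra_simps)
    ultimately have "integrable lborel (\<lambda>x. indicator (cbox a b) x * v (x + h))" by (simp add: add.commute)
    moreover have "integrable lborel (\<lambda>x. \<integral>t. indicator (cbox a b) x * (indicator {0..1} t * (g (x + t *\<^sub>R h) \<bullet> h)) \<partial>lborel)"
      by (rule segment_average_integrable(2)[OF seg]) auto
    ultimately have "integrable lborel (\<lambda>x. indicator (cbox a b) x * v (x + h) - indicator (cbox a b) x * v x
       - (\<integral>t. indicator (cbox a b) x * (indicator {0..1} t * (g (x + t *\<^sub>R h) \<bullet> h)) \<partial>lborel))"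
      using K(2) by (intro Bochner_Integration.integrable_diff) auto
    moreover have "(\<lambda>x. indicator (cbox a b) x * v (x + h) - indicator (cbox a b) x * v x
       - (\<integral>t. indicator (cbox a b) x * (indicator {0..1} t * (g (x + t *\<^sub>R h) \<bullet> h)) \<partial>lborel)) = w0"
      unfolding w0_def w_def by (simp add: fun_eq_iff right_diff_distrib)
    ultimately show ?thesis by (simp only:)
  qed
  have box0: "(\<integral>x. indicator (box c d) x * w x \<partial>lborel) = 0" if cd: "cbox c d \<subseteq> cbox a b" for c d
  proof -
    have "(\<integral>x. bump n c d x * w x \<partial>lborel) = 0" for n
      unfolding w_def by (rule bump_difference) (use cd seg in blast)
    moreover have "bump n c d x * w x = bump n c d x * w0 x" for n x
      using cd box_subset_cbox[of c d] bump_eq_0[of x c d n] by (cases "x \<in> box c d") (auto simp: w0_def)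
    ultimately have "(\<lambda>n. \<integral>x. bump n c d x * w0 x \<partial>lborel) = (\<lambda>_. 0)" by simp
    moreover have "(\<lambda>n. \<integral>x. bump n c d x * w0 x \<partial>lborel) \<longlonglongrightarrow> (\<integral>x. indicator (box c d) x * w0 x \<partial>lborel)"
    proof (rule integral_dominated_convergence)
      have [measurable]: "w0 \<in> borel_measurable borel" using borel_measurable_integrable[OF int] by simp
      show "(\<lambda>x. indicator (box c d) x * w0 x) \<in> borel_measurable lborel"
        by (intro borel_measurable_times borel_measurable_indicator) auto
      show "(\<lambda>x. bump n c d x * w0 x) \<in> borel_measurable lborel" for n by measurable
      show "integrable lborel (\<lambda>x. \<bar>w0 x\<bar>)" using int by simp
      show "AE x in lborel. (\<lambda>n. bump n c d x * w0 x) \<longlonglongrightarrow> indicator (box c d) x * w0 x"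
        by (intro AE_I2 tendsto_mult bump_tendsto tendsto_const)
      show "AE x in lborel. norm (bump n c d x * w0 x) \<le> \<bar>w0 x\<bar>" for n
        using bump_bounds[of n c d] by (intro AE_I2) (auto simp: abs_mult intro!: mult_left_le_one_le)
    qed
    ultimately have "(\<integral>x. indicator (box c d) x * w0 x \<partial>lborel) = 0"
      using LIMSEQ_unique[OF tendsto_const] by fastforce
    moreover have "indicator (box c d) x * w0 x = indicator (box c d) x * w x" for x
      using cd box_subset_cbox[of c d] by (cases "x \<in> box c d") (auto simp: w0_def)
    ultimately show ?thesis by simp
  qed
  have "AE x in lborel. indicator (box a b) x * w x = 0"
  proof (rule AE_eq_0_if_box_integrals_eq_0)
    have "integrable lborel (\<lambda>x. indicator (box a b) x *\<^sub>R w0 x)"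
      using int by (intro integrable_mult_indicator) auto
    moreover have "(\<lambda>x. indicator (box a b) x *\<^sub>R w0 x) = (\<lambda>x. indicator (box a b) x * w x)"
    proof
      show "indicator (box a b) x *\<^sub>R w0 x = indicator (box a b) x * w x" for x
        using box_subset_cbox[of a b] by (cases "x \<in> box a b") (auto simp: w0_def)
    qed
    ultimately show "integrable lborel (\<lambda>x. indicator (box a b) x * w x)" by (simp only:)
    fix c d :: "real ^ 'n"
    \<comment> \<open>An arbitrary box is intersected with the given one, because the vanishing
      integral is available for boxes whose closure lies in \<open>cbox a b\<close>.\<close>
    obtain e f where ef: "box c d \<inter> box a b = box e f" using box_Int_box by blast
    have "(\<integral>x. indicator (box c d) x * (indicator (box a b) x * w x) \<partial>lborel) = (\<integral>x. indicator (box e f) x * w x \<partial>lborel)"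
      unfolding ef[symmetric] by (intro Bochner_Integration.integral_cong) (auto simp: indicator_def)
    also have "\<dots> = 0"
    proof (cases "box e f = {}")
      case False
      have "closure (box e f) \<subseteq> cbox a b"
        using ef box_subset_cbox[of a b] by (intro closure_minimal) auto
      then show ?thesis using box0[of e f] closure_box[OF False] by simp
    qed simp
    finally show "(\<integral>x. indicator (box c d) x * (indicator (box a b) x * w x) \<partial>lborel) = 0" .
  qed
  then show ?thesis
    by eventually_elim (auto simp: w_def)
qed

lemma norm_difference_le_segment_average:
  assumes \<Omega>: "open \<Omega>" and fwd: "\<And>x t. x \<in> \<Omega> \<Longrightarrow> t \<ge> 0 \<Longrightarrow> x + t *\<^sub>R h \<in> \<Omega>"
  shows "AE x in lborel. x \<in> \<Omega> \<longrightarrow>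
    ennreal \<bar>v (x + h) - v x\<bar> \<le> (\<integral>\<^sup>+t. ennreal \<bar>g (x + t *\<^sub>R h) \<bullet> h\<bar> * indicator {0..1} t \<partial>lborel)"
proof -
  let ?A = "\<lambda>x. (\<integral>t. indicator {0..1} t * (g (x + t *\<^sub>R h) \<bullet> h) \<partial>lborel)"
  let ?N = "\<lambda>x. (\<integral>\<^sup>+t. ennreal \<bar>g (x + t *\<^sub>R h) \<bullet> h\<bar> * indicator {0..1} t \<partial>lborel)"
  obtain D where D: "countable D" "D \<subseteq> Pow \<Omega>" "\<And>X. X \<in> D \<Longrightarrow> \<exists>a b. X = cbox a b" "\<Union>D = \<Omega>"
    using open_countable_Union_open_cbox[OF \<Omega>] by metis
  have "AE x in lborel. \<forall>X\<in>D. x \<in> interior X \<longrightarrow>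
     v (x + h) - v x = ?A x"
  proof (subst AE_ball_countable[OF D(1)], rule ballI)
    fix X assume X: "X \<in> D"
    then obtain a b where ab: "X = cbox a b" using D by blast
    have "\<And>x t. x \<in> cbox a b \<Longrightarrow> 0 \<le> t \<Longrightarrow> t \<le> 1 \<Longrightarrow> x + t *\<^sub>R h \<in> \<Omega>"
      using X ab D(2) fwd by blast
    from difference_eq_segment_average[OF this]
    show "AE x in lborel. x \<in> interior X \<longrightarrow> v (x + h) - v x = ?A x"
      by (simp add: ab interior_cbox)
  qed
  \<comment> \<open>The covering boxes are closed and the identity holds in their interiors; the
    countably many boundaries form a null set.\<close>
  moreover have "AE x in lborel. \<forall>X\<in>D. x \<notin> X - interior X"
  proof (subst AE_ball_countable[OF D(1)], rule ballI)
    fix X assume "X \<in> D"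
    then obtain a b where ab: "X = cbox a b" using D by blast
    then have "X - interior X \<in> null_sets lborel" by (simp add: interior_cbox null_sets_cbox_Diff_box)
    then show "AE x in lborel. x \<notin> X - interior X" by (rule AE_not_in)
  qed
  ultimately show ?thesis
  proof eventually_elim
    case (elim x)
    show ?case
    proof
      assume "x \<in> \<Omega>"
      then obtain X where "X \<in> D" "x \<in> X" using D(4) by blast
      then have eq: "v (x + h) - v x = ?A x" using elim by blast
      show "ennreal \<bar>v (x + h) - v x\<bar> \<le> ?N x"
      proof (cases "integrable lborel (\<lambda>t. indicator {0..1} t * (g (x + t *\<^sub>R h) \<bullet> h))")
        case True
        have "ennreal \<bar>v (x + h) - v x\<bar> \<le> (\<integral>\<^sup>+t. ennreal (norm (indicator {0..1} t * (g (x + t *\<^sub>R h) \<bullet> h))) \<partial>lborel)"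
          unfolding eq using integral_norm_bound_ennreal[OF True] by simp
        also have "\<dots> = ?N x"
          by (intro nn_integral_cong) (auto simp: indicator_def)
        finally show ?thesis .
      next
        case False
        \<comment> \<open>The Bochner integral of a non-integrable function is 0, so in this case
          \<open>eq\<close> says that the difference vanishes.\<close>
        then show ?thesis unfolding eq by (simp add: not_integrable_integral_eq)
      qed
    qed
  qed
qed

text \<open>The power mean is taken in t along the segment, followed by Fubini. For fixed t the
  shift by t h maps \<Omega> into itself, so each integral over x is at most the one at t =
  0.\<close>

lemma difference_power_le_gradient:
  assumes \<Omega>: "open \<Omega>" and fwd: "\<And>x t. x \<in> \<Omega> \<Longrightarrow> t \<ge> 0 \<Longrightarrow> x + t *\<^sub>R h \<in> \<Omega>" and p: "p \<ge> 1"
  shows "(\<integral>\<^sup>+x. ennreal (\<bar>v (x + h) - v x\<bar> powr p) * indicator \<Omega> x \<partial>lborel)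
    \<le> (\<integral>\<^sup>+x. ennreal (\<bar>g x \<bullet> h\<bar> powr p) * indicator \<Omega> x \<partial>lborel)"
proof -
  have ae: "AE x in lborel. x \<in> \<Omega> \<longrightarrow>
      ennreal \<bar>v (x + h) - v x\<bar> \<le> (\<integral>\<^sup>+t. ennreal \<bar>g (x + t *\<^sub>R h) \<bullet> h\<bar> * indicator {0..1} t \<partial>lborel)"
    by (rule norm_difference_le_segment_average) (use \<Omega> fwd in auto)
  have [measurable]: "\<Omega> \<in> sets borel" using \<Omega> by simp
  let ?I = "(\<integral>\<^sup>+x. ennreal (\<bar>g x \<bullet> h\<bar> powr p) * indicator \<Omega> x \<partial>lborel)"
  let ?H = "\<lambda>x t. ennreal (\<bar>g (x + t *\<^sub>R h) \<bullet> h\<bar> powr p)"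
  have "(\<integral>\<^sup>+x. ennreal (\<bar>v (x + h) - v x\<bar> powr p) * indicator \<Omega> x \<partial>lborel)
    \<le> (\<integral>\<^sup>+x. (\<integral>\<^sup>+t. ?H x t * indicator {0..1} t \<partial>lborel) * indicator \<Omega> x \<partial>lborel)"
  proof (rule nn_integral_mono_AE)
    show "AE x in lborel. ennreal (\<bar>v (x + h) - v x\<bar> powr p) * indicator \<Omega> x
      \<le> (\<integral>\<^sup>+t. ?H x t * indicator {0..1} t \<partial>lborel) * indicator \<Omega> x"
      using ae
    proof eventually_elim
      case (elim x)
      show ?case
      proof (cases "x \<in> \<Omega>")
        case True
        with elim have "ennreal (\<bar>v (x + h) - v x\<bar> powr p) \<le> (\<integral>\<^sup>+t. ?H x t * indicator {0..1} t \<partial>lborel)"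
          by (intro nn_integral_power_mean[OF p]) auto
        then show ?thesis using True by simp
      qed simp
    qed
  qed
  also have "\<dots> = (\<integral>\<^sup>+x. (\<integral>\<^sup>+t. ?H x t * indicator {0..1} t * indicator \<Omega> x \<partial>lborel) \<partial>lborel)"
    by (intro nn_integral_cong nn_integral_multc[symmetric]) measurable
  also have "\<dots> = (\<integral>\<^sup>+t. (\<integral>\<^sup>+x. ?H x t * indicator {0..1} t * indicator \<Omega> x \<partial>lborel) \<partial>lborel)"
    by (rule lborel_pair.Fubini') measurable
  also have "\<dots> \<le> (\<integral>\<^sup>+t. ?I * indicator {0..1::real} t \<partial>lborel)"
  proof (rule nn_integral_mono)
    fix t :: real
    show "(\<integral>\<^sup>+x. ?H x t * indicator {0..1} t * indicator \<Omega> x \<partial>lborel)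
      \<le> ?I * indicator {0..1} t"
    proof (cases "t \<in> {0..1}")
      case True
      have "(\<integral>\<^sup>+x. ?H x t * indicator {0..1} t * indicator \<Omega> x \<partial>lborel)
         \<le> (\<integral>\<^sup>+x. ennreal (\<bar>g (t *\<^sub>R h + x) \<bullet> h\<bar> powr p) * indicator \<Omega> (t *\<^sub>R h + x) \<partial>lborel)"
        using True fwd[of _ t] by (intro nn_integral_mono) (auto simp: indicator_def add.commute)
      also have "\<dots> = ?I"
        by (rule nn_integral_lborel_translation) measurable
      finally show ?thesis using True by simp
    qed simp
  qed
  also have "\<dots> = ?I"
    by (simp add: nn_integral_cmult_indicator)
  finally show ?thesis .
qed

lemma difference_le_sup_gradient:
  assumes \<Omega>: "open \<Omega>" and fwd: "\<And>x t. x \<in> \<Omega> \<Longrightarrow> t \<ge> 0 \<Longrightarrow> x + t *\<^sub>R h \<in> \<Omega>"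
    and L: "\<And>x. norm (g x) \<le> L"
  shows "AE x in lborel. x \<in> \<Omega> \<longrightarrow> \<bar>v (x + h) - v x\<bar> \<le> L * norm h"
proof -
  have ae: "AE x in lborel. x \<in> \<Omega> \<longrightarrow>
      ennreal \<bar>v (x + h) - v x\<bar> \<le> (\<integral>\<^sup>+t. ennreal \<bar>g (x + t *\<^sub>R h) \<bullet> h\<bar> * indicator {0..1} t \<partial>lborel)"
    by (rule norm_difference_le_segment_average) (use \<Omega> fwd in auto)
  have Lh: "\<bar>g y \<bullet> h\<bar> \<le> L * norm h" for y
    using Cauchy_Schwarz_ineq2[of "g y" h] mult_right_mono[OF L[of y] norm_ge_zero[of h]] by linarith
  have L0: "L \<ge> 0" using L[of 0] norm_ge_zero[of "g 0"] by linarith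
  have le: "(\<integral>\<^sup>+t. ennreal \<bar>g (x + t *\<^sub>R h) \<bullet> h\<bar> * indicator {0..1} t \<partial>lborel) \<le> ennreal (L * norm h)" for x
  proof -
    have "(\<integral>\<^sup>+t. ennreal \<bar>g (x + t *\<^sub>R h) \<bullet> h\<bar> * indicator {0..1} t \<partial>lborel) \<le> (\<integral>\<^sup>+t. ennreal (L * norm h) * indicator {0..1::real} t \<partial>lborel)"
      by (intro nn_integral_mono mult_right_mono ennreal_leI Lh) simp
    then show ?thesis by (simp add: nn_integral_cmult_indicator)
  qed
  show ?thesis
    using ae
  proof eventually_elim
    case (elim x)
    show ?case
    proof
      assume "x \<in> \<Omega>"
      with elim le[of x] have "ennreal \<bar>v (x + h) - v x\<bar> \<le> ennreal (L * norm h)"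
        by (meson order_trans)
      then show "\<bar>v (x + h) - v x\<bar> \<le> L * norm h" using L0 by (simp add: ennreal_le_iff)
    qed
  qed
qed

end

section \<open>The energy of differences\<close>

lemma nn_integral_lebesgue_on:
  assumes [measurable]: "\<Omega> \<in> sets borel" "F \<in> borel_measurable borel"
  shows "(\<integral>\<^sup>+x. F x \<partial>lebesgue_on \<Omega>) = (\<integral>\<^sup>+x. F x * indicator \<Omega> x \<partial>lborel)"
proof -
  have "(\<integral>\<^sup>+x. F x \<partial>lebesgue_on \<Omega>) = (\<integral>\<^sup>+x. F x * indicator \<Omega> x \<partial>lebesgue)"
    by (rule nn_integral_restrict_space) simp
  also have "\<dots> = (\<integral>\<^sup>+x. F x * indicator \<Omega> x \<partial>lborel)"
    by (rule nn_integral_completion)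
  finally show ?thesis .
qed

lemma AE_lebesgue_on_iff:
  assumes "\<Omega> \<in> sets borel"
  shows "(AE x in lebesgue_on \<Omega>. P x) \<longleftrightarrow> (AE x in lebesgue. x \<in> \<Omega> \<longrightarrow> P x)"
  using assms by (subst AE_restrict_space_iff) auto

lemma AE_lebesgue_onI:
  assumes "\<Omega> \<in> sets borel" "AE x in lborel. P x"
  shows "AE x in lebesgue_on \<Omega>. P x"
  unfolding AE_lebesgue_on_iff[OF assms(1)] using AE_completion[OF assms(2)] by eventually_elim simp

text \<open>Common abstraction of the whole space and a half space. The sign is chosen for each
  direction h uniformly in x, so that translations in the chosen direction map \<Omega> into
  itself.\<close>

definition ray_domain :: "'a::euclidean_space set \<Rightarrow> bool" where
  "ray_domain \<Omega> \<longleftrightarrow> open \<Omega> \<and>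
    (\<forall>h. (\<forall>x\<in>\<Omega>. \<forall>t\<ge>0. x + t *\<^sub>R h \<in> \<Omega>) \<or> (\<forall>x\<in>\<Omega>. \<forall>t\<ge>0. x - t *\<^sub>R h \<in> \<Omega>))"

lemma ray_domain_UNIV: "ray_domain UNIV"
  by (simp add: ray_domain_def)

lemma ray_domain_half_space: "ray_domain (half_space k)"
proof -
  have "open (half_space k)"
    unfolding half_space_def by (intro open_Collect_less continuous_intros)
  moreover have "(\<forall>x\<in>half_space k. \<forall>t\<ge>0. x + t *\<^sub>R h \<in> half_space k) \<or> (\<forall>x\<in>half_space k. \<forall>t\<ge>0. x - t *\<^sub>R h \<in> half_space k)" for h :: "real ^ 'a"
  proof (cases "h $ k \<ge> 0")
    case True
    then show ?thesis by (auto simp: half_space_def intro!: add_pos_nonneg)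
  next
    case False
    then have "x $ k - t * h $ k > 0" if "x $ k > 0" "t \<ge> 0" for x :: "real ^ 'a" and t
      using that mult_nonneg_nonpos[of t "h $ k"] by linarith
    then show ?thesis by (auto simp: half_space_def)
  qed
  ultimately show ?thesis by (simp add: ray_domain_def)
qed

text \<open>The function G of the overview. The two indicators make it even in h.\<close>

definition diff_energy :: "real \<Rightarrow> 'a::euclidean_space set \<Rightarrow> ('a \<Rightarrow> real) \<Rightarrow> 'a \<Rightarrow> ennreal" where
  "diff_energy r \<Omega> v h =
     (\<integral>\<^sup>+x. ennreal (\<bar>v (x + h) - v x\<bar> powr r) * indicator \<Omega> x * indicator \<Omega> (x + h) \<partial>lborel)"

context
  fixes \<Omega> :: "'a::euclidean_space set" and v :: "'a \<Rightarrow> real" and r :: real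
  assumes \<Omega>: "ray_domain \<Omega>" and v[measurable]: "v \<in> borel_measurable borel" and r: "r \<ge> 1"
begin

lemma ray_domain_sets[measurable]: "\<Omega> \<in> sets borel"
  using \<Omega> by (simp add: ray_domain_def)

lemma diff_energy_measurable: "diff_energy r \<Omega> v \<in> borel_measurable borel"
  unfolding diff_energy_def by measurable

lemma diff_energy_uminus: "diff_energy r \<Omega> v (- h) = diff_energy r \<Omega> v h"
proof -
  let ?f = "\<lambda>x. ennreal (\<bar>v (x + h) - v x\<bar> powr r) * indicator \<Omega> x * indicator \<Omega> (x + h)"
  have "(\<integral>\<^sup>+x. ?f (- h + x) \<partial>lborel) = (\<integral>\<^sup>+x. ?f x \<partial>lborel)"
    by (rule nn_integral_lborel_translation) measurable
  then show ?thesis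
    unfolding diff_energy_def by (simp add: abs_minus_commute mult_ac add.commute)
qed

lemma diff_energy_forward:
  assumes "\<And>x t. x \<in> \<Omega> \<Longrightarrow> t \<ge> 0 \<Longrightarrow> x + t *\<^sub>R h \<in> \<Omega>" "t \<ge> 0"
  shows "diff_energy r \<Omega> v (t *\<^sub>R h) = (\<integral>\<^sup>+x. ennreal (\<bar>v (x + t *\<^sub>R h) - v x\<bar> powr r) * indicator \<Omega> x \<partial>lborel)"
  unfolding diff_energy_def using assms by (intro nn_integral_cong) (auto simp: indicator_def)

text \<open>Reduction to directions that point into \<Omega>; in the applications the second premise
  is discharged by evenness of the energy.\<close>

lemma ray_domain_induct:
  assumes "\<And>h. (\<And>x t. x \<in> \<Omega> \<Longrightarrow> t \<ge> 0 \<Longrightarrow> x + t *\<^sub>R h \<in> \<Omega>) \<Longrightarrow> P h"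
    and "\<And>h. P (- h) \<Longrightarrow> P h"
  shows "P h"
proof -
  consider "\<forall>x\<in>\<Omega>. \<forall>t\<ge>0. x + t *\<^sub>R h \<in> \<Omega>" | "\<forall>x\<in>\<Omega>. \<forall>t\<ge>0. x - t *\<^sub>R h \<in> \<Omega>"
    using \<Omega> by (auto simp: ray_domain_def)
  then show ?thesis
    by cases (use assms(1)[of h] assms(1)[of "- h"] assms(2)[of h] in auto)
qed

text \<open>The triangle inequality is raised to the power r, with the second difference based at x
  + e h. Since the translation by e h maps \<Omega> into itself, the integral of this second term is
  at most the full energy.\<close>

lemma diff_energy_split:
  assumes fwd: "\<And>x t. x \<in> \<Omega> \<Longrightarrow> t \<ge> 0 \<Longrightarrow> x + t *\<^sub>R h \<in> \<Omega>" and abc: "0 \<le> a" "0 \<le> b" "0 \<le> c"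
    and tri: "\<And>x. \<bar>v (x + a *\<^sub>R h) - v x\<bar> \<le> \<bar>v (x + b *\<^sub>R h) - v x\<bar> + \<bar>v (x + e *\<^sub>R h + c *\<^sub>R h) - v (x + e *\<^sub>R h)\<bar>"
    and e: "e \<ge> 0"
  shows "diff_energy r \<Omega> v (a *\<^sub>R h) \<le> ennreal (2 powr (r - 1)) * (diff_energy r \<Omega> v (b *\<^sub>R h) + diff_energy r \<Omega> v (c *\<^sub>R h))"
proof -
  let ?b = "\<lambda>x. ennreal (\<bar>v (x + b *\<^sub>R h) - v x\<bar> powr r) * indicator \<Omega> x"
  let ?c = "\<lambda>x. ennreal (\<bar>v (x + c *\<^sub>R h) - v x\<bar> powr r) * indicator \<Omega> x"
  have "diff_energy r \<Omega> v (a *\<^sub>R h) = (\<integral>\<^sup>+x. ennreal (\<bar>v (x + a *\<^sub>R h) - v x\<bar> powr r) * indicator \<Omega> x \<partial>lborel)"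
    using fwd abc(1) by (rule diff_energy_forward)
  also have "\<dots> \<le> (\<integral>\<^sup>+x. ennreal (2 powr (r - 1)) * (?b x + ?c (e *\<^sub>R h + x)) \<partial>lborel)"
  proof (rule nn_integral_mono)
    fix x
    show "ennreal (\<bar>v (x + a *\<^sub>R h) - v x\<bar> powr r) * indicator \<Omega> x \<le> ennreal (2 powr (r - 1)) * (?b x + ?c (e *\<^sub>R h + x))"
    proof (cases "x \<in> \<Omega>")
      case True
      then have x': "e *\<^sub>R h + x \<in> \<Omega>" using fwd[of x e] e by (simp add: add.commute)
      have "\<bar>v (x + a *\<^sub>R h) - v x\<bar> powr r \<le> (\<bar>v (x + b *\<^sub>R h) - v x\<bar> + \<bar>v (x + e *\<^sub>R h + c *\<^sub>R h) - v (x + e *\<^sub>R h)\<bar>) powr r"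
        using tri r by (intro powr_mono2) auto
      also have "\<dots> \<le> 2 powr (r - 1) * (\<bar>v (x + b *\<^sub>R h) - v x\<bar> powr r + \<bar>v (x + e *\<^sub>R h + c *\<^sub>R h) - v (x + e *\<^sub>R h)\<bar> powr r)"
        by (rule powr_add_le[OF r]) auto
      finally have "ennreal (\<bar>v (x + a *\<^sub>R h) - v x\<bar> powr r) \<le> ennreal (2 powr (r - 1) * (\<bar>v (x + b *\<^sub>R h) - v x\<bar> powr r + \<bar>v (x + e *\<^sub>R h + c *\<^sub>R h) - v (x + e *\<^sub>R h)\<bar> powr r))"
        by (rule ennreal_leI)
      then show ?thesis using True x' by (simp add: ennreal_mult add.commute)
    qed simp
  qed
  also have "\<dots> = ennreal (2 powr (r - 1)) * ((\<integral>\<^sup>+x. ?b x \<partial>lborel) + (\<integral>\<^sup>+x. ?c (e *\<^sub>R h + x) \<partial>lborel))"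
    by (simp add: nn_integral_cmult nn_integral_add)
  also have "(\<integral>\<^sup>+x. ?c (e *\<^sub>R h + x) \<partial>lborel) = (\<integral>\<^sup>+x. ?c x \<partial>lborel)"
    by (rule nn_integral_lborel_translation) measurable
  also have "(\<integral>\<^sup>+x. ?b x \<partial>lborel) = diff_energy r \<Omega> v (b *\<^sub>R h)"
    using fwd abc(2) by (rule diff_energy_forward[symmetric])
  also have "(\<integral>\<^sup>+x. ?c x \<partial>lborel) = diff_energy r \<Omega> v (c *\<^sub>R h)"
    using fwd abc(3) by (rule diff_energy_forward[symmetric])
  finally show ?thesis .
qed

lemma diff_energy_double: "diff_energy r \<Omega> v (2 *\<^sub>R h) \<le> ennreal (2 powr r) * diff_energy r \<Omega> v h"
proof (induction h rule: ray_domain_induct)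
  case (1 h)
  have "diff_energy r \<Omega> v (2 *\<^sub>R h) \<le> ennreal (2 powr (r - 1)) * (diff_energy r \<Omega> v (1 *\<^sub>R h) + diff_energy r \<Omega> v (1 *\<^sub>R h))"
  proof (rule diff_energy_split[where e=1])
    show "x + t *\<^sub>R h \<in> \<Omega>" if "x \<in> \<Omega>" "t \<ge> 0" for x t using that by (rule 1)
    show "\<bar>v (x + 2 *\<^sub>R h) - v x\<bar> \<le> \<bar>v (x + 1 *\<^sub>R h) - v x\<bar> + \<bar>v (x + 1 *\<^sub>R h + 1 *\<^sub>R h) - v (x + 1 *\<^sub>R h)\<bar>" for x
      by (simp add: scaleR_2 add.assoc)
  qed simp_all
  also have "\<dots> = ennreal (2 powr (r - 1) * 2) * diff_energy r \<Omega> v h"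
    by (simp add: ennreal_mult mult_2[symmetric] mult.assoc)
  also have "2 powr (r - 1) * 2 = 2 powr r" by (simp add: powr_diff)
  finally show ?case .
next
  case (2 h)
  then show ?case using diff_energy_uminus[of h] diff_energy_uminus[of "2 *\<^sub>R h"] by simp
qed

text \<open>One goes from x to x + l h and back to x + h; the way back is a difference for (l - 1) h
  based at x + h. All these points lie on the ray from x.\<close>

lemma diff_energy_quasi_monotone:
  assumes l: "l \<ge> 1"
  shows "diff_energy r \<Omega> v h \<le> ennreal (2 powr (r - 1)) * (diff_energy r \<Omega> v (l *\<^sub>R h) + diff_energy r \<Omega> v ((l - 1) *\<^sub>R h))"
proof (induction h rule: ray_domain_induct)
  case (1 h)
  have "diff_energy r \<Omega> v (1 *\<^sub>R h) \<le> ennreal (2 powr (r - 1)) * (diff_energy r \<Omega> v (l *\<^sub>R h) + diff_energy r \<Omega> v ((l - 1) *\<^sub>R h))"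
  proof (rule diff_energy_split[where e=1])
    show "x + t *\<^sub>R h \<in> \<Omega>" if "x \<in> \<Omega>" "t \<ge> 0" for x t using that by (rule 1)
    have e: "x + 1 *\<^sub>R h + (l - 1) *\<^sub>R h = x + l *\<^sub>R h" for x by (simp add: scaleR_left_diff_distrib)
    show "\<bar>v (x + 1 *\<^sub>R h) - v x\<bar> \<le> \<bar>v (x + l *\<^sub>R h) - v x\<bar> + \<bar>v (x + 1 *\<^sub>R h + (l - 1) *\<^sub>R h) - v (x + 1 *\<^sub>R h)\<bar>" for x
      unfolding e by arith
  qed (use l in simp_all)
  then show ?case by simp
next
  case (2 h)
  then show ?case using diff_energy_uminus[of h] diff_energy_uminus[of "l *\<^sub>R h"] diff_energy_uminus[of "(l - 1) *\<^sub>R h"] by simp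
qed

lemma diff_energy_le_norm:
  "diff_energy r \<Omega> v h \<le> ennreal (2 powr r) * (\<integral>\<^sup>+x. ennreal (\<bar>v x\<bar> powr r) * indicator \<Omega> x \<partial>lborel)"
proof -
  let ?f = "\<lambda>x. ennreal (\<bar>v x\<bar> powr r) * indicator \<Omega> x"
  have "diff_energy r \<Omega> v h \<le> (\<integral>\<^sup>+x. ennreal (2 powr (r - 1)) * (?f (h + x) + ?f x) \<partial>lborel)"
    unfolding diff_energy_def
  proof (rule nn_integral_mono)
    fix x
    show "ennreal (\<bar>v (x + h) - v x\<bar> powr r) * indicator \<Omega> x * indicator \<Omega> (x + h) \<le> ennreal (2 powr (r - 1)) * (?f (h + x) + ?f x)"
    proof (cases "x \<in> \<Omega> \<and> x + h \<in> \<Omega>")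
      case True
      have "\<bar>v (x + h) - v x\<bar> powr r \<le> (\<bar>v (x + h)\<bar> + \<bar>v x\<bar>) powr r"
        using r by (intro powr_mono2) auto
      also have "\<dots> \<le> 2 powr (r - 1) * (\<bar>v (x + h)\<bar> powr r + \<bar>v x\<bar> powr r)"
        by (rule powr_add_le[OF r]) auto
      finally have "ennreal (\<bar>v (x + h) - v x\<bar> powr r) \<le> ennreal (2 powr (r - 1) * (\<bar>v (x + h)\<bar> powr r + \<bar>v x\<bar> powr r))"
        by (rule ennreal_leI)
      then show ?thesis using True by (simp add: ennreal_mult add.commute)
    qed auto
  qed
  also have "\<dots> = ennreal (2 powr (r - 1)) * ((\<integral>\<^sup>+x. ?f (h + x) \<partial>lborel) + (\<integral>\<^sup>+x. ?f x \<partial>lborel))"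
    by (simp add: nn_integral_cmult nn_integral_add)
  also have "(\<integral>\<^sup>+x. ?f (h + x) \<partial>lborel) = (\<integral>\<^sup>+x. ?f x \<partial>lborel)"
    by (rule nn_integral_lborel_translation) measurable
  also have "ennreal (2 powr (r - 1)) * ((\<integral>\<^sup>+x. ?f x \<partial>lborel) + (\<integral>\<^sup>+x. ?f x \<partial>lborel)) = ennreal (2 powr (r - 1) * 2) * (\<integral>\<^sup>+x. ?f x \<partial>lborel)"
    by (simp add: ennreal_mult mult_2[symmetric] mult.assoc)
  also have "2 powr (r - 1) * 2 = 2 powr r" by (simp add: powr_diff)
  finally show ?thesis .
qed

lemma double_integral_eq_diff_energy:
  "(\<integral>\<^sup>+x. (\<integral>\<^sup>+y. ennreal (\<bar>v x - v y\<bar> powr r / norm (x - y) powr a) * indicator \<Omega> y \<partial>lborel) * indicator \<Omega> x \<partial>lborel)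
    = (\<integral>\<^sup>+h. diff_energy r \<Omega> v h * ennreal (norm h powr - a) \<partial>lborel)"
proof -
  let ?E = "\<lambda>x y. ennreal (\<bar>v x - v y\<bar> powr r / norm (x - y) powr a)"
  let ?F = "\<lambda>x h. ennreal (\<bar>v (x + h) - v x\<bar> powr r) * indicator \<Omega> x * indicator \<Omega> (x + h) * ennreal (norm h powr - a)"
  have "(\<integral>\<^sup>+x. (\<integral>\<^sup>+y. ?E x y * indicator \<Omega> y \<partial>lborel) * indicator \<Omega> x \<partial>lborel)
    = (\<integral>\<^sup>+x. (\<integral>\<^sup>+h. ?F x h \<partial>lborel) \<partial>lborel)"
  proof (rule nn_integral_cong)
    fix x
    have "(\<integral>\<^sup>+h. ?F x h \<partial>lborel)
      = (\<integral>\<^sup>+h. (\<lambda>y. ?E x y * indicator \<Omega> y * indicator \<Omega> x) (x + h) \<partial>lborel)"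
      by (intro nn_integral_cong) (auto simp: indicator_def abs_minus_commute powr_minus divide_inverse simp flip: ennreal_mult)
    also have "\<dots> = (\<integral>\<^sup>+y. ?E x y * indicator \<Omega> y * indicator \<Omega> x \<partial>lborel)"
      by (rule nn_integral_lborel_translation) measurable
    also have "\<dots> = (\<integral>\<^sup>+y. ?E x y * indicator \<Omega> y \<partial>lborel) * indicator \<Omega> x"
      by (rule nn_integral_multc) measurable
    finally show "(\<integral>\<^sup>+y. ?E x y * indicator \<Omega> y \<partial>lborel) * indicator \<Omega> x
      = (\<integral>\<^sup>+h. ?F x h \<partial>lborel)" ..
  qed
  also have "\<dots> = (\<integral>\<^sup>+h. (\<integral>\<^sup>+x. ?F x h \<partial>lborel) \<partial>lborel)"
    by (rule lborel_pair.Fubini') measurable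
  also have "\<dots> = (\<integral>\<^sup>+h. diff_energy r \<Omega> v h * ennreal (norm h powr - a) \<partial>lborel)"
    unfolding diff_energy_def by (intro nn_integral_cong nn_integral_multc) measurable
  finally show ?thesis .
qed

end

lemma ennreal_mult_le_scale:
  assumes "ennreal a * X \<le> ennreal b * Y" and c: "0 \<le> c" "c \<le> c'" and "0 \<le> a" "0 \<le> b"
  shows "ennreal (c * a) * X \<le> ennreal (c' * b) * Y"
proof -
  have "ennreal c * (ennreal a * X) \<le> ennreal c' * (ennreal b * Y)"
    by (rule mult_mono[OF ennreal_leI[OF c(2)] assms(1)]) auto
  then show ?thesis using assms by (simp add: ennreal_mult mult.assoc)
qed

lemma ennreal_mult_assoc: "0 \<le> q \<Longrightarrow> ennreal (p * q) * Y = ennreal p * (ennreal q * Y)"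
  by (simp add: ennreal_mult'' mult.assoc)

section \<open>The parts |h| \<ge> R and |h| < R of the energy against the seminorms of orders
  \<sigma> and s\<close>

context
  fixes \<Omega> :: "(real ^ 'n::finite) set" and v :: "real ^ 'n \<Rightarrow> real" and r :: real
  assumes \<Omega>: "ray_domain \<Omega>" and v[measurable]: "v \<in> borel_measurable borel" and r: "r \<ge> 1"
begin

lemma diff_energy_borel[measurable]: "diff_energy r \<Omega> v \<in> borel_measurable borel"
  using diff_energy_measurable[OF \<Omega> v r] .

text \<open>With \<alpha> = \<sigma> r and \<beta> = \<eta> r the quotient \<alpha>/\<beta> matches
  the factors \<sigma> and \<eta> of the two normalisations; the other factors satisfy 1 - \<eta>
  \<le> 1 - \<sigma>. The constant 2^r is 2 q for q = 2^{r-1}.\<close>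

lemma far_energy_le_fractional:
  assumes s: "0 < \<sigma>" "\<sigma> < \<eta>" "\<eta> < 1" and R: "R > 0"
  shows "ennreal (\<eta> * (1 - \<eta>)) * (\<integral>\<^sup>+h. diff_energy r \<Omega> v h * ennreal (norm h powr (- (\<eta> * r) - real CARD('n))) * indicator {h. R \<le> norm h} h \<partial>lborel)
    \<le> ennreal (2 powr r * R powr ((\<sigma> - \<eta>) * r)) * (ennreal (\<sigma> * (1 - \<sigma>)) * (\<integral>\<^sup>+h. diff_energy r \<Omega> v h * ennreal (norm h powr (- (\<sigma> * r) - real CARD('n))) \<partial>lborel))"
    (is "_ * ?X \<le> _ * (_ * ?Y)")
proof -
  have "ennreal (\<eta> * r) * ?X \<le> ennreal (2 * 2 powr (r - 1) * R powr (\<sigma> * r - \<eta> * r) * (\<sigma> * r)) * ?Y"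
  proof (rule quasi_monotone_near_infinity[OF diff_energy_borel, where \<alpha>="\<sigma> * r" and \<beta>="\<eta> * r" and R=R and q="2 powr (r - 1)", unfolded DIM_cart DIM_real mult_1_right])
    show "diff_energy r \<Omega> v h \<le> ennreal (2 powr (r - 1)) * (diff_energy r \<Omega> v (l *\<^sub>R h) + diff_energy r \<Omega> v ((l - 1) *\<^sub>R h))" if "l \<ge> 1" for h l
      using that by (rule diff_energy_quasi_monotone[OF \<Omega> v r])
  qed (use s r R in \<open>auto intro: ge_one_powr_ge_zero\<close>)
  then have "ennreal ((1 - \<eta>) / r * (\<eta> * r)) * ?X \<le> ennreal ((1 - \<sigma>) / r * (2 * 2 powr (r - 1) * R powr (\<sigma> * r - \<eta> * r) * (\<sigma> * r))) * ?Y"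
    by (rule ennreal_mult_le_scale) (use s r in \<open>auto intro!: divide_right_mono\<close>)
  moreover have "(1 - \<eta>) / r * (\<eta> * r) = \<eta> * (1 - \<eta>)" using r by simp
  moreover have "(1 - \<sigma>) / r * (2 * 2 powr (r - 1) * R powr (\<sigma> * r - \<eta> * r) * (\<sigma> * r)) = 2 powr r * R powr ((\<sigma> - \<eta>) * r) * (\<sigma> * (1 - \<sigma>))"
  proof -
    have "2 * 2 powr (r - 1) = (2 powr r :: real)" by (simp add: powr_diff)
    moreover have "\<sigma> * r - \<eta> * r = (\<sigma> - \<eta>) * r" by (simp add: algebra_simps)
    ultimately show ?thesis using r by simp
  qed
  ultimately have "ennreal (\<eta> * (1 - \<eta>)) * ?X \<le> ennreal (2 powr r * R powr ((\<sigma> - \<eta>) * r) * (\<sigma> * (1 - \<sigma>))) * ?Y"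
    by (simp only:)
  then show ?thesis using s by (subst (asm) ennreal_mult_assoc) auto
qed

text \<open>The end point \<sigma> = 0: the energy is at most 2^r times the integral of |v|^r, and
  the radial integral S R^{-\<eta> r}/(\<eta> r), with S the sphere area, cancels the factor \<eta>
  of the normalisation. The exponent is written with 0 - \<eta> to agree with the fractional
  case.\<close>

lemma far_energy_le_norm:
  assumes s: "0 < \<eta>" "\<eta> < 1" and R: "R > 0"
  shows "ennreal (\<eta> * (1 - \<eta>)) * (\<integral>\<^sup>+h. diff_energy r \<Omega> v h * ennreal (norm h powr (- (\<eta> * r) - real CARD('n))) * indicator {h. R \<le> norm h} h \<partial>lborel)
    \<le> ennreal (2 powr r * R powr ((0 - \<eta>) * r)) * (ennreal (2 * sphere_area CARD('n) / r) * (\<integral>\<^sup>+x. ennreal (\<bar>v x\<bar> powr r) * indicator \<Omega> x \<partial>lborel))"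
    (is "_ * ?X \<le> _ * (_ * ?U)")
proof -
  let ?S = "sphere_area CARD('n)"
  have S: "?S \<ge> 0" by (simp add: sphere_area_def Gamma_real_nonneg)
  have "?X \<le> (\<integral>\<^sup>+h. (ennreal (2 powr r) * ?U) * (ennreal (norm (h :: real ^ 'n) powr (- (\<eta> * r) - real CARD('n))) * indicator {h. R \<le> norm h} h) \<partial>lborel)"
    unfolding mult.assoc[of "diff_energy r \<Omega> v _"]
    by (intro nn_integral_mono mult_right_mono diff_energy_le_norm[OF \<Omega> v r]) simp
  also have "\<dots> = ennreal (2 powr r) * ?U * ennreal (?S * (R powr - (\<eta> * r) / (\<eta> * r)))"
    using s r R by (subst nn_integral_cmult) (auto simp: nn_integral_far_powr)
  finally have "ennreal (\<eta> * (1 - \<eta>)) * ?X \<le> ennreal (\<eta> * (1 - \<eta>)) * (ennreal (2 powr r) * ?U * ennreal (?S * (R powr - (\<eta> * r) / (\<eta> * r))))"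
    by (intro mult_left_mono) auto
  also have "\<dots> = ennreal (\<eta> * (1 - \<eta>) * 2 powr r * (?S * (R powr - (\<eta> * r) / (\<eta> * r)))) * ?U"
  proof -
    have e: "ennreal A * (ennreal P * U * ennreal Q) = ennreal (A * P * Q) * U" if "A \<ge> 0" "P \<ge> 0" "Q \<ge> 0" for A P Q U
      using that by (simp add: ennreal_mult mult_ac)
    then show ?thesis using s r S by (intro e) auto
  qed
  also have "\<dots> \<le> ennreal (2 powr r * R powr ((0 - \<eta>) * r) * (2 * ?S / r)) * ?U"
  proof (intro mult_right_mono ennreal_leI)
    have "\<eta> * (1 - \<eta>) * 2 powr r * (?S * (R powr - (\<eta> * r) / (\<eta> * r))) = (1 - \<eta>) * (2 powr r * R powr ((0 - \<eta>) * r) * (?S / r))"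
      using s r by (simp add: field_simps)
    \<comment> \<open>There is room here: 1 - \<eta> is at most 1, while the normalisation of order
      0 carries the factor 2.\<close>
    also have "\<dots> \<le> 2 * (2 powr r * R powr ((0 - \<eta>) * r) * (?S / r))"
      using s r S by (intro mult_right_mono) auto
    finally show "\<eta> * (1 - \<eta>) * 2 powr r * (?S * (R powr - (\<eta> * r) / (\<eta> * r))) \<le> 2 powr r * R powr ((0 - \<eta>) * r) * (2 * ?S / r)"
      by (simp add: mult_ac)
  qed simp
  also have "\<dots> = ennreal (2 powr r * R powr ((0 - \<eta>) * r)) * (ennreal (2 * ?S / r) * ?U)"
    using r S by (intro ennreal_mult_assoc) auto
  finally show ?thesis .
qed

text \<open>Here \<delta> = (1 - s) r and \<epsilon> = (1 - \<eta>) r, so that \<delta>/\<epsilon>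
  matches the factors 1 - s and 1 - \<eta> of the normalisations, and \<eta> \<le> s takes care of
  the rest. On the right the integral is then extended from |h| < R to all h.\<close>

lemma near_energy_le_fractional:
  assumes s: "0 < \<eta>" "\<eta> < s" "s < 1" and R: "R > 0"
  shows "ennreal (\<eta> * (1 - \<eta>)) * (\<integral>\<^sup>+h. diff_energy r \<Omega> v h * ennreal (norm h powr (- (\<eta> * r) - real CARD('n))) * indicator {h. norm h < R} h \<partial>lborel)
    \<le> ennreal ((2 * R) powr ((s - \<eta>) * r)) * (ennreal (s * (1 - s)) * (\<integral>\<^sup>+h. diff_energy r \<Omega> v h * ennreal (norm h powr (- (s * r) - real CARD('n))) \<partial>lborel))"
    (is "_ * ?X \<le> _ * (_ * ?Y)")
proof -
  have e: "(1 - t) * r - r = - (t * r)" for t by (simp add: algebra_simps)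
  have d: "(1 - \<eta>) * r - (1 - s) * r = (s - \<eta>) * r" by (simp add: algebra_simps)
  let ?Y' = "\<integral>\<^sup>+h. diff_energy r \<Omega> v h * ennreal (norm h powr (- (s * r) - real CARD('n))) * indicator {h. norm h < R} h \<partial>lborel"
  have "ennreal ((1 - \<eta>) * r) * ?X \<le> ennreal ((2 * R) powr ((s - \<eta>) * r) * ((1 - s) * r)) * ?Y'"
    by (rule dyadic_near_origin[OF diff_energy_borel diff_energy_double[OF \<Omega> v r], where \<delta>="(1 - s) * r" and \<epsilon>="(1 - \<eta>) * r" and R=R,
        unfolded e d DIM_cart DIM_real mult_1_right]) (use s r R in auto)
  also have "\<dots> \<le> ennreal ((2 * R) powr ((s - \<eta>) * r) * ((1 - s) * r)) * ?Y"
    by (intro mult_left_mono nn_integral_mono) (auto simp: indicator_def)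
  finally have "ennreal (\<eta> / r * ((1 - \<eta>) * r)) * ?X \<le> ennreal (s / r * ((2 * R) powr ((s - \<eta>) * r) * ((1 - s) * r))) * ?Y"
    by (rule ennreal_mult_le_scale) (use s r in \<open>auto intro!: divide_right_mono\<close>)
  moreover have "\<eta> / r * ((1 - \<eta>) * r) = \<eta> * (1 - \<eta>)" using r by simp
  moreover have "s / r * ((2 * R) powr ((s - \<eta>) * r) * ((1 - s) * r)) = (2 * R) powr ((s - \<eta>) * r) * (s * (1 - s))"
    using r by simp
  ultimately have "ennreal (\<eta> * (1 - \<eta>)) * ?X \<le> ennreal ((2 * R) powr ((s - \<eta>) * r) * (s * (1 - s))) * ?Y"
    by (simp only:)
  then show ?thesis using s by (subst (asm) ennreal_mult_assoc) auto
qed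

text \<open>The end point s = 1: the energy is at most the integral of |h \<bullet> g x|^r over x,
  and for fixed x the integral over |h| < R is explicit, with K and the area from the directions and
  1/((1 - \<eta>) r) from the radius. The bounds \<eta> \<le> 1 and R \<le> 2R bring it to the form
  of the fractional case.\<close>

lemma near_energy_le_gradient:
  assumes s: "0 < \<eta>" "\<eta> < 1" and R: "R > 0" and g: "borel_weak_gradient \<Omega> v g"
  shows "ennreal (\<eta> * (1 - \<eta>)) * (\<integral>\<^sup>+h. diff_energy r \<Omega> v h * ennreal (norm h powr (- (\<eta> * r) - real CARD('n))) * indicator {h. norm h < R} h \<partial>lborel)
    \<le> ennreal ((2 * R) powr ((1 - \<eta>) * r)) * (ennreal (K_const CARD('n) r * (sphere_area CARD('n) / r)) * (\<integral>\<^sup>+x. ennreal (norm (g x) powr r) * indicator \<Omega> x \<partial>lborel))"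
    (is "_ * ?X \<le> _ * (_ * ?Y)")
proof -
  note base = \<Omega> v r
  note ray_domain_sets[OF base, measurable]
  have op: "open \<Omega>" using \<Omega> unfolding ray_domain_def by blast
  interpret borel_weak_gradient \<Omega> v g by (rule g)
  let ?KS = "K_const CARD('n) r * sphere_area CARD('n)"
  have KS: "?KS \<ge> 0" using r by (simp add: sphere_area_def K_const_def Gamma_real_nonneg)
  have G: "diff_energy r \<Omega> v h \<le> (\<integral>\<^sup>+x. ennreal (\<bar>h \<bullet> g x\<bar> powr r) * indicator \<Omega> x \<partial>lborel)" for h
  proof (induction h rule: ray_domain_induct[OF base])
    case (1 h)
    have "diff_energy r \<Omega> v (1 *\<^sub>R h) = (\<integral>\<^sup>+x. ennreal (\<bar>v (x + 1 *\<^sub>R h) - v x\<bar> powr r) * indicator \<Omega> x \<partial>lborel)"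
      by (rule diff_energy_forward[OF base]) (use 1 in auto)
    also have "\<dots> \<le> (\<integral>\<^sup>+x. ennreal (\<bar>g x \<bullet> h\<bar> powr r) * indicator \<Omega> x \<partial>lborel)"
      using difference_power_le_gradient[OF op 1 r] by simp
    finally show ?case by (simp add: inner_commute)
  next
    case (2 h)
    then show ?case using diff_energy_uminus[OF base, of h] by simp
  qed
  let ?w = "\<lambda>h::real^'n. ennreal (norm h powr (- (\<eta> * r) - real CARD('n))) * indicator {h. norm h < R} h"
  have "?X \<le> (\<integral>\<^sup>+h. (\<integral>\<^sup>+x. ennreal (\<bar>h \<bullet> g x\<bar> powr r) * indicator \<Omega> x * ?w h \<partial>lborel) \<partial>lborel)"
  proof (rule nn_integral_mono)
    fix h :: "real^'n"
    have "diff_energy r \<Omega> v h * ?w h \<le> (\<integral>\<^sup>+x. ennreal (\<bar>h \<bullet> g x\<bar> powr r) * indicator \<Omega> x \<partial>lborel) * ?w h"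
      by (intro mult_right_mono G) simp
    also have "\<dots> = (\<integral>\<^sup>+x. ennreal (\<bar>h \<bullet> g x\<bar> powr r) * indicator \<Omega> x * ?w h \<partial>lborel)"
      by (rule nn_integral_multc[symmetric]) measurable
    finally show "diff_energy r \<Omega> v h * ennreal (norm h powr (- (\<eta> * r) - real CARD('n))) * indicator {h. norm h < R} h
      \<le> (\<integral>\<^sup>+x. ennreal (\<bar>h \<bullet> g x\<bar> powr r) * indicator \<Omega> x * ?w h \<partial>lborel)" by (simp only: mult.assoc)
  qed
  also have "\<dots> = (\<integral>\<^sup>+x. (\<integral>\<^sup>+h. ennreal (\<bar>h \<bullet> g x\<bar> powr r) * indicator \<Omega> x * ?w h \<partial>lborel) \<partial>lborel)"
    by (rule lborel_pair.Fubini') measurable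
  also have "\<dots> = (\<integral>\<^sup>+x. ennreal (?KS * (R powr (r - \<eta> * r) / (r - \<eta> * r))) * (ennreal (norm (g x) powr r) * indicator \<Omega> x) \<partial>lborel)"
  proof (rule nn_integral_cong)
    fix x
    have "(\<integral>\<^sup>+h. ennreal (\<bar>h \<bullet> g x\<bar> powr r) * indicator \<Omega> x * ?w h \<partial>lborel)
      = (\<integral>\<^sup>+h. indicator \<Omega> x * (ennreal (\<bar>h \<bullet> g x\<bar> powr r) * ennreal (norm h powr (- (\<eta> * r) - real CARD('n))) * indicator {h. norm h < R} h) \<partial>lborel)"
      by (simp add: mult_ac)
    also have "\<dots> = indicator \<Omega> x * (\<integral>\<^sup>+h. ennreal (\<bar>h \<bullet> g x\<bar> powr r) * ennreal (norm h powr (- (\<eta> * r) - real CARD('n))) * indicator {h. norm h < R} h \<partial>lborel)"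
      by (rule nn_integral_cmult) measurable
    also have "(\<integral>\<^sup>+h. ennreal (\<bar>h \<bullet> g x\<bar> powr r) * ennreal (norm h powr (- (\<eta> * r) - real CARD('n))) * indicator {h. norm h < R} h \<partial>lborel)
      = ennreal (?KS * (R powr (r - \<eta> * r) / (r - \<eta> * r))) * ennreal (norm (g x) powr r)"
      using s r R by (intro nn_integral_near_inner_powr) auto
    finally show "(\<integral>\<^sup>+h. ennreal (\<bar>h \<bullet> g x\<bar> powr r) * indicator \<Omega> x * ?w h \<partial>lborel)
      = ennreal (?KS * (R powr (r - \<eta> * r) / (r - \<eta> * r))) * (ennreal (norm (g x) powr r) * indicator \<Omega> x)"
      by (simp only: mult_ac)
  qed
  also have "\<dots> = ennreal (?KS * (R powr (r - \<eta> * r) / (r - \<eta> * r))) * ?Y"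
    by (rule nn_integral_cmult) measurable
  finally have "ennreal (\<eta> * (1 - \<eta>)) * ?X \<le> ennreal (\<eta> * (1 - \<eta>)) * (ennreal (?KS * (R powr (r - \<eta> * r) / (r - \<eta> * r))) * ?Y)"
    by (intro mult_left_mono) auto
  also have "\<dots> = ennreal (\<eta> * (1 - \<eta>) * (?KS * (R powr (r - \<eta> * r) / (r - \<eta> * r)))) * ?Y"
    using s r KS by (intro ennreal_mult_assoc[symmetric]) auto
  also have "\<dots> \<le> ennreal ((2 * R) powr ((1 - \<eta>) * r) * (K_const CARD('n) r * (sphere_area CARD('n) / r))) * ?Y"
  proof (intro mult_right_mono ennreal_leI)
    have d: "r - \<eta> * r = (1 - \<eta>) * r" by (simp add: algebra_simps)
    have "\<eta> * (1 - \<eta>) * (?KS * (R powr (r - \<eta> * r) / (r - \<eta> * r))) = \<eta> * R powr ((1 - \<eta>) * r) * (?KS / r)"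
      unfolding d using s r by simp
    also have "\<dots> \<le> (1 * (2 * R) powr ((1 - \<eta>) * r)) * (?KS / r)"
      using s r R KS by (intro mult_right_mono mult_mono powr_mono2) auto
    finally show "\<eta> * (1 - \<eta>) * (?KS * (R powr (r - \<eta> * r) / (r - \<eta> * r))) \<le> (2 * R) powr ((1 - \<eta>) * r) * (K_const CARD('n) r * (sphere_area CARD('n) / r))"
      by simp
  qed simp
  also have "\<dots> = ennreal ((2 * R) powr ((1 - \<eta>) * r)) * (ennreal (K_const CARD('n) r * (sphere_area CARD('n) / r)) * ?Y)"
    using KS r by (intro ennreal_mult_assoc) auto
  finally show ?thesis .
qed

end

section \<open>Finite exponents\<close>

lemma epow_mono: "a \<ge> 0 \<Longrightarrow> x \<le> y \<Longrightarrow> epow x a \<le> epow y a"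
  by (cases x; cases y) (auto simp: epow_def top_unique intro!: ennreal_leI powr_mono2)

lemma epow_epow: "epow (epow x a) b = epow x (a * b)"
  by (cases x) (auto simp: epow_def powr_powr)

lemma epow_1: "epow x 1 = x"
  by (cases x) (auto simp: epow_def)

lemma epow_inverse: "a > 0 \<Longrightarrow> epow (epow x (1 / a)) a = x" "a > 0 \<Longrightarrow> epow (epow x a) (1 / a) = x"
  by (simp_all add: epow_epow epow_1)

lemma epow_ennreal: "x \<ge> 0 \<Longrightarrow> epow (ennreal x) a = ennreal (x powr a)"
  by (simp add: epow_def)

lemma epow_mult_ennreal: "c > 0 \<Longrightarrow> epow (ennreal c * x) a = ennreal (c powr a) * epow x a"
proof (cases x)
  case top
  assume "c > 0"
  then show ?thesis using top by (simp add: epow_def ennreal_mult_top)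
next
  case (real y)
  assume "c > 0"
  then show ?thesis using real by (simp add: epow_ennreal powr_mult flip: ennreal_mult)
qed

text \<open>A positive power is an order isomorphism whose inverse is the power 1/a, hence it
  commutes with infima, including that of the empty set. It will be applied to
  \<open>grad_norm\<close>, an infimum over weak gradients.\<close>

lemma epow_INF:
  assumes "a > 0"
  shows "epow (INF i\<in>I. f i) a = (INF i\<in>I. epow (f i) a)"
proof (rule antisym)
  show "epow (INF i\<in>I. f i) a \<le> (INF i\<in>I. epow (f i) a)"
    using assms by (intro INF_greatest epow_mono INF_lower) auto
  let ?m = "INF i\<in>I. epow (f i) a"
  have "epow ?m (1 / a) \<le> (INF i\<in>I. f i)"
  proof (rule INF_greatest)
    fix i assume "i \<in> I"
    then have "epow ?m (1 / a) \<le> epow (epow (f i) a) (1 / a)"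
      using assms by (intro epow_mono INF_lower) auto
    then show "epow ?m (1 / a) \<le> f i" using assms by (simp add: epow_inverse)
  qed
  then have "epow (epow ?m (1 / a)) a \<le> epow (INF i\<in>I. f i) a"
    using assms by (intro epow_mono) auto
  then show "?m \<le> epow (INF i\<in>I. f i) a" using assms by (simp add: epow_inverse)
qed

lemma borel_version_weak_gradient:
  fixes g :: "real ^ 'n::finite \<Rightarrow> real ^ 'n"
  assumes op: "open \<Omega>" and w: "weak_gradient \<Omega> u g" and u: "u \<in> borel_measurable lebesgue"
    and v: "locally_integrable_on UNIV v" and uv: "AE x in lborel. u x = v x"
    and g': "g' \<in> borel_measurable borel" "AE x in lebesgue_on \<Omega>. g x = g' x"
  shows "borel_weak_gradient \<Omega> v g'"
proof
  show "locally_integrable_on UNIV v" by (rule v)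
  have vb: "v \<in> borel_measurable borel" using v by (simp add: locally_integrable_on_def)
  have \<Omega>b: "\<Omega> \<in> sets borel" using op by simp
  then have \<Omega>l: "\<Omega> \<inter> space lebesgue \<in> sets lebesgue" by simp
  have gg: "AE x in lebesgue. x \<in> \<Omega> \<longrightarrow> g x = g' x"
    using g'(2) \<Omega>b by (simp add: AE_lebesgue_on_iff)
  have "g \<in> borel_measurable (lebesgue_on \<Omega>)" using w by (simp add: weak_gradient_def)
  then have gm: "(\<lambda>x. indicator \<Omega> x *\<^sub>R g x) \<in> borel_measurable lebesgue"
    using borel_measurable_restrict_space_iff[OF \<Omega>l] by blast
  have uvl: "AE x in lebesgue. u x = v x" using uv by (rule AE_completion)
  have bl: "f \<in> borel_measurable lebesgue" if "f \<in> borel_measurable borel" for f :: "real ^ 'n \<Rightarrow> 'c::topological_space"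
    using that by (intro measurable_completion) simp
  show "locally_integrable_on \<Omega> g'"
    unfolding locally_integrable_on_def
  proof (intro conjI allI impI g'(1))
    fix K :: "(real ^ 'n) set"
    assume K: "compact K \<and> K \<subseteq> \<Omega>"
    then have Kb[measurable]: "K \<in> sets borel" by (simp add: borel_compact)
    have "integrable (lebesgue_on K) g" using w K by (simp add: weak_gradient_def)
    then have i: "integrable lebesgue (\<lambda>x. indicator K x *\<^sub>R g x)"
      by (subst (asm) integrable_restrict_space) (use Kb in auto)
    have m: "(\<lambda>x. indicator K x *\<^sub>R g' x) \<in> borel_measurable borel"
      by (intro borel_measurable_scaleR borel_measurable_indicator Kb g'(1))
    have "integrable lebesgue (\<lambda>x. indicator K x *\<^sub>R g' x)"
    proof (rule integrable_cong_AE_imp[OF i bl[OF m]])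
      show "AE x in lebesgue. indicator K x *\<^sub>R g x = indicator K x *\<^sub>R g' x"
        using gg K by (auto elim!: eventually_mono simp: indicator_def)
    qed
    then show "integrable lborel (\<lambda>x. indicator K x *\<^sub>R g' x)"
      using m by (subst (asm) integrable_completion) auto
  qed
  show "(\<integral>x. v x * partial_deriv i (bump n a b) x \<partial>lborel) = - (\<integral>x. g' x $ i * bump n a b x \<partial>lborel)"
    if sub: "cbox a b \<subseteq> \<Omega>" for n a b i
  proof -
    let ?\<phi> = "bump n a b" and ?D = "partial_deriv i (bump n a b)"
    have out: "?D x = 0 \<and> ?\<phi> x = 0" if "x \<notin> \<Omega>" for x
      using that sub bump_partial_eq_0[of x a b i n] bump_eq_0[of x a b n] box_subset_cbox[of a b] by blast
    have "(\<integral>x. u x * ?D x \<partial>lebesgue_on \<Omega>) = (\<integral>x. indicator \<Omega> x *\<^sub>R (u x * ?D x) \<partial>lebesgue)"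
      by (rule integral_restrict_space[OF \<Omega>l])
    also have "\<dots> = (\<integral>x. v x * ?D x \<partial>lebesgue)"
    proof (rule integral_cong_AE)
      show "(\<lambda>x. indicator \<Omega> x *\<^sub>R (u x * ?D x)) \<in> borel_measurable lebesgue"
        using \<Omega>b by (intro borel_measurable_scaleR borel_measurable_indicator borel_measurable_times u bl[OF bump_partial_measurable]) auto
      show "(\<lambda>x. v x * ?D x) \<in> borel_measurable lebesgue"
        by (intro borel_measurable_times bl[OF vb] bl[OF bump_partial_measurable])
      show "AE x in lebesgue. indicator \<Omega> x *\<^sub>R (u x * ?D x) = v x * ?D x"
        using uvl by eventually_elim (use out in \<open>auto simp: indicator_def\<close>)
    qed
    also have "\<dots> = (\<integral>x. v x * ?D x \<partial>lborel)"
      using vb by (intro integral_completion) auto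
    finally have 1: "(\<integral>x. u x * ?D x \<partial>lebesgue_on \<Omega>) = (\<integral>x. v x * ?D x \<partial>lborel)" .
    have "(\<integral>x. g x $ i * ?\<phi> x \<partial>lebesgue_on \<Omega>) = (\<integral>x. indicator \<Omega> x *\<^sub>R (g x $ i * ?\<phi> x) \<partial>lebesgue)"
      by (rule integral_restrict_space[OF \<Omega>l])
    also have "\<dots> = (\<integral>x. g' x $ i * ?\<phi> x \<partial>lebesgue)"
    proof (rule integral_cong_AE)
      have "(\<lambda>x. (indicator \<Omega> x *\<^sub>R g x) \<bullet> axis i 1 * ?\<phi> x) \<in> borel_measurable lebesgue"
        by (intro borel_measurable_times borel_measurable_inner gm borel_measurable_const bl[OF bump_measurable])
      then show "(\<lambda>x. indicator \<Omega> x *\<^sub>R (g x $ i * ?\<phi> x)) \<in> borel_measurable lebesgue"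
        by (simp add: inner_axis mult.assoc)
      have "(\<lambda>x. g' x \<bullet> axis i 1 * ?\<phi> x) \<in> borel_measurable lebesgue"
        by (intro borel_measurable_times borel_measurable_inner bl[OF g'(1)] borel_measurable_const bl[OF bump_measurable])
      then show "(\<lambda>x. g' x $ i * ?\<phi> x) \<in> borel_measurable lebesgue"
        by (simp add: inner_axis)
      show "AE x in lebesgue. indicator \<Omega> x *\<^sub>R (g x $ i * ?\<phi> x) = g' x $ i * ?\<phi> x"
        using gg by eventually_elim (use out in \<open>auto simp: indicator_def\<close>)
    qed
    also have "\<dots> = (\<integral>x. g' x $ i * ?\<phi> x \<partial>lborel)"
    proof (rule integral_completion)
      have "(\<lambda>x. g' x \<bullet> axis i 1 * ?\<phi> x) \<in> borel_measurable lborel"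
        using g'(1) by measurable
      then show "(\<lambda>x. g' x $ i * ?\<phi> x) \<in> borel_measurable lborel"
        by (simp add: inner_axis)
    qed
    finally have 2: "(\<integral>x. g x $ i * ?\<phi> x \<partial>lebesgue_on \<Omega>) = (\<integral>x. g' x $ i * ?\<phi> x \<partial>lborel)" .
    have "test_fun \<Omega> ?\<phi>" using sub by (rule bump_test_fun)
    then show ?thesis using w 1 2 by (simp add: weak_gradient_def)
  qed
qed

text \<open>Cutting off at \<Omega> makes g measurable on the whole space; then each coordinate is
  replaced by a Borel function, which discards finitely many null sets.\<close>

lemma borel_version_vector:
  fixes g :: "'a::euclidean_space \<Rightarrow> real ^ 'n::finite"
  assumes \<Omega>: "\<Omega> \<in> sets borel" and g: "g \<in> borel_measurable (lebesgue_on \<Omega>)"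
  obtains g' where "g' \<in> borel_measurable borel" "AE x in lebesgue_on \<Omega>. g x = g' x"
proof -
  have "\<Omega> \<inter> space lebesgue \<in> sets lebesgue" using \<Omega> by simp
  then have gm: "(\<lambda>x. indicator \<Omega> x *\<^sub>R g x) \<in> borel_measurable lebesgue"
    using borel_measurable_restrict_space_iff g by blast
  have "\<exists>f\<in>borel_measurable lborel. AE x in lborel. (indicator \<Omega> x *\<^sub>R g x) \<bullet> axis i 1 = f x" for i
    by (intro completion_ex_borel_measurable_real borel_measurable_inner gm borel_measurable_const)
  then obtain f where f: "\<And>i. f i \<in> borel_measurable lborel" "\<And>i. AE x in lborel. (indicator \<Omega> x *\<^sub>R g x) \<bullet> axis i 1 = f i x"
    by metis
  define g' where "g' x = (\<Sum>i\<in>UNIV. f i x *\<^sub>R (axis i 1 :: real ^ 'n))" for x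
  show ?thesis
  proof
    show "g' \<in> borel_measurable borel" unfolding g'_def using f(1) by (intro borel_measurable_sum borel_measurable_scaleR) auto
    have "AE x in lborel. \<forall>i. (indicator \<Omega> x *\<^sub>R g x) \<bullet> axis i 1 = f i x"
      using f(2) by (intro eventually_all_finite) auto
    then have "AE x in lborel. x \<in> \<Omega> \<longrightarrow> g x = g' x"
    proof eventually_elim
      case (elim x)
      show ?case
      proof
        assume "x \<in> \<Omega>"
        then have "f i x = g x $ i" for i using elim[rule_format, of i] by (simp add: inner_axis)
        then show "g x = g' x" unfolding g'_def
          by (metis (no_types, lifting) basis_expansion scalar_mult_eq_scaleR sum.cong)
      qed
    qed
    from AE_completion[OF this] show "AE x in lebesgue_on \<Omega>. g x = g' x"
      using \<Omega> by (simp add: AE_lebesgue_on_iff)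
  qed
qed

text \<open>Local integrability comes from the bound on the whole space: |v| \<le> 1 + |v|^p on a
  compact set if p is finite, and v is essentially bounded if p = \<infinity>.\<close>

lemma Lp_space_borel_version:
  assumes u: "u \<in> Lp_space p UNIV" and p: "1 \<le> p"
  obtains v :: "real ^ 'n::finite \<Rightarrow> real" where "u \<in> borel_measurable lebesgue" "AE x in lborel. u x = v x" "locally_integrable_on UNIV v"
proof -
  have ul: "u \<in> borel_measurable lebesgue" and fin: "Lp_norm p UNIV u < \<infinity>"
    using u by (auto simp: Lp_space_def lebesgue_on_UNIV_eq)
  obtain v where v: "v \<in> borel_measurable lborel" "AE x in lborel. u x = v x"
    using completion_ex_borel_measurable_real[OF ul] by blast
  have [measurable]: "v \<in> borel_measurable borel" using v(1) by simp
  have uvl: "AE x in lebesgue. u x = v x" using v(2) by (rule AE_completion)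
  have K: "integrable lborel (\<lambda>x. indicator K x *\<^sub>R v x)" if K: "compact K" for K :: "(real ^ 'n) set"
  proof -
    have Kb[measurable]: "K \<in> sets borel" using K by (simp add: borel_compact)
    have Kf: "emeasure lborel K < \<infinity>" using K by (rule emeasure_compact_finite)
    have "(\<integral>\<^sup>+x. ennreal (norm (indicator K x *\<^sub>R v x)) \<partial>lborel) < \<infinity>"
    proof (cases "p = \<infinity>")
      case True
      define L where "L = esssup lebesgue (\<lambda>x. ennreal \<bar>u x\<bar>)"
      have L: "L < \<infinity>" using fin True by (simp add: Lp_norm_def lebesgue_on_UNIV_eq L_def)
      have "AE x in lebesgue. ennreal \<bar>u x\<bar> \<le> L" unfolding L_def by (rule esssup_AE)
      with uvl have "AE x in lebesgue. ennreal \<bar>v x\<bar> \<le> L" by eventually_elim simp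
      then have "AE x in lborel. ennreal \<bar>v x\<bar> \<le> L"
        by (subst (asm) AE_completion_iff) auto
      then have "(\<integral>\<^sup>+x. ennreal (norm (indicator K x *\<^sub>R v x)) \<partial>lborel) \<le> (\<integral>\<^sup>+x. L * indicator K x \<partial>lborel)"
        by (intro nn_integral_mono_AE) (auto elim!: eventually_mono simp: indicator_def)
      also have "\<dots> = L * emeasure lborel K" by (simp add: nn_integral_cmult_indicator)
      also have "\<dots> < \<infinity>" using L Kf by (simp add: ennreal_mult_less_top)
      finally show ?thesis .
    next
      case False
      define r where "r = enn2real p"
      have "p = ennreal r" using False by (simp add: r_def less_top)
      then have r: "r \<ge> 1" using p by simp
      have "epow (\<integral>\<^sup>+x. ennreal (norm (u x) powr r) \<partial>lebesgue) (recip p) < \<infinity>"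
        using fin False by (simp add: Lp_norm_def lebesgue_on_UNIV_eq r_def)
      then have f: "(\<integral>\<^sup>+x. ennreal (norm (u x) powr r) \<partial>lebesgue) < \<infinity>"
        by (auto simp: epow_def less_top[symmetric] split: if_splits)
      have "(\<integral>\<^sup>+x. ennreal (norm (u x) powr r) \<partial>lebesgue) = (\<integral>\<^sup>+x. ennreal (\<bar>v x\<bar> powr r) \<partial>lebesgue)"
        by (rule nn_integral_cong_AE) (use uvl in \<open>eventually_elim, simp\<close>)
      also have "\<dots> = (\<integral>\<^sup>+x. ennreal (\<bar>v x\<bar> powr r) \<partial>lborel)" by (rule nn_integral_completion)
      finally have f: "(\<integral>\<^sup>+x. ennreal (\<bar>v x\<bar> powr r) \<partial>lborel) < \<infinity>" using f by simp
      have "(\<integral>\<^sup>+x. ennreal (norm (indicator K x *\<^sub>R v x)) \<partial>lborel) \<le> (\<integral>\<^sup>+x. indicator K x + ennreal (\<bar>v x\<bar> powr r) \<partial>lborel)"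
      proof (rule nn_integral_mono)
        fix x
        have "\<bar>v x\<bar> \<le> 1 + \<bar>v x\<bar> powr r"
        proof (cases "\<bar>v x\<bar> \<le> 1")
          case False
          then have "\<bar>v x\<bar> powr 1 \<le> \<bar>v x\<bar> powr r" using r by (intro powr_mono) auto
          then show ?thesis using False by simp
        qed (simp add: add_increasing2)
        then have "ennreal \<bar>v x\<bar> \<le> 1 + ennreal (\<bar>v x\<bar> powr r)"
          by (metis ennreal_1 ennreal_leI ennreal_plus powr_ge_zero zero_le_one)
        then show "ennreal (norm (indicator K x *\<^sub>R v x)) \<le> indicator K x + ennreal (\<bar>v x\<bar> powr r)"
          by (auto simp: indicator_def)
      qed
      also have "\<dots> = emeasure lborel K + (\<integral>\<^sup>+x. ennreal (\<bar>v x\<bar> powr r) \<partial>lborel)"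
        by (subst nn_integral_add) auto
      also have "\<dots> < \<infinity>" using f Kf by simp
      finally show ?thesis .
    qed
    then show ?thesis by (intro integrableI_bounded) auto
  qed
  have "locally_integrable_on UNIV v" unfolding locally_integrable_on_def using K by auto
  then show ?thesis using that ul v(2) by blast
qed

section \<open>The seminorms in terms of a Borel representative, for finite p\<close>

context
  fixes \<Omega> :: "(real ^ 'n::finite) set" and u v :: "real ^ 'n \<Rightarrow> real" and p :: ennreal and r :: real
  assumes \<Omega>: "ray_domain \<Omega>" and u: "u \<in> borel_measurable lebesgue"
    and v: "locally_integrable_on UNIV v" and uv: "AE x in lborel. u x = v x"
    and p: "p = ennreal r" and r: "r \<ge> 1"
begin

lemma version_measurable: "v \<in> borel_measurable borel"
  using v by (simp add: locally_integrable_on_def)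

lemma domain_sets: "\<Omega> \<in> sets borel"
  by (rule ray_domain_sets[OF \<Omega> version_measurable r])

lemma sobolev_pow_0:
  "sobolev_pow 0 p \<Omega> u = ennreal (2 * sphere_area CARD('n) / r) * (\<integral>\<^sup>+x. ennreal (\<bar>v x\<bar> powr r) * indicator \<Omega> x \<partial>lborel)"
proof -
  have "(\<integral>\<^sup>+x. ennreal (norm (u x) powr r) \<partial>lebesgue_on \<Omega>) = (\<integral>\<^sup>+x. ennreal (\<bar>v x\<bar> powr r) \<partial>lebesgue_on \<Omega>)"
    by (rule nn_integral_cong_AE) (use AE_lebesgue_onI[OF domain_sets uv] in \<open>eventually_elim, simp\<close>)
  also have "\<dots> = (\<integral>\<^sup>+x. ennreal (\<bar>v x\<bar> powr r) * indicator \<Omega> x \<partial>lborel)"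
    by (rule nn_integral_lebesgue_on[OF domain_sets]) (use version_measurable in measurable)
  finally show ?thesis
    using r by (simp add: sobolev_pow_def Lp_norm_def p recip_def epow_inverse)
qed

lemma sobolev_pow_fractional:
  assumes s: "0 < s" "s < 1"
  shows "sobolev_pow s p \<Omega> u = ennreal (s * (1 - s)) * (\<integral>\<^sup>+h. diff_energy r \<Omega> v h * ennreal (norm h powr (- (s * r) - real CARD('n))) \<partial>lborel)"
proof -
  let ?a = "real CARD('n) + s * r"
  let ?E = "\<lambda>x y. ennreal (\<bar>v x - v y\<bar> powr r / norm (x - y) powr ?a)"
  let ?F = "\<lambda>x y. ennreal (\<bar>u x - u y\<bar> powr r / norm (x - y) powr ?a)"
  note ae = AE_lebesgue_onI[OF domain_sets uv]
  note version_measurable[measurable] domain_sets[measurable]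
  have "(\<integral>\<^sup>+x. (\<integral>\<^sup>+y. ?F x y \<partial>lebesgue_on \<Omega>) \<partial>lebesgue_on \<Omega>)
    = (\<integral>\<^sup>+x. (\<integral>\<^sup>+y. ?E x y \<partial>lebesgue_on \<Omega>) \<partial>lebesgue_on \<Omega>)"
  proof (rule nn_integral_cong_AE)
    show "AE x in lebesgue_on \<Omega>. (\<integral>\<^sup>+y. ?F x y \<partial>lebesgue_on \<Omega>)
      = (\<integral>\<^sup>+y. ?E x y \<partial>lebesgue_on \<Omega>)"
      using ae
    proof eventually_elim
      case (elim x)
      show ?case
        by (rule nn_integral_cong_AE) (use ae in \<open>eventually_elim, simp add: elim\<close>)
    qed
  qed
  also have "\<dots> = (\<integral>\<^sup>+x. (\<integral>\<^sup>+y. ?E x y * indicator \<Omega> y \<partial>lborel) \<partial>lebesgue_on \<Omega>)"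
    by (intro nn_integral_cong nn_integral_lebesgue_on) measurable
  also have "\<dots> = (\<integral>\<^sup>+x. (\<integral>\<^sup>+y. ?E x y * indicator \<Omega> y \<partial>lborel) * indicator \<Omega> x \<partial>lborel)"
    by (rule nn_integral_lebesgue_on) measurable
  also have "\<dots> = (\<integral>\<^sup>+h. diff_energy r \<Omega> v h * ennreal (norm h powr - ?a) \<partial>lborel)"
    by (rule double_integral_eq_diff_energy[OF \<Omega> version_measurable r])
  also have "- ?a = - (s * r) - real CARD('n)" by simp
  finally show ?thesis using s r by (simp add: sobolev_pow_def p)
qed

text \<open>Transfers a bound known for each Borel weak gradient to the infimum that defines the
  seminorm of order 1. The constant is first moved to the left by division, for which it has to be
  positive; if there is no weak gradient, the right side is infinite.\<close>

lemma sobolev_pow_1_ge: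
  assumes X: "\<And>g. borel_weak_gradient \<Omega> v g \<Longrightarrow>
      X \<le> ennreal c * (ennreal (K_const CARD('n) r * (sphere_area CARD('n) / r)) * (\<integral>\<^sup>+x. ennreal (norm (g x) powr r) * indicator \<Omega> x \<partial>lborel))"
    and c: "c > 0"
  shows "X \<le> ennreal c * sobolev_pow 1 p \<Omega> u"
proof -
  define k where "k = K_const CARD('n) r * (sphere_area CARD('n) / r)"
  have k: "k > 0"
  proof -
    have "Gamma (real CARD('n) / 2) > 0" "Gamma ((r + 1) / 2) > 0" "Gamma ((real CARD('n) + r) / 2) > 0" "Gamma (1 / 2 :: real) > 0"
      using r by (auto intro!: Gamma_real_pos add_pos_nonneg)
    then show ?thesis unfolding k_def K_const_def sphere_area_def
      using r by (intro mult_pos_pos divide_pos_pos) auto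
  qed
  have op: "open \<Omega>" using \<Omega> unfolding ray_domain_def by blast
  have "ennreal (1 / (c * k)) * X \<le> epow (Lp_norm p \<Omega> g) r" if g: "weak_gradient \<Omega> u g" for g
  proof -
    have gm: "g \<in> borel_measurable (lebesgue_on \<Omega>)" using g by (simp add: weak_gradient_def)
    obtain g' where g': "g' \<in> borel_measurable borel" "AE x in lebesgue_on \<Omega>. g x = g' x"
      using borel_version_vector[OF domain_sets gm] by blast
    have "X \<le> ennreal c * (ennreal k * (\<integral>\<^sup>+x. ennreal (norm (g' x) powr r) * indicator \<Omega> x \<partial>lborel))"
      unfolding k_def by (rule X[OF borel_version_weak_gradient[OF op g u v uv g']])
    also have "(\<integral>\<^sup>+x. ennreal (norm (g' x) powr r) * indicator \<Omega> x \<partial>lborel) = (\<integral>\<^sup>+x. ennreal (norm (g' x) powr r) \<partial>lebesgue_on \<Omega>)"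
      by (rule nn_integral_lebesgue_on[OF domain_sets, symmetric]) (use g'(1) in measurable)
    also have "\<dots> = (\<integral>\<^sup>+x. ennreal (norm (g x) powr r) \<partial>lebesgue_on \<Omega>)"
      by (rule nn_integral_cong_AE) (use g'(2) in \<open>eventually_elim, simp\<close>)
    also have "\<dots> = epow (Lp_norm p \<Omega> g) r"
      using r by (simp add: Lp_norm_def p recip_def epow_inverse)
    also have "ennreal c * (ennreal k * epow (Lp_norm p \<Omega> g) r) = ennreal (c * k) * epow (Lp_norm p \<Omega> g) r"
      using k by (intro ennreal_mult_assoc[symmetric]) simp
    finally have "ennreal (1 / (c * k)) * X \<le> ennreal (1 / (c * k)) * (ennreal (c * k) * epow (Lp_norm p \<Omega> g) r)"
      by (intro mult_left_mono) auto
    also have "\<dots> = ennreal (1 / (c * k) * (c * k)) * epow (Lp_norm p \<Omega> g) r"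
      using k c by (intro ennreal_mult_assoc[symmetric]) simp
    also have "1 / (c * k) * (c * k) = 1" using k c by simp
    finally show ?thesis by simp
  qed
  then have "ennreal (1 / (c * k)) * X \<le> epow (grad_norm p \<Omega> u) r"
    unfolding grad_norm_def using r by (subst epow_INF) (auto intro!: INF_greatest)
  then have "ennreal (c * k) * (ennreal (1 / (c * k)) * X) \<le> ennreal (c * k) * epow (grad_norm p \<Omega> u) r"
    by (intro mult_left_mono) auto
  moreover have "ennreal (c * k) * (ennreal (1 / (c * k)) * X) = ennreal (c * k * (1 / (c * k))) * X"
    using k c by (intro ennreal_mult_assoc[symmetric]) simp
  moreover have "c * k * (1 / (c * k)) = 1" using k c by simp
  moreover have "ennreal (c * k) * epow (grad_norm p \<Omega> u) r = ennreal c * (ennreal k * epow (grad_norm p \<Omega> u) r)"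
    using k by (intro ennreal_mult_assoc) simp
  moreover have "sobolev_pow 1 p \<Omega> u = ennreal k * epow (grad_norm p \<Omega> u) r"
    unfolding k_def sobolev_pow_def Let_def p using r by simp
  ultimately show ?thesis by (metis ennreal_1 mult_1)
qed

lemma sobolev_pow_interpolation:
  assumes s: "0 \<le> \<sigma>" "\<sigma> < \<eta>" "\<eta> < s" "s \<le> 1"
  shows "sobolev_pow \<eta> p \<Omega> u \<le> ennreal (2 powr (r * ((s - \<eta>) / (s - \<sigma>) * (\<eta> + 1 - \<sigma>)))) * (sobolev_pow \<sigma> p \<Omega> u + sobolev_pow s p \<Omega> u)"
proof -
  note base = \<Omega> version_measurable r
  note diff_energy_borel[OF base, measurable]
  \<comment> \<open>The radius balances the two constants, 2 powr r * R powr ((\<sigma> - \<eta>) r)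
    = (2R) powr ((s - \<eta>) r). For R = 2 powr (e - 1) this says 1 + \<eta> - \<sigma> = e (s -
    \<sigma>).\<close>
  define e where "e = (1 + \<eta> - \<sigma>) / (s - \<sigma>)"
  define R where "R = 2 powr (e - 1)"
  have R: "R > 0" by (simp add: R_def)
  let ?w = "\<lambda>h. diff_energy r \<Omega> v h * ennreal (norm h powr (- (\<eta> * r) - real CARD('n)))"
  let ?far = "\<integral>\<^sup>+h. ?w h * indicator {h. R \<le> norm h} h \<partial>lborel"
  let ?near = "\<integral>\<^sup>+h. ?w h * indicator {h. norm h < R} h \<partial>lborel"
  have far: "ennreal (\<eta> * (1 - \<eta>)) * ?far \<le> ennreal (2 powr r * R powr ((\<sigma> - \<eta>) * r)) * sobolev_pow \<sigma> p \<Omega> u"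
  proof (cases "\<sigma> = 0")
    case True
    show ?thesis unfolding True sobolev_pow_0 by (rule far_energy_le_norm[OF base]) (use s True R in auto)
  next
    case False
    then have "sobolev_pow \<sigma> p \<Omega> u = ennreal (\<sigma> * (1 - \<sigma>)) * (\<integral>\<^sup>+h. diff_energy r \<Omega> v h * ennreal (norm h powr (- (\<sigma> * r) - real CARD('n))) \<partial>lborel)"
      using s by (intro sobolev_pow_fractional) auto
    then show ?thesis using False s far_energy_le_fractional[OF base, of \<sigma> \<eta> R] R by simp
  qed
  have near: "ennreal (\<eta> * (1 - \<eta>)) * ?near \<le> ennreal ((2 * R) powr ((s - \<eta>) * r)) * sobolev_pow s p \<Omega> u"
  proof (cases "s = 1")
    case True
    show ?thesis unfolding True
      by (rule sobolev_pow_1_ge[OF near_energy_le_gradient[OF base]]) (use s True R in auto)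
  next
    case False
    then have "sobolev_pow s p \<Omega> u = ennreal (s * (1 - s)) * (\<integral>\<^sup>+h. diff_energy r \<Omega> v h * ennreal (norm h powr (- (s * r) - real CARD('n))) \<partial>lborel)"
      using s by (intro sobolev_pow_fractional) auto
    then show ?thesis using False s near_energy_le_fractional[OF base, of \<eta> s R] R by simp
  qed
  have exps: "2 powr r * R powr ((\<sigma> - \<eta>) * r) = 2 powr (r * ((s - \<eta>) / (s - \<sigma>) * (\<eta> + 1 - \<sigma>)))"
    "(2 * R) powr ((s - \<eta>) * r) = 2 powr (r * ((s - \<eta>) / (s - \<sigma>) * (\<eta> + 1 - \<sigma>)))"
  proof -
    have e1: "e * (s - \<sigma>) = 1 + \<eta> - \<sigma>" using s by (simp add: e_def)
    have "r + (e - 1) * ((\<sigma> - \<eta>) * r) = r * ((1 + \<eta> - \<sigma>) + e * (\<sigma> - \<eta>))" by (simp add: algebra_simps)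
    also have "\<dots> = r * (e * (s - \<eta>))" unfolding e1[symmetric] by (simp add: algebra_simps)
    also have "e * (s - \<eta>) = (s - \<eta>) / (s - \<sigma>) * (\<eta> + 1 - \<sigma>)" by (simp add: e_def algebra_simps)
    finally show "2 powr r * R powr ((\<sigma> - \<eta>) * r) = 2 powr (r * ((s - \<eta>) / (s - \<sigma>) * (\<eta> + 1 - \<sigma>)))"
      by (simp add: R_def powr_powr flip: powr_add)
    have "2 * R = 2 powr e" by (simp add: R_def powr_diff)
    then show "(2 * R) powr ((s - \<eta>) * r) = 2 powr (r * ((s - \<eta>) / (s - \<sigma>) * (\<eta> + 1 - \<sigma>)))"
      by (simp add: powr_powr e_def algebra_simps)
  qed
  have "(\<integral>\<^sup>+h. ?w h \<partial>lborel) = (\<integral>\<^sup>+h. ?w h * indicator {h. R \<le> norm h} h + ?w h * indicator {h. norm h < R} h \<partial>lborel)"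
    by (intro nn_integral_cong) (auto simp: indicator_def)
  also have "\<dots> = ?far + ?near" by (rule nn_integral_add) measurable
  finally have "sobolev_pow \<eta> p \<Omega> u = ennreal (\<eta> * (1 - \<eta>)) * ?far + ennreal (\<eta> * (1 - \<eta>)) * ?near"
    using s by (subst sobolev_pow_fractional) (auto simp: distrib_left)
  also have "\<dots> \<le> ennreal (2 powr (r * ((s - \<eta>) / (s - \<sigma>) * (\<eta> + 1 - \<sigma>)))) * (sobolev_pow \<sigma> p \<Omega> u + sobolev_pow s p \<Omega> u)"
    unfolding distrib_left using far near unfolding exps by (rule add_mono)
  finally show ?thesis .
qed

lemma sobolev_seminorm_interpolation_finite:
  assumes s: "0 \<le> \<sigma>" "\<sigma> < \<eta>" "\<eta> < s" "s \<le> 1"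
  shows "sobolev_seminorm \<eta> p \<Omega> u \<le> ennreal (2 powr ((s - \<eta>) / (s - \<sigma>) * (\<eta> + 1 - \<sigma>)))
    * lp_sum p (sobolev_seminorm \<sigma> p \<Omega> u) (sobolev_seminorm s p \<Omega> u)"
proof -
  let ?E = "(s - \<eta>) / (s - \<sigma>) * (\<eta> + 1 - \<sigma>)"
  have "epow (sobolev_pow \<eta> p \<Omega> u) (1 / r) \<le> epow (ennreal (2 powr (r * ?E)) * (sobolev_pow \<sigma> p \<Omega> u + sobolev_pow s p \<Omega> u)) (1 / r)"
    using r by (intro epow_mono sobolev_pow_interpolation s) auto
  also have "\<dots> = ennreal (2 powr ?E) * epow (sobolev_pow \<sigma> p \<Omega> u + sobolev_pow s p \<Omega> u) (1 / r)"
    using r by (simp add: epow_mult_ennreal powr_powr)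
  finally show ?thesis
    using r by (simp add: sobolev_seminorm_def lp_sum_def p recip_def epow_inverse)
qed

end

section \<open>The exponent infinity\<close>

text \<open>The exceptional null set depends on the direction h. Fubini over pairs of points gives a
  set \<open>E\<close> of almost all x in \<Omega> such that the Lipschitz bound holds between x and
  almost every y. Two points of \<open>E\<close> are compared through a third point y close to the
  first; thus v is Lipschitz on all of \<open>E\<close>, and its extension to the closure covers
  \<Omega>.\<close>

lemma borel_weak_gradient_imp_Lipschitz:
  assumes \<Omega>: "ray_domain \<Omega>" and g: "borel_weak_gradient \<Omega> v g" and L: "\<And>x. norm (g x) \<le> L"
  obtains w where "AE x in lborel. x \<in> \<Omega> \<longrightarrow> w x = v x" "L-lipschitz_on \<Omega> w"
proof -
  interpret borel_weak_gradient \<Omega> v g by (rule g)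
  note vb = v_measurable
  have L0: "L \<ge> 0" using L[of 0] norm_ge_zero[of "g 0"] by linarith
  have op: "open \<Omega>" using \<Omega> unfolding ray_domain_def by blast
  have [measurable]: "\<Omega> \<in> sets borel" using op by simp
  define bad where "bad x y \<longleftrightarrow> x \<in> \<Omega> \<and> y \<in> \<Omega> \<and> \<bar>v y - v x\<bar> > L * norm (y - x)" for x y
  have [measurable]: "(\<lambda>z. bad (fst z) (snd z)) \<in> measurable (borel \<Otimes>\<^sub>M borel) (count_space UNIV)"
    unfolding bad_def by measurable
  let ?b = "\<lambda>x y. if bad x y then 1 else 0 :: ennreal"
  have bm[measurable]: "(\<lambda>z. ?b (fst z) (snd z)) \<in> borel_measurable (borel \<Otimes>\<^sub>M borel)" by measurable
  have bm1: "(\<lambda>x. ?b (f x) (k x)) \<in> borel_measurable M" if "f \<in> borel_measurable M" "k \<in> borel_measurable M" for f k and M :: "'c measure"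
    using measurable_compose[OF measurable_Pair[OF that] bm] by simp
  have zero: "(\<integral>\<^sup>+x. ?b x (x + h) \<partial>lborel) = 0" for h
  proof (induction h rule: ray_domain_induct[OF \<Omega> vb order_refl])
    case (1 h)
    have "AE x in lborel. x \<in> \<Omega> \<longrightarrow> \<bar>v (x + h) - v x\<bar> \<le> L * norm h"
      by (rule difference_le_sup_gradient[OF op _ L]) (rule 1)
    then have "AE x in lborel. ?b x (x + h) = 0"
      by eventually_elim (auto simp: bad_def)
    then show ?case by (subst nn_integral_cong_AE[where v="\<lambda>_. 0"]) auto
  next
    case (2 h)
    \<comment> \<open>The relation \<open>bad\<close> is symmetric in its two points, which settles
      the directions that point out of \<Omega>.\<close>
    have "(\<integral>\<^sup>+x. ?b x (x + h) \<partial>lborel) = (\<integral>\<^sup>+x. ?b (x + h) x \<partial>lborel)"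
      by (intro nn_integral_cong) (auto simp: bad_def abs_minus_commute norm_minus_commute)
    also have "\<dots> = (\<integral>\<^sup>+x. (\<lambda>x. ?b x (x + - h)) (h + x) \<partial>lborel)"
      by (simp add: add.commute)
    also have "\<dots> = (\<integral>\<^sup>+x. ?b x (x + - h) \<partial>lborel)"
      by (rule nn_integral_lborel_translation) (intro bm1; measurable)
    finally show ?case using 2 by simp
  qed
  have "(\<integral>\<^sup>+x. (\<integral>\<^sup>+y. ?b x y \<partial>lborel) \<partial>lborel) = (\<integral>\<^sup>+x. (\<integral>\<^sup>+h. ?b x (x + h) \<partial>lborel) \<partial>lborel)"
    by (intro nn_integral_cong nn_integral_lborel_translation[symmetric] bm1) auto
  also have "\<dots> = (\<integral>\<^sup>+h. (\<integral>\<^sup>+x. ?b x (x + h) \<partial>lborel) \<partial>lborel)"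
  proof (rule lborel_pair.Fubini')
    have "(\<lambda>z. ?b (snd z) (snd z + fst z)) \<in> borel_measurable (lborel \<Otimes>\<^sub>M lborel)"
      by (intro bm1) measurable
    then show "(\<lambda>(h, x). ?b x (x + h)) \<in> borel_measurable (lborel \<Otimes>\<^sub>M lborel)"
      by (simp add: split_beta)
  qed
  finally have "(\<integral>\<^sup>+x. (\<integral>\<^sup>+y. ?b x y \<partial>lborel) \<partial>lborel) = 0" by (simp add: zero)
  moreover have "(\<lambda>x. \<integral>\<^sup>+y. ?b x y \<partial>lborel) \<in> borel_measurable lborel"
    by (intro lborel.borel_measurable_nn_integral) (use bm in \<open>simp add: split_beta\<close>)
  ultimately have "AE x in lborel. (\<integral>\<^sup>+y. ?b x y \<partial>lborel) = 0"
    by (simp add: nn_integral_0_iff_AE)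
  moreover have "(AE y in lborel. \<not> bad x y)" if "(\<integral>\<^sup>+y. ?b x y \<partial>lborel) = 0" for x
  proof -
    have "(\<lambda>y. ?b x y) \<in> borel_measurable lborel" by (intro bm1) auto
    then have "AE y in lborel. ?b x y = 0" using that by (simp add: nn_integral_0_iff_AE)
    then show ?thesis by eventually_elim (simp split: if_splits)
  qed
  ultimately have good: "AE x in lborel. (AE y in lborel. \<not> bad x y)"
    by (auto elim: eventually_mono)
  define E where "E = {x\<in>\<Omega>. AE y in lborel. \<not> bad x y}"
  have lip: "L-lipschitz_on E v"
  proof (rule lipschitz_onI)
    fix x x' assume x: "x \<in> E" and x': "x' \<in> E"
    \<comment> \<open>Points y that are good for both x and x' lie in \<open>C\<close>. As
      \<open>C\<close> is closed and contains almost all of the open set \<Omega>, it contains y =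
      x, where the first term vanishes.\<close>
    define C where "C = {y. \<bar>v x - v x'\<bar> \<le> L * norm (y - x) + L * norm (y - x')}"
    have "AE y in lborel. \<not> bad x y \<and> \<not> bad x' y" using x x' by (simp add: E_def)
    then have "AE y in lborel. y \<in> \<Omega> \<longrightarrow> y \<in> C"
    proof eventually_elim
      case (elim y)
      have "x \<in> \<Omega>" "x' \<in> \<Omega>" using x x' by (auto simp: E_def)
      then show ?case using elim unfolding bad_def C_def by auto
    qed
    then have ae: "AE y\<in>\<Omega> in lebesgue. y \<in> C" by (rule AE_completion)
    have cl: "closed C" unfolding C_def by (intro closed_Collect_le continuous_intros)
    have "x \<in> \<Omega>" using x by (simp add: E_def)
    then have "x \<in> C" by (rule mem_closed_if_AE_lebesgue_open[OF op cl ae])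
    then show "dist (v x) (v x') \<le> L * dist x x'" by (simp add: C_def dist_norm)
  qed (rule L0)
  obtain w where w: "L-lipschitz_on (closure E) w" "\<forall>x\<in>E. w x = v x"
    using lipschitz_extend_closure[OF lip] by blast
  have EA: "AE x in lborel. x \<in> \<Omega> \<longrightarrow> x \<in> E"
    using good by eventually_elim (simp add: E_def)
  then have "AE x\<in>\<Omega> in lebesgue. x \<in> closure E"
    using AE_completion[OF EA] closure_subset[of E] by (auto elim: eventually_mono)
  then have "\<Omega> \<subseteq> closure E" using mem_closed_if_AE_lebesgue_open[OF op closed_closure] by blast
  then have "L-lipschitz_on \<Omega> w" using w(1) lipschitz_on_subset by blast
  moreover have "AE x in lborel. x \<in> \<Omega> \<longrightarrow> w x = v x"
    using EA by eventually_elim (use w(2) in auto)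
  ultimately show ?thesis using that by blast
qed

section \<open>Hoelder quotients of a fixed representative\<close>

definition hoelder_quotient :: "real \<Rightarrow> (real ^ 'n::finite) set \<Rightarrow> (real ^ 'n \<Rightarrow> real) \<Rightarrow> ennreal" where
  "hoelder_quotient s \<Omega> v = (SUP x\<in>\<Omega>. SUP y\<in>\<Omega> - {x}. ennreal (\<bar>v x - v y\<bar> / norm (x - y) powr s))"

lemma hoelder_quotient_le_iff:
  assumes "c \<ge> 0"
  shows "hoelder_quotient s \<Omega> v \<le> ennreal c \<longleftrightarrow> (\<forall>x\<in>\<Omega>. \<forall>y\<in>\<Omega>. \<bar>v x - v y\<bar> \<le> c * norm (x - y) powr s)"
proof -
  have *: "ennreal (\<bar>v x - v y\<bar> / norm (x - y) powr s) \<le> ennreal c \<longleftrightarrow> \<bar>v x - v y\<bar> \<le> c * norm (x - y) powr s" if "x \<noteq> y" for x y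
    using assms that by (simp add: ennreal_le_iff pos_divide_le_eq)
  have "hoelder_quotient s \<Omega> v \<le> ennreal c \<longleftrightarrow> (\<forall>x\<in>\<Omega>. \<forall>y\<in>\<Omega> - {x}. \<bar>v x - v y\<bar> \<le> c * norm (x - y) powr s)"
    unfolding hoelder_quotient_def SUP_le_iff by (intro ball_cong refl *) auto
  also have "\<dots> \<longleftrightarrow> (\<forall>x\<in>\<Omega>. \<forall>y\<in>\<Omega>. \<bar>v x - v y\<bar> \<le> c * norm (x - y) powr s)"
  proof (rule ball_cong[OF refl], rule iffI, rule ballI)
    fix x y assume xy: "\<forall>y\<in>\<Omega> - {x}. \<bar>v x - v y\<bar> \<le> c * norm (x - y) powr s" "y \<in> \<Omega>"
    show "\<bar>v x - v y\<bar> \<le> c * norm (x - y) powr s"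
      using xy by (cases "y = x") auto
  qed auto
  finally show ?thesis .
qed

lemma hoelder_seminorm_le:
  assumes "AE x in lebesgue_on \<Omega>. v x = u x" "c \<ge> 0"
    and "\<And>x y. x \<in> \<Omega> \<Longrightarrow> y \<in> \<Omega> \<Longrightarrow> \<bar>v x - v y\<bar> \<le> c * norm (x - y) powr s"
  shows "hoelder_seminorm s \<Omega> u \<le> ennreal c"
proof -
  have "hoelder_seminorm s \<Omega> u \<le> hoelder_quotient s \<Omega> v"
    unfolding hoelder_seminorm_def hoelder_quotient_def using assms(1) by (intro INF_lower) simp
  also have "\<dots> \<le> ennreal c" using assms by (simp add: hoelder_quotient_le_iff)
  finally show ?thesis .
qed

text \<open>The infimum over representatives is not known to be attained, hence the strict bound in
  the premise. It will be used with M + e in place of M, for every e > 0.\<close>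

lemma hoelder_seminorm_less:
  assumes "hoelder_seminorm s \<Omega> u < ennreal c"
  obtains v where "AE x in lebesgue_on \<Omega>. v x = u x" "\<And>x y. x \<in> \<Omega> \<Longrightarrow> y \<in> \<Omega> \<Longrightarrow> \<bar>v x - v y\<bar> \<le> c * norm (x - y) powr s"
proof -
  have c: "c \<ge> 0" using assms by (metis ennreal_neg linorder_not_le not_less_zero nle_le)
  obtain v where "AE x in lebesgue_on \<Omega>. v x = u x" "hoelder_quotient s \<Omega> v < ennreal c"
    using assms unfolding hoelder_seminorm_def hoelder_quotient_def[symmetric] INF_less_iff by auto
  then show ?thesis using that hoelder_quotient_le_iff[OF c, of s \<Omega> v] by (simp add: less_imp_le)
qed

lemma hoelder_seminorm_1_le_grad_norm:
  fixes u v :: "real ^ 'n::finite \<Rightarrow> real"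
  assumes \<Omega>: "ray_domain \<Omega>" and u: "u \<in> borel_measurable lebesgue"
    and v: "locally_integrable_on UNIV v" and uv: "AE x in lborel. u x = v x"
  shows "hoelder_seminorm 1 \<Omega> u \<le> grad_norm \<infinity> \<Omega> u"
  unfolding grad_norm_def
proof (rule INF_greatest)
  fix g assume "g \<in> {g. weak_gradient \<Omega> u g}"
  then have g: "weak_gradient \<Omega> u g" by simp
  have op: "open \<Omega>" using \<Omega> unfolding ray_domain_def by blast
  have \<Omega>b: "\<Omega> \<in> sets borel" using op by simp
  show "hoelder_seminorm 1 \<Omega> u \<le> Lp_norm \<infinity> \<Omega> g"
  proof (cases "Lp_norm \<infinity> \<Omega> g")
    case (real L)
    have gm: "g \<in> borel_measurable (lebesgue_on \<Omega>)" using g by (simp add: weak_gradient_def)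
    have "AE x in lebesgue_on \<Omega>. ennreal (norm (g x)) \<le> esssup (lebesgue_on \<Omega>) (\<lambda>x. ennreal (norm (g x)))"
      by (rule esssup_AE)
    then have gL: "AE x in lebesgue_on \<Omega>. norm (g x) \<le> L"
      using real by (simp add: Lp_norm_def)
    obtain g0 where g0: "g0 \<in> borel_measurable borel" "AE x in lebesgue_on \<Omega>. g x = g0 x"
      using borel_version_vector[OF \<Omega>b gm] by blast
    \<comment> \<open>The Lipschitz bound is available for a gradient bounded at every point.
      Setting \<open>g0\<close> to 0 where its norm exceeds L changes it on \<Omega> only in a null
      set.\<close>
    define g1 where "g1 x = (if norm (g0 x) \<le> L then g0 x else 0)" for x
    have "g1 \<in> borel_measurable borel" unfolding g1_def using g0(1) by measurable
    moreover have "AE x in lebesgue_on \<Omega>. g x = g1 x"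
      using gL g0(2) by eventually_elim (simp add: g1_def)
    ultimately have wg: "borel_weak_gradient \<Omega> v g1"
      by (rule borel_version_weak_gradient[OF op g u v uv])
    have g1L: "norm (g1 x) \<le> L" for x using real by (simp add: g1_def)
    obtain w where w: "AE x in lborel. x \<in> \<Omega> \<longrightarrow> w x = v x" "L-lipschitz_on \<Omega> w"
      using borel_weak_gradient_imp_Lipschitz[OF \<Omega> wg g1L] by blast
    have "AE x in lborel. x \<in> \<Omega> \<longrightarrow> w x = u x"
      using w(1) uv by eventually_elim simp
    then have "AE x in lebesgue_on \<Omega>. w x = u x"
      using \<Omega>b by (simp add: AE_lebesgue_on_iff AE_completion)
    then have "hoelder_seminorm 1 \<Omega> u \<le> ennreal L"
      using real lipschitz_onD[OF w(2)] by (intro hoelder_seminorm_le) (auto simp: dist_norm)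
    then show ?thesis using real by simp
  qed simp
qed

text \<open>The inequality defines a closed set of points y that contains almost every point of the
  open set \<Omega>, hence all of it; y = x makes both powers vanish. This turns almost everywhere
  statements about Hoelder continuous representatives into pointwise ones.\<close>

lemma hoelder_AE_bound:
  assumes op: "open \<Omega>" and s: "s > 0" "s' > 0" and x: "x \<in> \<Omega>"
    and ae: "AE y in lebesgue_on \<Omega>. c \<le> a * norm (x - y) powr s + b * norm (x - y) powr s' + e"
  shows "c \<le> (e :: real)"
proof -
  let ?C = "{y. c \<le> a * norm (x - y) powr s + b * norm (x - y) powr s' + e}"
  have "AE y\<in>\<Omega> in lebesgue. y \<in> ?C" using ae op by (simp add: AE_lebesgue_on_iff)
  moreover have "closed ?C"
    using s by (intro closed_Collect_le continuous_intros continuous_on_powr') auto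
  ultimately have "x \<in> ?C" using mem_closed_if_AE_lebesgue_open[OF op] x by blast
  then show ?thesis using s by simp
qed

text \<open>Geometric mean of the two bounds: a = a^t a^{1-t} with t = (s - \<eta>)/(s - \<sigma>),
  for which \<sigma> t + s (1 - t) = \<eta>. The factor 2 in the first bound is that of |w x - w y|
  \<le> 2 sup |w| for \<sigma> = 0.\<close>

lemma interpolate_powr:
  fixes a M d :: real
  assumes s: "\<sigma> < \<eta>" "\<eta> < s" and d: "d > 0" and a: "0 \<le> a" and M: "M \<ge> 0"
    and 1: "a \<le> 2 * M * d powr \<sigma>" and 2: "a \<le> M * d powr s"
  shows "a \<le> 2 powr ((s - \<eta>) / (s - \<sigma>)) * M * d powr \<eta>"
proof (cases "a = 0 \<or> M = 0")
  case True
  then show ?thesis using a M d 2 by auto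
next
  case False
  define t where "t = (s - \<eta>) / (s - \<sigma>)"
  have t: "0 < t" "t < 1" using s by (auto simp: t_def)
  have te: "\<sigma> * t + s * (1 - t) = \<eta>"
  proof -
    have "t * (s - \<sigma>) = s - \<eta>" using s by (simp add: t_def)
    then show ?thesis by (simp add: algebra_simps)
  qed
  have "a = a powr t * a powr (1 - t)" using False a by (simp flip: powr_add)
  also have "\<dots> \<le> (2 * M * d powr \<sigma>) powr t * (M * d powr s) powr (1 - t)"
    using t a 1 2 by (intro mult_mono powr_mono2) auto
  also have "\<dots> = 2 powr t * (M powr t * M powr (1 - t)) * (d powr (\<sigma> * t) * d powr (s * (1 - t)))"
    using M d by (simp add: powr_mult powr_powr mult_ac)
  also have "M powr t * M powr (1 - t) = M" using False M by (simp flip: powr_add)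
  also have "d powr (\<sigma> * t) * d powr (s * (1 - t)) = d powr \<eta>" by (simp add: te flip: powr_add)
  finally show ?thesis by (simp add: t_def)
qed

lemma sobolev_seminorm_interpolation_infinite:
  fixes u v :: "real ^ 'n::finite \<Rightarrow> real"
  assumes \<Omega>: "ray_domain \<Omega>" and u: "u \<in> borel_measurable lebesgue"
    and v: "locally_integrable_on UNIV v" and uv: "AE x in lborel. u x = v x"
    and s: "0 \<le> \<sigma>" "\<sigma> < \<eta>" "\<eta> < s" "s \<le> 1"
  shows "sobolev_seminorm \<eta> \<infinity> \<Omega> u \<le> ennreal (2 powr ((s - \<eta>) / (s - \<sigma>)))
    * max (sobolev_seminorm \<sigma> \<infinity> \<Omega> u) (sobolev_seminorm s \<infinity> \<Omega> u)"
proof (cases "max (sobolev_seminorm \<sigma> \<infinity> \<Omega> u) (sobolev_seminorm s \<infinity> \<Omega> u)")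
  case top
  then show ?thesis by (simp add: ennreal_mult_top)
next
  case (real M)
  let ?c = "2 powr ((s - \<eta>) / (s - \<sigma>))"
  have op: "open \<Omega>" using \<Omega> unfolding ray_domain_def by blast
  have hs: "hoelder_seminorm t \<Omega> u \<le> ennreal M" if "t = s \<or> t = \<sigma> \<and> \<sigma> > 0" for t
  proof -
    have "hoelder_seminorm t \<Omega> u \<le> sobolev_seminorm t \<infinity> \<Omega> u"
      using that s hoelder_seminorm_1_le_grad_norm[OF \<Omega> u v uv] by (auto simp: sobolev_seminorm_def)
    also have "\<dots> \<le> ennreal M" unfolding real(2)[symmetric] using that by (auto simp: max.coboundedI1 max.coboundedI2)
    finally show ?thesis .
  qed
  have bound: "hoelder_seminorm \<eta> \<Omega> u \<le> ennreal (?c * (M + e))" if e: "e > 0" for e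
  proof -
    have Me: "ennreal M < ennreal (M + e)" using real e by (simp add: ennreal_less_iff)
    obtain w where w: "AE x in lebesgue_on \<Omega>. w x = u x" "\<And>x y. x \<in> \<Omega> \<Longrightarrow> y \<in> \<Omega> \<Longrightarrow> \<bar>w x - w y\<bar> \<le> (M + e) * norm (x - y) powr s"
      using hoelder_seminorm_less[OF le_less_trans[OF hs Me], of s] by blast
    \<comment> \<open>For \<sigma> = 0 the bound comes from the essential supremum, and the 2 from
      adding two values. For \<sigma> > 0 it is the Hoelder bound of order \<sigma>, weakened by 2
      so that both cases have one form.\<close>
    have low: "\<bar>w x - w y\<bar> \<le> 2 * (M + e) * norm (x - y) powr \<sigma>" if xy: "x \<in> \<Omega>" "y \<in> \<Omega>" "x \<noteq> y" for x y
    proof (cases "\<sigma> = 0")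
      case True
      have "AE x in lebesgue_on \<Omega>. ennreal (norm (u x)) \<le> esssup (lebesgue_on \<Omega>) (\<lambda>x. ennreal (norm (u x)))"
        by (rule esssup_AE)
      moreover have "esssup (lebesgue_on \<Omega>) (\<lambda>x. ennreal (norm (u x))) \<le> ennreal M"
        unfolding real(2)[symmetric] using True by (simp add: sobolev_seminorm_def Lp_norm_def)
      ultimately have uM: "AE x in lebesgue_on \<Omega>. \<bar>u x\<bar> \<le> M"
        using real(1) by (auto elim!: eventually_mono dest: order_trans simp: ennreal_le_iff)
      have wM: "\<bar>w x\<bar> \<le> M" if "x \<in> \<Omega>" for x
      proof (rule hoelder_AE_bound[OF op _ _ that, where a="M + e" and b=0 and s=s and s'=s])
        have "AE y in lebesgue_on \<Omega>. y \<in> \<Omega>" using op by (simp add: AE_lebesgue_on_iff)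
        then show "AE y in lebesgue_on \<Omega>. \<bar>w x\<bar> \<le> (M + e) * norm (x - y) powr s + 0 * norm (x - y) powr s + M"
          using uM w(1)
        proof eventually_elim
          case (elim y)
          then show ?case using w(2)[OF that, of y] by simp
        qed
      qed (use s in auto)
      show ?thesis using wM[OF xy(1)] wM[OF xy(2)] xy True e by simp
    next
      case False
      then have \<sigma>: "\<sigma> > 0" using s by simp
      obtain w' where w': "AE x in lebesgue_on \<Omega>. w' x = u x" "\<And>x y. x \<in> \<Omega> \<Longrightarrow> y \<in> \<Omega> \<Longrightarrow> \<bar>w' x - w' y\<bar> \<le> (M + e) * norm (x - y) powr \<sigma>"
        using hoelder_seminorm_less[OF le_less_trans[OF hs Me], of \<sigma>] \<sigma> by blast
      \<comment> \<open>The infima for \<sigma> and for s may be approached by different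
        representatives. Both are continuous and agree almost everywhere, hence on \<Omega>.\<close>
      have ww: "w x = w' x" if "x \<in> \<Omega>" for x
      proof -
        have "\<bar>w x - w' x\<bar> \<le> 0"
        proof (rule hoelder_AE_bound[OF op _ _ that, where a="M + e" and b="M + e" and s=s and s'=\<sigma>])
          have "AE y in lebesgue_on \<Omega>. y \<in> \<Omega>" using op by (simp add: AE_lebesgue_on_iff)
          then show "AE y in lebesgue_on \<Omega>. \<bar>w x - w' x\<bar> \<le> (M + e) * norm (x - y) powr s + (M + e) * norm (x - y) powr \<sigma> + 0"
            using w(1) w'(1)
          proof eventually_elim
            case (elim y)
            then show ?case using w(2)[OF that, of y] w'(2)[OF that, of y] by simp
          qed
        qed (use s \<sigma> in auto)
        then show ?thesis by simp
      qed
      have "\<bar>w x - w y\<bar> \<le> (M + e) * norm (x - y) powr \<sigma>"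
        using w'(2)[OF xy(1,2)] ww xy by simp
      also have "\<dots> \<le> 2 * (M + e) * norm (x - y) powr \<sigma>"
        using real e by (intro mult_right_mono) auto
      finally show ?thesis .
    qed
    show ?thesis
    proof (rule hoelder_seminorm_le[OF w(1)])
      show "0 \<le> ?c * (M + e)" using real e by simp
      show "\<bar>w x - w y\<bar> \<le> ?c * (M + e) * norm (x - y) powr \<eta>" if xy: "x \<in> \<Omega>" "y \<in> \<Omega>" for x y
      proof (cases "x = y")
        case False
        then show ?thesis
          using xy s real e w(2)[OF xy] low[OF xy False] by (intro interpolate_powr) auto
      qed simp
    qed
  qed
  have "hoelder_seminorm \<eta> \<Omega> u \<le> ennreal (?c * M)"
  proof (rule ennreal_le_epsilon)
    fix e :: real assume e: "e > 0"
    have "hoelder_seminorm \<eta> \<Omega> u \<le> ennreal (?c * (M + e / ?c))" using e by (intro bound) simp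
    also have "?c * (M + e / ?c) = ?c * M + e" by (simp add: field_simps)
    also have "ennreal (?c * M + e) = ennreal (?c * M) + ennreal e" using real e by simp
    finally show "hoelder_seminorm \<eta> \<Omega> u \<le> ennreal (?c * M) + ennreal e" .
  qed
  moreover have "sobolev_seminorm \<eta> \<infinity> \<Omega> u = hoelder_seminorm \<eta> \<Omega> u" using s by (simp add: sobolev_seminorm_def)
  ultimately show ?thesis using real by (simp add: ennreal_mult)
qed

section \<open>The interpolation inequality\<close>

lemma sobolev_seminorm_interpolation:
  fixes u :: "real ^ 'n::finite \<Rightarrow> real"
  assumes \<Omega>: "ray_domain \<Omega>" and p: "1 \<le> p" and u: "u \<in> Lp_space p UNIV"
    and s: "0 \<le> \<sigma>" "\<sigma> < \<eta>" "\<eta> < s" "s \<le> 1"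
  shows "sobolev_seminorm \<eta> p \<Omega> u \<le> ennreal (2 powr ((s - \<eta>) / (s - \<sigma>) * (\<eta> + 1 - \<sigma>)))
    * lp_sum p (sobolev_seminorm \<sigma> p \<Omega> u) (sobolev_seminorm s p \<Omega> u)"
proof -
  obtain v where v: "u \<in> borel_measurable lebesgue" "AE x in lborel. u x = v x" "locally_integrable_on UNIV v"
    using Lp_space_borel_version[OF u p] by blast
  show ?thesis
  proof (cases p)
    case (real r)
    then have "r \<ge> 1" using p by simp
    then show ?thesis
      by (intro sobolev_seminorm_interpolation_finite[OF \<Omega> v(1,3,2) real(2)] s)
  next
    case top
    \<comment> \<open>As \<eta> + 1 - \<sigma> \<ge> 1, the exponent found for p = \<infinity> is at
      most the one for finite p.\<close>
    have "(s - \<eta>) / (s - \<sigma>) * 1 \<le> (s - \<eta>) / (s - \<sigma>) * (\<eta> + 1 - \<sigma>)"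
      using s by (intro mult_left_mono) auto
    then have "ennreal (2 powr ((s - \<eta>) / (s - \<sigma>))) \<le> ennreal (2 powr ((s - \<eta>) / (s - \<sigma>) * (\<eta> + 1 - \<sigma>)))"
      by (intro ennreal_leI powr_mono) auto
    then have "ennreal (2 powr ((s - \<eta>) / (s - \<sigma>))) * max (sobolev_seminorm \<sigma> \<infinity> \<Omega> u) (sobolev_seminorm s \<infinity> \<Omega> u)
      \<le> ennreal (2 powr ((s - \<eta>) / (s - \<sigma>) * (\<eta> + 1 - \<sigma>))) * max (sobolev_seminorm \<sigma> \<infinity> \<Omega> u) (sobolev_seminorm s \<infinity> \<Omega> u)"
      by (rule mult_right_mono) simp
    with sobolev_seminorm_interpolation_infinite[OF \<Omega> v(1,3,2) s]
    show ?thesis using top by (simp add: lp_sum_def)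
  qed
qed

section \<open>Bounds of the constants\<close>

lemma recip_nonneg: "recip p \<ge> 0"
  by (simp add: recip_def)

text \<open>Put \<theta> = (\<eta> - \<sigma>)/(s - \<sigma>). As s - \<sigma> \<le> 1, one has
  \<eta> - \<sigma> \<le> \<theta> and E \<le> (1 - \<theta>)(1 + \<theta>) \<le> 1. The remaining
  factor of N is the 1/p-th power of X = (1/\<theta>)^\<theta> (1/(1-\<theta>))^{1-\<theta>}. Both
  bases are at least 1, hence X \<ge> 1; the weighted inequality between geometric and arithmetic
  mean gives X \<le> 1 + 1.\<close>

lemma N_const_bounds:
  assumes s: "0 \<le> \<sigma>" "\<sigma> < \<eta>" "\<eta> < s" "s \<le> 1"
  defines "E \<equiv> (s - \<eta>) / (s - \<sigma>) * (\<eta> + 1 - \<sigma>)"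
  shows "E \<le> 1" and "2 powr E \<le> N_const p \<sigma> \<eta> s" and "N_const p \<sigma> \<eta> s \<le> 2 powr (1 + recip p)"
proof -
  define \<theta> where "\<theta> = (\<eta> - \<sigma>) / (s - \<sigma>)"
  have \<theta>: "0 < \<theta>" "\<theta> < 1" using s by (auto simp: \<theta>_def)
  have c: "(s - \<eta>) / (s - \<sigma>) = 1 - \<theta>" using s by (simp add: \<theta>_def field_simps)
  have i: "(s - \<sigma>) / (\<eta> - \<sigma>) = 1 / \<theta>" "(s - \<sigma>) / (s - \<eta>) = 1 / (1 - \<theta>)"
    unfolding c[symmetric] by (simp_all add: \<theta>_def)
  have "\<eta> - \<sigma> = \<theta> * (s - \<sigma>)" using s by (simp add: \<theta>_def)
  also have "\<dots> \<le> \<theta> * 1" using \<theta> s by (intro mult_left_mono) auto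
  finally have "E \<le> (1 - \<theta>) * (1 + \<theta>)"
    unfolding E_def c using \<theta> by (intro mult_left_mono) auto
  also have "\<dots> = 1 - \<theta>\<^sup>2" by (simp add: algebra_simps power2_eq_square)
  finally show E1: "E \<le> 1" by (smt (verit) zero_le_power2)
  define X where "X = (1 / \<theta>) powr \<theta> * (1 / (1 - \<theta>)) powr (1 - \<theta>)"
  have N: "N_const p \<sigma> \<eta> s = 2 powr E * X powr recip p"
    unfolding N_const_def X_def i c E_def \<theta>_def[symmetric] using \<theta> by (simp add: powr_mult powr_powr mult_ac)
  have "X \<ge> 1 * 1"
    unfolding X_def using \<theta> by (intro mult_mono ge_one_powr_ge_zero) auto
  then have X1: "X \<ge> 1" by simp
  have "X \<le> \<theta> * (1 / \<theta>) + (1 - \<theta>) * (1 / (1 - \<theta>))"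
    unfolding X_def using \<theta> by (intro Youngs_inequality_0) auto
  then have X2: "X \<le> 2" using \<theta> by simp
  have "2 powr E * 1 \<le> 2 powr E * X powr recip p"
    using X1 by (intro mult_left_mono ge_one_powr_ge_zero recip_nonneg) auto
  then show "2 powr E \<le> N_const p \<sigma> \<eta> s" by (simp add: N)
  have "2 powr E * X powr recip p \<le> 2 powr 1 * 2 powr recip p"
    using X1 X2 E1 by (intro mult_mono powr_mono powr_mono2 recip_nonneg) auto
  then show "N_const p \<sigma> \<eta> s \<le> 2 powr (1 + recip p)" by (simp add: N powr_add)
qed

text \<open>With S the sphere area, 2S + 1 dominates both the coefficient 2S/p of the norm and the
  coefficient 1 of B; being at least 1, it also dominates its own 1/p-th power. For p = \<infinity>
  the seminorm of order 0 is the norm itself.\<close>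

lemma lp_sum_0_le_Lp_norm:
  fixes u :: "real ^ 'n::finite \<Rightarrow> real"
  assumes p: "1 \<le> p"
  shows "lp_sum p (sobolev_seminorm 0 p \<Omega> u) B \<le> ennreal (2 * sphere_area CARD('n) + 1) * lp_sum p (Lp_norm p \<Omega> u) B"
proof -
  let ?S = "sphere_area CARD('n)"
  have S: "?S \<ge> 0" by (simp add: sphere_area_def Gamma_real_nonneg)
  show ?thesis
  proof (cases p)
    case (real r)
    then have r: "r \<ge> 1" using p by simp
    have pos: "2 * ?S + 1 > 0" using S by simp
    have "2 * ?S / r \<le> 2 * ?S / 1" using r S by (intro divide_left_mono) auto
    have le: "ennreal (2 * ?S / r) * epow (Lp_norm p \<Omega> u) r + epow B r \<le> ennreal (2 * ?S + 1) * (epow (Lp_norm p \<Omega> u) r + epow B r)"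
    proof -
      have "ennreal (2 * ?S / r) \<le> ennreal (2 * ?S + 1)"
        using \<open>2 * ?S / r \<le> 2 * ?S / 1\<close> by (intro ennreal_leI) simp
      moreover have "1 \<le> ennreal (2 * ?S + 1)" using S by (simp add: ennreal_ge_1)
      ultimately have "ennreal (2 * ?S / r) * epow (Lp_norm p \<Omega> u) r + 1 * epow B r \<le> ennreal (2 * ?S + 1) * epow (Lp_norm p \<Omega> u) r + ennreal (2 * ?S + 1) * epow B r"
        by (intro add_mono mult_right_mono) auto
      then show ?thesis by (simp add: distrib_left)
    qed
    have "lp_sum p (sobolev_seminorm 0 p \<Omega> u) B = epow (ennreal (2 * ?S / r) * epow (Lp_norm p \<Omega> u) r + epow B r) (1 / r)"
      using real r by (simp add: lp_sum_def sobolev_seminorm_def sobolev_pow_def recip_def epow_inverse)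
    also have "\<dots> \<le> epow (ennreal (2 * ?S + 1) * (epow (Lp_norm p \<Omega> u) r + epow B r)) (1 / r)"
      using r le by (intro epow_mono) auto
    also have "\<dots> = ennreal ((2 * ?S + 1) powr (1 / r)) * lp_sum p (Lp_norm p \<Omega> u) B"
      unfolding epow_mult_ennreal[OF pos] using r real by (simp add: lp_sum_def recip_def)
    also have "\<dots> \<le> ennreal (2 * ?S + 1) * lp_sum p (Lp_norm p \<Omega> u) B"
    proof (intro mult_right_mono ennreal_leI)
      have "(2 * ?S + 1) powr (1 / r) \<le> (2 * ?S + 1) powr 1"
        using r S by (intro powr_mono) auto
      then show "(2 * ?S + 1) powr (1 / r) \<le> 2 * ?S + 1" using S by simp
    qed simp
    finally show ?thesis .
  next
    case top
    have "1 * max (Lp_norm p \<Omega> u) B \<le> ennreal (2 * ?S + 1) * max (Lp_norm p \<Omega> u) B"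
      using S by (intro mult_right_mono) (auto simp: ennreal_ge_1)
    then show ?thesis using top by (simp add: lp_sum_def sobolev_seminorm_def)
  qed
qed

lemma ennreal_mult_le_trans:
  assumes "x \<le> ennreal a * y" "a \<le> b"
  shows "x \<le> ennreal b * y"
  using assms by (meson ennreal_leI mult_right_mono order_trans zero_le)

theorem corollary5p6:
  fixes u :: "real ^ 'n::finite \<Rightarrow> real" and k :: 'n
    and p :: ennreal and \<sigma> \<eta> s :: real
  assumes "1 \<le> p"
    and "u \<in> Lp_space p UNIV"
    and "0 \<le> \<sigma>" and "\<sigma> < \<eta>" and "\<eta> < s" and "s \<le> 1"
  shows "sobolev_seminorm \<eta> p UNIV u
       \<le> ennreal (kappa_const CARD('n) p * N_const p \<sigma> \<eta> s)
         * lp_sum p (sobolev_seminorm \<sigma> p UNIV u) (sobolev_seminorm s p UNIV u)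
    \<and> sobolev_seminorm \<eta> p (half_space k) u
       \<le> ennreal (4 powr recip p * kappa_const CARD('n) p * N_const p \<sigma> \<eta> s)
         * lp_sum p (sobolev_seminorm \<sigma> p (half_space k) u) (sobolev_seminorm s p (half_space k) u)
    \<and> N_const p \<sigma> \<eta> s \<le> 2 powr (1 + recip p)
    \<and> (\<sigma> = 0 \<longrightarrow>
         sobolev_seminorm \<eta> p UNIV u
           \<le> ennreal (2 powr (1 + 2 * recip p) * (2 * sphere_area CARD('n) + 1))
             * lp_sum p (Lp_norm p UNIV u) (sobolev_seminorm s p UNIV u)
       \<and> sobolev_seminorm \<eta> p (half_space k) u
           \<le> ennreal (2 powr (1 + 4 * recip p) * (2 * sphere_area CARD('n) + 1))
             * lp_sum p (Lp_norm p (half_space k) u) (sobolev_seminorm s p (half_space k) u))"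
proof -
  let ?E = "(s - \<eta>) / (s - \<sigma>) * (\<eta> + 1 - \<sigma>)" and ?S = "sphere_area CARD('n)"
  note main = sobolev_seminorm_interpolation[OF _ assms]
  note N = N_const_bounds[OF assms(3-6)]
  have S: "?S \<ge> 0" by (simp add: sphere_area_def Gamma_real_nonneg)
  have N0: "N_const p \<sigma> \<eta> s \<ge> 0" using order_trans[OF powr_ge_zero N(2)] .
  \<comment> \<open>The factors \<open>kappa_const\<close> and 4^{1/p} are at least 1, so the
    constants for both domains dominate N and with it 2^E.\<close>
  have "kappa_const CARD('n) p \<ge> 1"
    using recip_nonneg[of p] by (auto simp: kappa_const_def intro: ge_one_powr_ge_zero)
  then have "1 * N_const p \<sigma> \<eta> s \<le> kappa_const CARD('n) p * N_const p \<sigma> \<eta> s"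
    using N0 by (rule mult_right_mono)
  then have k1: "N_const p \<sigma> \<eta> s \<le> kappa_const CARD('n) p * N_const p \<sigma> \<eta> s" by simp
  have "1 * (kappa_const CARD('n) p * N_const p \<sigma> \<eta> s) \<le> 4 powr recip p * (kappa_const CARD('n) p * N_const p \<sigma> \<eta> s)"
    using N0 k1 recip_nonneg[of p] by (intro mult_right_mono ge_one_powr_ge_zero) auto
  then have k2: "kappa_const CARD('n) p * N_const p \<sigma> \<eta> s \<le> 4 powr recip p * kappa_const CARD('n) p * N_const p \<sigma> \<eta> s"
    by (simp add: mult.assoc)
  \<comment> \<open>The exponent E is at most 1, hence at most 1 + c/p; the cases c = 2 and c = 4
    are the two inequalities for \<sigma> = 0.\<close>
  have zero: "sobolev_seminorm \<eta> p \<Omega> u \<le> ennreal (2 powr (1 + c * recip p) * (2 * ?S + 1)) * lp_sum p (Lp_norm p \<Omega> u) (sobolev_seminorm s p \<Omega> u)"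
    if \<Omega>: "ray_domain \<Omega>" and \<sigma>: "\<sigma> = 0" and c: "c \<ge> 0" for \<Omega> and c :: real
  proof -
    have "sobolev_seminorm \<eta> p \<Omega> u \<le> ennreal (2 powr ?E) * lp_sum p (sobolev_seminorm 0 p \<Omega> u) (sobolev_seminorm s p \<Omega> u)"
      using main[OF \<Omega>] unfolding \<sigma> .
    also have "\<dots> \<le> ennreal (2 powr (1 + c * recip p)) * (ennreal (2 * ?S + 1) * lp_sum p (Lp_norm p \<Omega> u) (sobolev_seminorm s p \<Omega> u))"
    proof (rule mult_mono)
      have "?E \<le> 1 + c * recip p" using N(1) mult_nonneg_nonneg[OF c recip_nonneg[of p]] by linarith
      then show "ennreal (2 powr ?E) \<le> ennreal (2 powr (1 + c * recip p))"
        by (intro ennreal_leI powr_mono) auto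
    qed (use lp_sum_0_le_Lp_norm[OF assms(1)] in auto)
    also have "\<dots> = ennreal (2 powr (1 + c * recip p) * (2 * ?S + 1)) * lp_sum p (Lp_norm p \<Omega> u) (sobolev_seminorm s p \<Omega> u)"
      using S by (intro ennreal_mult_assoc[symmetric]) simp
    finally show ?thesis .
  qed
  show ?thesis
    using ennreal_mult_le_trans[OF main[OF ray_domain_UNIV] order_trans[OF N(2) k1]]
      ennreal_mult_le_trans[OF main[OF ray_domain_half_space] order_trans[OF N(2) order_trans[OF k1 k2]]]
      N(3) zero[OF ray_domain_UNIV, of 2] zero[OF ray_domain_half_space, of 4]
    by simp
qed

end
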